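(* Let $G$ be a residually finite countably infinite group and let $X\subset\Sigma^G$ be any subshift of finite type with the eventual filling property (EFP). Then: (1) $\hat{\mathfrak L}(X)$ is simple; (2) $\hat{\mathfrak L}(X)$ equals the commutator subgroup of $\mathfrak L(X)$; (3) $\hat{\mathfrak L}(X)$ and $\mathfrak L(X)$ are normal subgroups of $\mathrm{SAut}(X)$; (4) $\hat{\mathfrak L}(X)$ is the monolith of $\mathfrak L(X)$ and also the monolith of $\mathrm{SAut}(X)$.
   Context: $\Sigma$ is a finite alphabet, $\Sigma^G$ has the product topology, and $G$ acts by $\sigma_g(x)_h=x_{hg}$. A subshift is a nonempty closed $G$-invariant set $X\subset\Sigma^G$; it is a subshift of finite type (SFT) if $X=\bigcap_{g\in G}\sigma_g(C)$ for some clopen $C\subset\Sigma^G$. For $D\subset G$, $x|D$ is the restriction of $x$ to $D$ and $X|D=\{x|D:x\in X\}$. EFP: for every finite $F\subset G$ there is a finite $N\subset G$ such that for all $x,y\in X$ there is $z\in X$ with $z|F=x|F$ and $z|(G\setminus N)=y|(G\setminus N)$. A gate on $X$ is a homeomorphism $\chi:X\to X$ for which there is a finite $N\subset G$ with $\chi(x)_g=x_g$ for all $x\in X$, $g\notin N$. A finite $N$ is a strong neighborhood of $\chi$ if moreover there is $\hat\chi:X|N\to X|N$ with $\chi(x)|N=\hat\chi(x|N)$ for all $x$; every gate has one, and $\hat\chi$ is then a permutation of $X|N$. The gate $\chi$ is even if it has a strong neighborhood $N$ such that for every $y\in X|(G\setminus N)$ the map $\hat\chi$ restricts to an even permutation of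 the finite set $\{x|N: x\in X,\ x|(G\setminus N)=y\}$. For $g\in G$ put $\chi^g=\sigma_g^{-1}\circ\chi\circ\sigma_g$. For $S\subset G$ say $\chi^S$ commutes if $\chi^s$ and $\chi^t$ commute for all $s,t\in S$; then $\chi^S$ denotes the pointwise limit, over finite $F\subset S$ ordered by inclusion, of the compositions $\prod_{s\in F}\chi^s$ (this limit always exists). A gate lattice is a map $\chi^{Hg}$ with $\chi$ a gate, $H\le G$ of finite index, $g\in G$, and $\chi^{Hg}$ commuting; it is an even gate lattice if $\chi$ is even. $\mathfrak L(X)$ is the group generated by gate lattices and $\hat{\mathfrak L}(X)$ the group generated by even gate lattices. $\mathrm{Aut}(X,H)$ is the group of homeomorphisms of $X$ commuting with $\sigma_h$ for all $h\in H$, and $\mathrm{SAut}(X)=\bigcup_H\mathrm{Aut}(X,H)$ over all finite-index subgroups $H\le G$. $\mathfrak L(X)$ and $\hat{\mathfrak L}(X)$ are contained in $\mathrm{SAut}(X)$. The monolith of a group is its unique minimal non-trivial normal subgroup, i.e. a non-trivial normal subgroup contained in every non-trivial normal subgroup.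
   Formalization: Parts (1) and (4) are stated for subshifts X with more than one point; for a one-point X all the groups are trivial, so simplicity and the (non-trivial) monolith claims fail. *)

theory Defs
  imports "HOL-Analysis.Analysis" "HOL-Algebra.Bij" "HOL-Algebra.Generated_Groups" "HOL-Algebra.FiniteProduct" "HOL-Combinatorics.Permutations"
begin

section \<open>Groups\<close>

definition finite_index :: "('g, 'm) monoid_scheme \<Rightarrow> 'g set \<Rightarrow> bool" where
  "finite_index G H \<longleftrightarrow> subgroup H G \<and> finite (rcosets\<^bsub>G\<^esub> H)"

definition residually_finite :: "('g, 'm) monoid_scheme \<Rightarrow> bool" where
  "residually_finite G \<longleftrightarrow> group G \<and>
     (\<forall>g\<in>carrier G. g \<noteq> \<one>\<^bsub>G\<^esub> \<longrightarrow> (\<exists>N. N \<lhd> G \<and> finite (rcosets\<^bsub>G\<^esub> N) \<and> g \<notin> N))"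

text \<open>The locale \<open>simple_group\<close> of HOL-Algebra demands \<open>order K > 1\<close>, where \<open>order\<close> is
  a \<open>card\<close> and hence \<open>0\<close> for infinite groups; so it only covers finite simple groups.\<close>

definition is_simple_group :: "('g, 'm) monoid_scheme \<Rightarrow> bool" where
  "is_simple_group K \<longleftrightarrow> group K \<and> carrier K \<noteq> {\<one>\<^bsub>K\<^esub>} \<and>
     (\<forall>N. N \<lhd> K \<longrightarrow> N = carrier K \<or> N = {\<one>\<^bsub>K\<^esub>})"

definition is_monolith :: "'g set \<Rightarrow> ('g, 'm) monoid_scheme \<Rightarrow> bool" where
  "is_monolith M K \<longleftrightarrow> M \<lhd> K \<and> M \<noteq> {\<one>\<^bsub>K\<^esub>} \<and>
     (\<forall>N. N \<lhd> K \<and> N \<noteq> {\<one>\<^bsub>K\<^esub>} \<longrightarrow> M \<subseteq> N)"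


section \<open>Subshifts\<close>

text \<open>Configurations are functions \<open>'g \<Rightarrow> 's\<close> that are \<open>undefined\<close> outside \<open>carrier G\<close>;
  patterns on \<open>D \<subseteq> carrier G\<close> are those that are \<open>undefined\<close> outside \<open>D\<close>.\<close>

definition full_shift :: "('g, 'm) monoid_scheme \<Rightarrow> 's set \<Rightarrow> ('g \<Rightarrow> 's) topology" where
  "full_shift G \<Sigma> = product_topology (\<lambda>_. discrete_topology \<Sigma>) (carrier G)"

definition shift :: "('g, 'm) monoid_scheme \<Rightarrow> 'g \<Rightarrow> ('g \<Rightarrow> 's) \<Rightarrow> 'g \<Rightarrow> 's" where
  "shift G g x = (\<lambda>h\<in>carrier G. x (h \<otimes>\<^bsub>G\<^esub> g))"

definition subshift :: "('g, 'm) monoid_scheme \<Rightarrow> 's set \<Rightarrow> ('g \<Rightarrow> 's) set \<Rightarrow> bool" where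
  "subshift G \<Sigma> X \<longleftrightarrow> X \<noteq> {} \<and> closedin (full_shift G \<Sigma>) X \<and>
     (\<forall>g\<in>carrier G. \<forall>x\<in>X. shift G g x \<in> X)"

definition SFT :: "('g, 'm) monoid_scheme \<Rightarrow> 's set \<Rightarrow> ('g \<Rightarrow> 's) set \<Rightarrow> bool" where
  "SFT G \<Sigma> X \<longleftrightarrow> subshift G \<Sigma> X \<and>
     (\<exists>C. openin (full_shift G \<Sigma>) C \<and> closedin (full_shift G \<Sigma>) C \<and>
          X = (\<Inter>g\<in>carrier G. shift G g ` C))"

definition restrictions :: "('g \<Rightarrow> 's) set \<Rightarrow> 'g set \<Rightarrow> ('g \<Rightarrow> 's) set" where
  "restrictions X D = (\<lambda>x. restrict x D) ` X"

definition EFP :: "('g, 'm) monoid_scheme \<Rightarrow> ('g \<Rightarrow> 's) set \<Rightarrow> bool" where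
  "EFP G X \<longleftrightarrow>
     (\<forall>F. finite F \<and> F \<subseteq> carrier G \<longrightarrow>
       (\<exists>N. finite N \<and> N \<subseteq> carrier G \<and>
         (\<forall>x\<in>X. \<forall>y\<in>X. \<exists>z\<in>X.
            restrict z F = restrict x F \<and>
            restrict z (carrier G - N) = restrict y (carrier G - N))))"


section \<open>Homeomorphisms and gates\<close>

text \<open>Self-maps of \<open>X\<close> are elements of \<open>Bij X\<close>, so all groups below are subgroups
  of \<open>BijGroup X\<close>.\<close>

definition Homeo :: "('g, 'm) monoid_scheme \<Rightarrow> 's set \<Rightarrow> ('g \<Rightarrow> 's) set
    \<Rightarrow> (('g \<Rightarrow> 's) \<Rightarrow> ('g \<Rightarrow> 's)) set" where
  "Homeo G \<Sigma> X = {\<phi> \<in> Bij X.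
     homeomorphic_map (subtopology (full_shift G \<Sigma>) X) (subtopology (full_shift G \<Sigma>) X) \<phi>}"

definition acts_within :: "('g, 'm) monoid_scheme \<Rightarrow> ('g \<Rightarrow> 's) set \<Rightarrow> 'g set
    \<Rightarrow> (('g \<Rightarrow> 's) \<Rightarrow> ('g \<Rightarrow> 's)) \<Rightarrow> bool" where
  "acts_within G X N \<phi> \<longleftrightarrow> finite N \<and> N \<subseteq> carrier G \<and>
     (\<forall>x\<in>X. \<forall>g\<in>carrier G - N. \<phi> x g = x g)"

definition gates :: "('g, 'm) monoid_scheme \<Rightarrow> 's set \<Rightarrow> ('g \<Rightarrow> 's) set
    \<Rightarrow> (('g \<Rightarrow> 's) \<Rightarrow> ('g \<Rightarrow> 's)) set" where
  "gates G \<Sigma> X = {\<phi> \<in> Homeo G \<Sigma> X. \<exists>N. acts_within G X N \<phi>}"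

text \<open>\<open>N\<close> is a strong neighborhood of \<open>\<phi>\<close>, witnessed by the local map \<open>\<phi>'\<close>,
  whose values outside \<open>X|N\<close> are irrelevant.\<close>

definition strong_neighborhood :: "('g, 'm) monoid_scheme \<Rightarrow> ('g \<Rightarrow> 's) set
    \<Rightarrow> (('g \<Rightarrow> 's) \<Rightarrow> ('g \<Rightarrow> 's)) \<Rightarrow> 'g set \<Rightarrow> (('g \<Rightarrow> 's) \<Rightarrow> ('g \<Rightarrow> 's)) \<Rightarrow> bool" where
  "strong_neighborhood G X \<phi> N \<phi>' \<longleftrightarrow> acts_within G X N \<phi> \<and>
     \<phi>' \<in> restrictions X N \<rightarrow> restrictions X N \<and>
     (\<forall>x\<in>X. restrict (\<phi> x) N = \<phi>' (restrict x N))"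

definition fillings :: "('g, 'm) monoid_scheme \<Rightarrow> ('g \<Rightarrow> 's) set \<Rightarrow> 'g set
    \<Rightarrow> ('g \<Rightarrow> 's) \<Rightarrow> ('g \<Rightarrow> 's) set" where
  "fillings G X N y = {restrict x N | x. x \<in> X \<and> restrict x (carrier G - N) = y}"

definition even_perm_on :: "('a \<Rightarrow> 'a) \<Rightarrow> 'a set \<Rightarrow> bool" where
  "even_perm_on p S \<longleftrightarrow> restrict_id p S permutes S \<and> evenperm (restrict_id p S)"

definition even_gates :: "('g, 'm) monoid_scheme \<Rightarrow> 's set \<Rightarrow> ('g \<Rightarrow> 's) set
    \<Rightarrow> (('g \<Rightarrow> 's) \<Rightarrow> ('g \<Rightarrow> 's)) set" where
  "even_gates G \<Sigma> X = {\<phi> \<in> gates G \<Sigma> X. \<exists>N \<phi>'. strong_neighborhood G X \<phi> N \<phi>' \<and>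
     (\<forall>y\<in>restrictions X (carrier G - N). even_perm_on \<phi>' (fillings G X N y))}"


section \<open>Gate lattices\<close>

definition conj_gate :: "('g, 'm) monoid_scheme \<Rightarrow> ('g \<Rightarrow> 's) set
    \<Rightarrow> (('g \<Rightarrow> 's) \<Rightarrow> ('g \<Rightarrow> 's)) \<Rightarrow> 'g \<Rightarrow> ('g \<Rightarrow> 's) \<Rightarrow> ('g \<Rightarrow> 's)" where
  "conj_gate G X \<phi> g = (\<lambda>x\<in>X. shift G (inv\<^bsub>G\<^esub> g) (\<phi> (shift G g x)))"

definition commutes_on :: "('g, 'm) monoid_scheme \<Rightarrow> ('g \<Rightarrow> 's) set
    \<Rightarrow> (('g \<Rightarrow> 's) \<Rightarrow> ('g \<Rightarrow> 's)) \<Rightarrow> 'g set \<Rightarrow> bool" where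
  "commutes_on G X \<phi> S \<longleftrightarrow> (\<forall>s\<in>S. \<forall>t\<in>S.
     conj_gate G X \<phi> s \<otimes>\<^bsub>BijGroup X\<^esub> conj_gate G X \<phi> t =
     conj_gate G X \<phi> t \<otimes>\<^bsub>BijGroup X\<^esub> conj_gate G X \<phi> s)"

text \<open>\<open>BijGroup X\<close> is not commutative, but when \<open>commutes_on G X \<phi> S\<close> holds, the factors
  of the \<open>finprod\<close> below commute, which is all that its underlying fold needs to be well-defined.\<close>

definition gate_power :: "('g, 'm) monoid_scheme \<Rightarrow> 's set \<Rightarrow> ('g \<Rightarrow> 's) set
    \<Rightarrow> (('g \<Rightarrow> 's) \<Rightarrow> ('g \<Rightarrow> 's)) \<Rightarrow> 'g set \<Rightarrow> ('g \<Rightarrow> 's) \<Rightarrow> ('g \<Rightarrow> 's)" where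
  "gate_power G \<Sigma> X \<phi> S = (\<lambda>x\<in>X. THE y. limitin (full_shift G \<Sigma>)
     (\<lambda>F. finprod (BijGroup X) (conj_gate G X \<phi>) F x) y (finite_subsets_at_top S))"

definition lattices_of :: "('g, 'm) monoid_scheme \<Rightarrow> 's set \<Rightarrow> ('g \<Rightarrow> 's) set
    \<Rightarrow> (('g \<Rightarrow> 's) \<Rightarrow> ('g \<Rightarrow> 's)) set \<Rightarrow> (('g \<Rightarrow> 's) \<Rightarrow> ('g \<Rightarrow> 's)) set" where
  "lattices_of G \<Sigma> X \<Gamma> = {gate_power G \<Sigma> X \<phi> (H #>\<^bsub>G\<^esub> g) | \<phi> H g.
     \<phi> \<in> \<Gamma> \<and> finite_index G H \<and> g \<in> carrier G \<and> commutes_on G X \<phi> (H #>\<^bsub>G\<^esub> g)}"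

definition gate_lattices :: "('g, 'm) monoid_scheme \<Rightarrow> 's set \<Rightarrow> ('g \<Rightarrow> 's) set
    \<Rightarrow> (('g \<Rightarrow> 's) \<Rightarrow> ('g \<Rightarrow> 's)) set" where
  "gate_lattices G \<Sigma> X = lattices_of G \<Sigma> X (gates G \<Sigma> X)"

definition even_gate_lattices :: "('g, 'm) monoid_scheme \<Rightarrow> 's set \<Rightarrow> ('g \<Rightarrow> 's) set
    \<Rightarrow> (('g \<Rightarrow> 's) \<Rightarrow> ('g \<Rightarrow> 's)) set" where
  "even_gate_lattices G \<Sigma> X = lattices_of G \<Sigma> X (even_gates G \<Sigma> X)"

definition L :: "('g, 'm) monoid_scheme \<Rightarrow> 's set \<Rightarrow> ('g \<Rightarrow> 's) set
    \<Rightarrow> (('g \<Rightarrow> 's) \<Rightarrow> ('g \<Rightarrow> 's)) set" where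
  "L G \<Sigma> X = generate (BijGroup X) (gate_lattices G \<Sigma> X)"

definition L_even :: "('g, 'm) monoid_scheme \<Rightarrow> 's set \<Rightarrow> ('g \<Rightarrow> 's) set
    \<Rightarrow> (('g \<Rightarrow> 's) \<Rightarrow> ('g \<Rightarrow> 's)) set" where
  "L_even G \<Sigma> X = generate (BijGroup X) (even_gate_lattices G \<Sigma> X)"


section \<open>The stabilized automorphism group\<close>

definition Aut :: "('g, 'm) monoid_scheme \<Rightarrow> 's set \<Rightarrow> ('g \<Rightarrow> 's) set \<Rightarrow> 'g set
    \<Rightarrow> (('g \<Rightarrow> 's) \<Rightarrow> ('g \<Rightarrow> 's)) set" where
  "Aut G \<Sigma> X H = {f \<in> Homeo G \<Sigma> X. \<forall>h\<in>H. \<forall>x\<in>X. f (shift G h x) = shift G h (f x)}"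

definition SAut :: "('g, 'm) monoid_scheme \<Rightarrow> 's set \<Rightarrow> ('g \<Rightarrow> 's) set
    \<Rightarrow> (('g \<Rightarrow> 's) \<Rightarrow> ('g \<Rightarrow> 's)) set" where
  "SAut G \<Sigma> X = (\<Union>H\<in>{H. finite_index G H}. Aut G \<Sigma> X H)"

text \<open>\<open>L\<close>, \<open>L_even\<close> and \<open>SAut\<close> are sets of permutations of \<open>X\<close>; this turns them into groups.\<close>

abbreviation as_group :: "'x set \<Rightarrow> ('x \<Rightarrow> 'x) set \<Rightarrow> ('x \<Rightarrow> 'x) monoid" where
  "as_group X K \<equiv> BijGroup X \<lparr>carrier := K\<rparr>"

end

theory Submission
  imports Defs
begin

text \<open>Write \<open>\<chi>\<^sup>K\<close> for the product of the translates \<open>\<chi>\<^sup>k\<close>, \<open>k \<in> K\<close>. Two reductions turn the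
statements about such infinite products into statements about finite permutation groups.

\<^bold>\<open>From lattices to gates.\<close> Let \<open>K\<close> be a normal subgroup of finite index that separates the points
of a finite set \<open>D\<close>, so that \<open>D\<close> and \<open>D k\<close> are disjoint for \<open>1 \<noteq> k \<in> K\<close>. The translates by distinct
elements of \<open>K\<close> of gates supported in \<open>D\<close> have disjoint supports, hence commute, and
\<open>\<chi> \<mapsto> \<chi>\<^sup>K\<close> is multiplicative on these gates. Residual finiteness provides such a \<open>K\<close> for every \<open>D\<close>,
and every deeper \<open>K\<close> does as well. Conversely every gate lattice over a coset \<open>H g\<close> is a finite product
of lattices \<open>(\<chi>\<^sup>r)\<^sup>K\<close>, \<open>r \<in> H g\<close>, for any normal \<open>K \<subseteq> H\<close> of finite index
(\<open>gp_coset_decomposition\<close>). The number of factors grows with the depth of \<open>K\<close>, so one needs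
the condition \<open>(\<chi>\<^sup>k)\<^sup>K \<in> U\<close> for all deep \<open>K\<close> uniformly in \<open>k\<close>, where \<open>k\<close> ranges over one fixed subgroup of
finite index. The gates that satisfy it are the \<open>deep_gates\<close>; if all even gates do, then
the group of even gate lattices is contained in \<open>U\<close> (\<open>L_even_subset_if_deep\<close>).

\<^bold>\<open>From gates to permutations.\<close> In a subshift of finite type a finite set \<open>N\<close> lies in a larger finite set
\<open>M\<close> such that the contents of \<open>N\<close> can be exchanged between two configurations that agree on the frame
\<open>M - N\<close>. So the gates that act within \<open>N\<close> and look only at \<open>M\<close> are exactly the permutations of the
patterns on \<open>M\<close> that preserve the frame, and such a gate is even if its permutation is even on the
patterns with any given frame (\<open>gate_is_lift\<close>, \<open>even_gate_is_lift\<close>). Such an even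
permutation is a product of 3-cycles, and a 3-cycle is a commutator of transpositions.

\<^bold>\<open>The four statements.\<close> Elements of the stabilized automorphism group conjugate gates to gates and preserve
parity, since they turn a change at finitely many coordinates into a change at finitely many coordinates; conjugating a lattice over a deep
enough \<open>K\<close> therefore gives a lattice over \<open>K\<close>, which is normality. The commutator of two lattices
over a deep \<open>K\<close> is trivial or the lattice of a commutator of two gates, because a translate of the
first gate then meets at most one translate of the second; commutators of gates are even. Together
with the expression of even gates as products of commutators, this identifies the group of even gate
lattices with the derived subgroup.

Finally let \<open>U\<close> be a nontrivial group of stabilized automorphisms that is normalized by the even gate
lattices, and \<open>1 \<noteq> f \<in> U\<close>. The eventual filling property yields an even gate \<open>\<chi>\<close> with \<open>[f, \<chi>] \<noteq> 1\<close>, and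
\<open>[f, \<chi>]\<^sup>K = [f, \<chi>\<^sup>K]\<close> lies in \<open>U\<close>. By the same property a nontrivial gate acts nontrivially on the
patterns with any given frame, as soon as \<open>N\<close> is large, and there are many such patterns. The
classical commutator argument for alternating groups then produces every 3-cycle from \<open>[f, \<chi>]\<close>, so \<open>U\<close>
contains all even gate lattices (\<open>L_even_minimal\<close>). Simplicity and both monolith statements
are instances of this.\<close>

section \<open>Permutations that preserve the fibres of a map\<close>

abbreviation swap :: "'a \<Rightarrow> 'a \<Rightarrow> 'a \<Rightarrow> 'a" where
  "swap \<equiv> Transposition.transpose"

text \<open>The notation \<open>inv\<close> belongs to the algebraic inverse.\<close>

abbreviation pinv :: "('a \<Rightarrow> 'a) \<Rightarrow> 'a \<Rightarrow> 'a" where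
  "pinv \<equiv> inv_into UNIV"

definition cyc3 :: "'a \<Rightarrow> 'a \<Rightarrow> 'a \<Rightarrow> 'a \<Rightarrow> 'a" where
  "cyc3 a b c = swap a b \<circ> swap b c"

definition fiber_perms :: "('a \<Rightarrow> 'b) \<Rightarrow> 'a set \<Rightarrow> ('a \<Rightarrow> 'a) set" where
  "fiber_perms \<beta> A = {p. p permutes A \<and> (\<forall>x\<in>A. \<beta> (p x) = \<beta> x)}"

definition fiber_alt :: "('a \<Rightarrow> 'b) \<Rightarrow> 'a set \<Rightarrow> ('a \<Rightarrow> 'a) set" where
  "fiber_alt \<beta> A = {p \<in> fiber_perms \<beta> A. \<forall>x\<in>A. evenperm (restrict_id p {y \<in> A. \<beta> y = \<beta> x})}"

lemma cyc3_apply: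
  assumes "a \<noteq> b" "b \<noteq> c" "a \<noteq> c"
  shows "cyc3 a b c a = b" "cyc3 a b c b = c" "cyc3 a b c c = a"
    "x \<noteq> a \<Longrightarrow> x \<noteq> b \<Longrightarrow> x \<noteq> c \<Longrightarrow> cyc3 a b c x = x"
  using assms by (auto simp: cyc3_def Transposition.transpose_def)

lemma cyc3_rotate:
  assumes "a \<noteq> b" "b \<noteq> c" "a \<noteq> c"
  shows "cyc3 a b c = cyc3 b c a"
  using assms by (auto simp: cyc3_def Transposition.transpose_def fun_eq_iff)

lemma bij_cyc3: "bij (cyc3 a b c)"
  by (simp add: cyc3_def bij_comp)

lemma cyc3_inverse:
  assumes "a \<noteq> b" "b \<noteq> c" "a \<noteq> c"
  shows "cyc3 a b c \<circ> cyc3 c b a = id"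
  using assms by (auto simp: cyc3_def Transposition.transpose_def fun_eq_iff)

lemma inv_cyc3:
  assumes "a \<noteq> b" "b \<noteq> c" "a \<noteq> c"
  shows "pinv (cyc3 a b c) = cyc3 c b a"
  using cyc3_inverse[OF assms] bij_cyc3 by (metis bij_is_inj comp_assoc comp_id fun.map_id inv_o_cancel)

lemma conj_cyc3:
  assumes "bij s"
  shows "s \<circ> cyc3 a b c \<circ> pinv s = cyc3 (s a) (s b) (s c)"
proof -
  have t: "s \<circ> swap x y = swap (s x) (s y) \<circ> s" for x y
    using bij_is_inj[OF assms] by (auto simp: fun_eq_iff Transposition.transpose_def inj_eq)
  have "s \<circ> cyc3 a b c \<circ> pinv s = cyc3 (s a) (s b) (s c) \<circ> (s \<circ> pinv s)"
    unfolding cyc3_def using t by (metis comp_assoc)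
  then show ?thesis
    using assms by (simp add: bij_def surj_iff)
qed

lemma cyc3_overlap:
  assumes "x \<noteq> z" "x \<noteq> w" "x \<noteq> w'" "z \<noteq> w" "z \<noteq> w'" "w \<noteq> w'"
  shows "cyc3 x w w' \<circ> cyc3 w' w z = cyc3 w z x"
proof
  fix y
  consider "y = x" | "y = z" | "y = w" | "y = w'" | "y \<noteq> x" "y \<noteq> z" "y \<noteq> w" "y \<noteq> w'" by blast
  then show "(cyc3 x w w' \<circ> cyc3 w' w z) y = cyc3 w z x y"
    by cases (use assms in \<open>simp_all add: cyc3_def Transposition.transpose_def\<close>)
qed

lemma evenperm_cyc3:
  assumes "a \<noteq> b" "b \<noteq> c" shows "evenperm (cyc3 a b c)"
  unfolding cyc3_def using assms
  by (subst evenperm_comp) (auto simp: permutation_swap_id evenperm_swap)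

lemma cyc3_commutator:
  assumes "a \<noteq> b" "b \<noteq> c" "a \<noteq> c"
  shows "cyc3 a b c = swap a c \<circ> swap c b \<circ> swap a c \<circ> swap c b"
proof
  fix x
  consider "x = a" | "x = b" | "x = c" | "x \<noteq> a" "x \<noteq> b" "x \<noteq> c" by blast
  then show "cyc3 a b c x = (swap a c \<circ> swap c b \<circ> swap a c \<circ> swap c b) x"
    by cases (use assms in \<open>simp_all add: cyc3_def Transposition.transpose_def\<close>)
qed

context
  fixes A :: "'a set" and \<beta> :: "'a \<Rightarrow> 'b"
  assumes fin: "finite A"
begin

lemma fiber_perms_comp: "p \<in> fiber_perms \<beta> A \<Longrightarrow> q \<in> fiber_perms \<beta> A \<Longrightarrow> p \<circ> q \<in> fiber_perms \<beta> A"
  unfolding fiber_perms_def by (auto intro: permutes_compose simp: permutes_in_image)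

lemma fiber_perms_inv:
  assumes "p \<in> fiber_perms \<beta> A" shows "pinv p \<in> fiber_perms \<beta> A"
proof -
  have p: "p permutes A" "\<And>x. x \<in> A \<Longrightarrow> \<beta> (p x) = \<beta> x"
    using assms by (auto simp: fiber_perms_def)
  have "\<beta> (pinv p x) = \<beta> x" if "x \<in> A" for x
    using p(2)[of "pinv p x"] that permutes_in_image[OF permutes_inv[OF p(1)]]
    by (simp add: permutes_inverses(1)[OF p(1)])
  then show ?thesis
    using permutes_inv[OF p(1)] by (auto simp: fiber_perms_def)
qed

lemma fiber_perms_transpose: "a \<in> A \<Longrightarrow> b \<in> A \<Longrightarrow> \<beta> a = \<beta> b \<Longrightarrow> swap a b \<in> fiber_perms \<beta> A"
  unfolding fiber_perms_def by (auto intro: permutes_swap_id simp: Transposition.transpose_def)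

lemma fiber_perms_restrict_permutes:
  assumes "p \<in> fiber_perms \<beta> A"
  shows "restrict_id p {y \<in> A. \<beta> y = b} permutes {y \<in> A. \<beta> y = b}"
proof (rule permutes_restrict_id)
  have p: "p permutes A" "\<And>x. x \<in> A \<Longrightarrow> \<beta> (p x) = \<beta> x"
    using assms by (auto simp: fiber_perms_def)
  have "inj_on p {y \<in> A. \<beta> y = b}"
    using permutes_inj[OF p(1)] by (meson inj_on_subset subset_UNIV)
  moreover have "p ` {y \<in> A. \<beta> y = b} \<subseteq> {y \<in> A. \<beta> y = b}"
    using p permutes_in_image[OF p(1)] by auto
  ultimately show "bij_betw p {y \<in> A. \<beta> y = b} {y \<in> A. \<beta> y = b}"
    using fin by (simp add: bij_betw_def endo_inj_surj)
qed

lemma fiber_alt_comp: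
  assumes "p \<in> fiber_alt \<beta> A" "q \<in> fiber_alt \<beta> A"
  shows "p \<circ> q \<in> fiber_alt \<beta> A"
proof -
  have *: "p \<in> fiber_perms \<beta> A" "q \<in> fiber_perms \<beta> A"
    using assms by (auto simp: fiber_alt_def)
  have "evenperm (restrict_id (p \<circ> q) {y \<in> A. \<beta> y = \<beta> x})" if "x \<in> A" for x
  proof -
    let ?S = "{y \<in> A. \<beta> y = \<beta> x}"
    have q: "q y \<in> ?S" if "y \<in> ?S" for y
      using *(2) that by (auto simp: fiber_perms_def dest: permutes_in_image)
    have "restrict_id (p \<circ> q) ?S = restrict_id p ?S \<circ> restrict_id q ?S"
      using q by (auto simp: restrict_id_def fun_eq_iff)
    moreover have "permutation (restrict_id p ?S)" "permutation (restrict_id q ?S)"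
      using fiber_perms_restrict_permutes[OF *(1)] fiber_perms_restrict_permutes[OF *(2)] fin
      by (auto intro: permutes_imp_permutation[of ?S])
    moreover have "evenperm (restrict_id p ?S)" "evenperm (restrict_id q ?S)"
      using assms that by (auto simp: fiber_alt_def)
    ultimately show ?thesis
      by (simp add: evenperm_comp)
  qed
  then show ?thesis
    using fiber_perms_comp[OF *] by (simp add: fiber_alt_def)
qed

lemma cyc3_fiber_perms:
  assumes "a \<in> A" "b \<in> A" "c \<in> A" "\<beta> a = \<beta> b" "\<beta> b = \<beta> c"
  shows "cyc3 a b c \<in> fiber_perms \<beta> A"
  unfolding cyc3_def using assms by (intro fiber_perms_comp fiber_perms_transpose) auto

lemma cyc3_fiber_alt:
  assumes abc: "a \<in> A" "b \<in> A" "c \<in> A" "\<beta> a = \<beta> b" "\<beta> b = \<beta> c" "a \<noteq> b" "b \<noteq> c" "a \<noteq> c"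
  shows "cyc3 a b c \<in> fiber_alt \<beta> A"
proof -
  have "evenperm (restrict_id (cyc3 a b c) {y \<in> A. \<beta> y = \<beta> x})" if "x \<in> A" for x
  proof (cases "\<beta> x = \<beta> a")
    case True
    have "restrict_id (cyc3 a b c) {y \<in> A. \<beta> y = \<beta> x} = cyc3 a b c"
      using True abc cyc3_apply(4)[of a b c] by (auto simp: restrict_id_def fun_eq_iff) metis+
    then show ?thesis using evenperm_cyc3 abc by simp
  next
    case False
    have "restrict_id (cyc3 a b c) {y \<in> A. \<beta> y = \<beta> x} = id"
      using False abc by (auto simp: restrict_id_def fun_eq_iff intro!: cyc3_apply(4)[of a b c])
    then show ?thesis by simp
  qed
  then show ?thesis
    using cyc3_fiber_perms abc by (simp add: fiber_alt_def)
qed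

text \<open>If \<open>a\<close> and \<open>p a\<close> were the only points of the fibre that move, then \<open>p\<close> would restrict to a transposition there, which is odd.\<close>

lemma fiber_alt_third_moved:
  assumes p: "p \<in> fiber_alt \<beta> A" and a: "a \<in> A" "p a \<noteq> a"
  obtains c where "c \<in> A" "\<beta> c = \<beta> a" "p c \<noteq> c" "c \<noteq> a" "c \<noteq> p a"
proof -
  note obtained = that
  let ?S = "{y \<in> A. \<beta> y = \<beta> a}"
  let ?r = "restrict_id p ?S"
  have pf: "p \<in> fiber_perms \<beta> A" and ev: "evenperm ?r"
    using p a by (auto simp: fiber_alt_def)
  then have pA: "p permutes A" "\<beta> (p a) = \<beta> a"
    using a by (auto simp: fiber_perms_def)
  have inj: "inj p" using pA permutes_inj by blast
  have paS: "p a \<in> ?S" using a pA(2) permutes_in_image[OF pA(1)] by auto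
  show thesis
  proof (rule ccontr)
    assume neg: "\<not> thesis"
    then have fix1: "p c = c" if "c \<in> ?S" "c \<noteq> a" "c \<noteq> p a" for c
      using that obtained[of c] neg by blast
    have "p (p a) \<in> ?S"
      using pf paS permutes_in_image[OF pA(1)] by (auto simp: fiber_perms_def)
    then have ppa: "p (p a) = a"
      by (metis a(2) fix1 inj injD)
    have "?r = swap a (p a)"
    proof
      fix x show "?r x = swap a (p a) x"
        using fix1[of x] ppa paS a by (auto simp: restrict_id_def Transposition.transpose_def)
    qed
    with ev a show False by (simp add: evenperm_swap)
  qed
qed

text \<open>Even permutations are products of 3-cycles inside the fibres: composing with a 3-cycle that sends \<open>p a\<close> back to \<open>a\<close> and otherwise involves only a third moved point makes the set of moved points smaller.\<close>

lemma fiber_alt_induct [consumes 1, case_names id cyc3]: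
  assumes "p \<in> fiber_alt \<beta> A"
    and "P id"
    and "\<And>a b c q. a \<in> A \<Longrightarrow> b \<in> A \<Longrightarrow> c \<in> A \<Longrightarrow> \<beta> a = \<beta> b \<Longrightarrow> \<beta> b = \<beta> c \<Longrightarrow> a \<noteq> b \<Longrightarrow> b \<noteq> c
      \<Longrightarrow> a \<noteq> c \<Longrightarrow> q \<in> fiber_alt \<beta> A \<Longrightarrow> P q \<Longrightarrow> P (cyc3 a b c \<circ> q)"
  shows "P p"
  using assms(1)
proof (induction "card {x \<in> A. p x \<noteq> x}" arbitrary: p rule: less_induct)
  case less
  show ?case
  proof (cases "p = id")
    case True then show ?thesis using assms(2) by simp
  next
    case False
    have pf: "p \<in> fiber_perms \<beta> A" using less.prems by (simp add: fiber_alt_def)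
    then have pA: "p permutes A" by (simp add: fiber_perms_def)
    have inj: "inj p" using pA permutes_inj by blast
    obtain a where a: "p a \<noteq> a" using False by (auto simp: fun_eq_iff)
    then have aA: "a \<in> A" using pA by (meson permutes_not_in)
    obtain c where c: "c \<in> A" "\<beta> c = \<beta> a" "p c \<noteq> c" "c \<noteq> a" "c \<noteq> p a"
      using fiber_alt_third_moved[OF less.prems aA a] by blast
    define b where "b = p a"
    have b: "b \<in> A" "\<beta> b = \<beta> a" "b \<noteq> a" "c \<noteq> b" "p b \<noteq> b"
      using pf aA a c inj by (auto simp: b_def fiber_perms_def permutes_in_image dest: injD)
    define q where "q = cyc3 b a c \<circ> p"
    have qalt: "q \<in> fiber_alt \<beta> A"
      unfolding q_def using less.prems a aA b c by (intro fiber_alt_comp cyc3_fiber_alt) auto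
    have qa: "q a = a" unfolding q_def using b c cyc3_apply[of b a c] by (simp add: b_def[symmetric])
    have "q x = x" if "p x = x" for x
      unfolding q_def using that cyc3_apply(4)[of b a c x] a b c by auto
    then have "{x \<in> A. q x \<noteq> x} \<subset> {x \<in> A. p x \<noteq> x}"
      using qa a aA by auto
    then have "card {x \<in> A. q x \<noteq> x} < card {x \<in> A. p x \<noteq> x}"
      using fin by (intro psubset_card_mono) auto
    then have "P q" using less.hyps qalt by blast
    moreover have "cyc3 a b c \<circ> q = p"
    proof -
      have "cyc3 a b c = cyc3 c a b" using b c cyc3_rotate[of c a b] by auto
      then have "cyc3 a b c \<circ> cyc3 b a c = id" using cyc3_inverse[of c a b] b c by auto
      then show ?thesis unfolding q_def by (metis comp_assoc id_comp)
    qed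
    ultimately show ?thesis
      using assms(3)[of a b c q] aA b c qalt by auto
  qed
qed

text \<open>The classical proof that alternating groups are simple, carried out in all fibres at once. For a moved point \<open>a\<close> and a
3-cycle \<open>\<tau>\<close> through \<open>a\<close> that avoids \<open>\<pi> a\<close>, the commutator \<open>\<rho> = [\<pi>, \<tau>]\<close> is nontrivial and moves at most six points,
all in the fibre of \<open>a\<close>. Commuting \<open>\<rho>\<close> with a 3-cycle through a point moved by \<open>\<rho>\<close> and two points fixed by \<open>\<rho>\<close> gives a 3-cycle.
All 3-cycles in the fibre are conjugate to it. Nine points leave room for a point outside any eight given ones.\<close>

lemma fiber_alt_subset_if_normalized:
  assumes comp: "\<And>p q. p \<in> n \<Longrightarrow> q \<in> n \<Longrightarrow> p \<circ> q \<in> n"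
    and ninv: "\<And>p. p \<in> n \<Longrightarrow> pinv p \<in> n"
    and norm: "\<And>p q. p \<in> fiber_alt \<beta> A \<Longrightarrow> q \<in> n \<Longrightarrow> p \<circ> q \<circ> pinv p \<in> n"
    and pi: "\<pi> \<in> n" "\<pi> \<in> fiber_perms \<beta> A"
    and moves: "\<And>x. x \<in> A \<Longrightarrow> \<exists>y\<in>A. \<beta> y = \<beta> x \<and> \<pi> y \<noteq> y"
    and large: "\<And>x. x \<in> A \<Longrightarrow> card {y \<in> A. \<beta> y = \<beta> x} \<ge> 9"
  shows "fiber_alt \<beta> A \<subseteq> n"
proof -
  have fresh: "\<exists>y. y \<in> A \<and> \<beta> y = \<beta> x \<and> y \<notin> set zs" if "x \<in> A" "length zs \<le> 8" for x zs
  proof (rule ccontr)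
    assume "\<nexists>y. y \<in> A \<and> \<beta> y = \<beta> x \<and> y \<notin> set zs"
    then have "card {y \<in> A. \<beta> y = \<beta> x} \<le> card (set zs)"
      by (intro card_mono) auto
    then show False using large[OF that(1)] that(2) card_length[of zs] by linarith
  qed
  have piA: "\<pi> permutes A" "\<And>x. x \<in> A \<Longrightarrow> \<beta> (\<pi> x) = \<beta> x" using pi by (auto simp: fiber_perms_def)
  have pinj: "inj \<pi>" "bij \<pi>" using piA permutes_inj permutes_bij by blast+
  have pimem: "\<pi> x \<in> A \<longleftrightarrow> x \<in> A" for x using piA permutes_in_image by metis
  have some_cycle: "\<exists>u v w. u \<in> A \<and> v \<in> A \<and> w \<in> A \<and> \<beta> u = \<beta> x \<and> \<beta> v = \<beta> x \<and> \<beta> w = \<beta> x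
      \<and> u \<noteq> v \<and> v \<noteq> w \<and> u \<noteq> w \<and> cyc3 u v w \<in> n" if x: "x \<in> A" for x
  proof -
    obtain a where a: "a \<in> A" "\<beta> a = \<beta> x" "\<pi> a \<noteq> a" using moves[OF x] by blast
    obtain u where u: "u \<in> A" "\<beta> u = \<beta> x" "u \<notin> set [a, \<pi> a]"
      using fresh[OF x, of "[a, \<pi> a]"] by auto
    obtain v where v: "v \<in> A" "\<beta> v = \<beta> x" "v \<notin> set [a, \<pi> a, u]"
      using fresh[OF x, of "[a, \<pi> a, u]"] by auto
    define \<tau> where "\<tau> = cyc3 a u v"
    have tau: "\<tau> \<in> fiber_alt \<beta> A" unfolding \<tau>_def using a u v by (intro cyc3_fiber_alt) auto
    have bt: "bij \<tau>" unfolding \<tau>_def by (rule bij_cyc3)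
    have it: "pinv \<tau> = cyc3 v u a" unfolding \<tau>_def by (rule inv_cyc3) (use u v in auto)
    define \<rho> where "\<rho> = \<pi> \<circ> (\<tau> \<circ> pinv \<pi> \<circ> pinv \<tau>)"
    have rho: "\<rho> \<in> n" unfolding \<rho>_def using comp norm ninv tau pi by blast
    \<comment> \<open>The commutator as a conjugate of \<open>\<tau>\<close> times the inverse of \<open>\<tau>\<close>: a product of two 3-cycles.\<close>
    have rho': "\<rho> = cyc3 (\<pi> a) (\<pi> u) (\<pi> v) \<circ> cyc3 v u a"
      unfolding \<rho>_def it using conj_cyc3[OF pinj(2), of a u v] by (simp add: \<tau>_def flip: comp_assoc)
    have brho: "bij \<rho>" unfolding rho' by (intro bij_comp bij_cyc3)
    let ?M = "[a, u, v, \<pi> a, \<pi> u, \<pi> v]"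
    have fixed: "\<rho> y = y" if "y \<notin> set ?M" for y
    proof -
      have "cyc3 v u a y = y" using that u v by (intro cyc3_apply(4)) auto
      moreover have "cyc3 (\<pi> a) (\<pi> u) (\<pi> v) y = y"
        using that u v by (intro cyc3_apply(4)) (auto simp: inj_eq[OF pinj(1)])
      ultimately show ?thesis unfolding rho' by simp
    qed
    have "\<rho> (\<tau> (\<pi> a)) \<noteq> \<tau> (\<pi> a)"
    proof
      have "\<tau> (\<pi> a) = \<pi> a"
        unfolding \<tau>_def using a u v by (intro cyc3_apply(4)) auto
      moreover have "\<rho> (\<tau> (\<pi> a)) = \<pi> (\<tau> a)"
        unfolding \<rho>_def using bt pinj by (simp add: bij_is_inj)
      moreover have "\<tau> a = u" unfolding \<tau>_def by (rule cyc3_apply) (use u v in auto)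
      moreover assume "\<rho> (\<tau> (\<pi> a)) = \<tau> (\<pi> a)"
      ultimately have "\<pi> u = \<pi> a" by simp
      then have "u = a" using pinj(1) by (auto dest: injD)
      then show False using u by simp
    qed
    then obtain z where z: "\<rho> z \<noteq> z" by blast
    have M: "y \<in> A \<and> \<beta> y = \<beta> x" if "y \<in> set ?M" for y
    proof -
      have "\<pi> a \<in> A" "\<pi> u \<in> A" "\<pi> v \<in> A" "\<beta> (\<pi> a) = \<beta> x" "\<beta> (\<pi> u) = \<beta> x" "\<beta> (\<pi> v) = \<beta> x"
        by (simp_all add: piA(2) pimem a u v)
      then show ?thesis using that a u v by auto
    qed
    have zM: "z \<in> set ?M" using fixed z by blast
    then have zA: "z \<in> A" "\<beta> z = \<beta> x" using M by blast+
    have "\<rho> (\<rho> z) \<noteq> \<rho> z" using z by (simp add: inj_eq[OF bij_is_inj[OF brho]])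
    then have rzM: "\<rho> z \<in> set ?M" using fixed by blast
    then have rz: "\<rho> z \<in> A" "\<beta> (\<rho> z) = \<beta> x" using M by blast+
    obtain w where w: "w \<in> A" "\<beta> w = \<beta> x" "w \<notin> set ?M"
      using fresh[OF x, of ?M] by auto
    obtain w' where w': "w' \<in> A" "\<beta> w' = \<beta> x" "w' \<notin> set (w # ?M)"
      using fresh[OF x, of "w # ?M"] by auto
    have dz: "z \<noteq> w" "z \<noteq> w'" "w \<noteq> w'" "\<rho> z \<noteq> w" "\<rho> z \<noteq> w'"
    proof -
      have "w \<noteq> y" "w' \<noteq> y" if "y \<in> set ?M" for y
        using that w(3) w'(3) by (metis, metis list.set_intros(2))
      then show "z \<noteq> w" "z \<noteq> w'" "\<rho> z \<noteq> w" "\<rho> z \<noteq> w'" using zM rzM by blast+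
      show "w \<noteq> w'" using w'(3) by auto
    qed
    define \<tau>2 where "\<tau>2 = cyc3 z w w'"
    have tau2: "\<tau>2 \<in> fiber_alt \<beta> A" unfolding \<tau>2_def using zA w w' dz by (intro cyc3_fiber_alt) auto
    have it2: "pinv \<tau>2 = cyc3 w' w z" unfolding \<tau>2_def by (rule inv_cyc3) (use dz in auto)
    have "\<rho> \<circ> (\<tau>2 \<circ> pinv \<rho> \<circ> pinv \<tau>2) \<in> n" using comp norm ninv tau2 rho by blast
    moreover have "\<rho> \<circ> (\<tau>2 \<circ> pinv \<rho> \<circ> pinv \<tau>2) = cyc3 (\<rho> z) w w' \<circ> cyc3 w' w z"
      using conj_cyc3[OF brho, of z w w'] fixed[OF w(3)] fixed[of w'] w'(3)
      by (simp add: \<tau>2_def[symmetric] it2 flip: comp_assoc)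
    moreover have "cyc3 (\<rho> z) w w' \<circ> cyc3 w' w z = cyc3 w z (\<rho> z)"
      by (rule cyc3_overlap) (use dz z in auto)
    ultimately have "cyc3 w z (\<rho> z) \<in> n" by simp
    then show ?thesis
      using zA rz w dz z by (intro exI[of _ w] exI[of _ z] exI[of _ "\<rho> z"]) simp
  qed
  \<comment> \<open>Conjugating by the 3-cycle \<open>(u y t)\<close> replaces \<open>u\<close> by \<open>y\<close>; the auxiliary point \<open>t\<close> makes the conjugator even.\<close>
  have exchange: "cyc3 y v w \<in> n"
    if uvw: "u \<in> A" "v \<in> A" "w \<in> A" "\<beta> u = \<beta> v" "\<beta> v = \<beta> w" "u \<noteq> v" "v \<noteq> w" "u \<noteq> w"
      "cyc3 u v w \<in> n" and y: "y \<in> A" "\<beta> y = \<beta> w" "y \<notin> {u, v, w}" for u v w y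
  proof -
    obtain t where t: "t \<in> A" "\<beta> t = \<beta> w" "t \<notin> set [u, v, w, y]"
      using fresh[OF uvw(3), of "[u, v, w, y]"] by auto
    have "cyc3 u y t \<circ> cyc3 u v w \<circ> pinv (cyc3 u y t) \<in> n"
      using uvw y t by (intro norm cyc3_fiber_alt) auto
    moreover have "cyc3 u y t u = y" "cyc3 u y t v = v" "cyc3 u y t w = w"
      using uvw y t by (auto intro!: cyc3_apply(1,4))
    ultimately show ?thesis
      by (simp add: conj_cyc3[OF bij_cyc3])
  qed
  have step: "cyc3 v w y \<in> n"
    if "u \<in> A" "v \<in> A" "w \<in> A" "\<beta> u = \<beta> v" "\<beta> v = \<beta> w" "u \<noteq> v" "v \<noteq> w" "u \<noteq> w"
      "cyc3 u v w \<in> n" "y \<in> A" "\<beta> y = \<beta> w" "y \<notin> {u, v, w}" for u v w y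
    using exchange[OF that] cyc3_rotate[of y v w] that by auto
  have all_cycles: "cyc3 a b c \<in> n"
    if abc: "a \<in> A" "b \<in> A" "c \<in> A" "\<beta> a = \<beta> b" "\<beta> b = \<beta> c" "a \<noteq> b" "b \<noteq> c" "a \<noteq> c" for a b c
  proof -
    obtain u v w where uvw: "u \<in> A" "v \<in> A" "w \<in> A" "\<beta> u = \<beta> a" "\<beta> v = \<beta> a" "\<beta> w = \<beta> a"
       "u \<noteq> v" "v \<noteq> w" "u \<noteq> w" "cyc3 u v w \<in> n" using some_cycle[OF abc(1)] by blast
    let ?Z = "[a, b, c, u, v, w]"
    \<comment> \<open>Six replacements, first through fresh points \<open>r\<close>, \<open>s\<close>, \<open>t\<close>, since a new point must differ from the three current ones.\<close>
    obtain r where r: "r \<in> A" "\<beta> r = \<beta> a" "r \<notin> set ?Z" using fresh[OF abc(1), of ?Z] by auto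
    obtain s where s: "s \<in> A" "\<beta> s = \<beta> a" "s \<notin> set (r # ?Z)" using fresh[OF abc(1), of "r # ?Z"] by auto
    obtain t where t: "t \<in> A" "\<beta> t = \<beta> a" "t \<notin> set (s # r # ?Z)"
      using fresh[OF abc(1), of "s # r # ?Z"] by auto
    have 1: "cyc3 v w r \<in> n" using step[of u v w r] uvw r by auto
    have 2: "cyc3 w r s \<in> n" using step[of v w r s] uvw r s 1 by auto
    have 3: "cyc3 r s t \<in> n" using step[of w r s t] uvw r s t 2 by auto
    have 4: "cyc3 s t a \<in> n" using step[of r s t a] r s t abc 3 by auto
    have 5: "cyc3 t a b \<in> n" using step[of s t a b] s t abc 4 by auto
    show ?thesis by (rule step[of t a b c]) (use t abc 5 in auto)
  qed
  have "\<pi> \<circ> pinv \<pi> = id" using bij_is_surj[OF pinj(2)] by (simp add: surj_iff)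
  then have "id \<in> n" using comp[OF pi(1) ninv[OF pi(1)]] by simp
  show ?thesis
  proof
    fix p assume "p \<in> fiber_alt \<beta> A"
    then show "p \<in> n"
    proof (induction rule: fiber_alt_induct)
      case id show ?case by (rule \<open>id \<in> n\<close>)
    next
      case (cyc3 a b c q) then show ?case using comp[OF all_cycles] by blast
    qed
  qed
qed

end

section \<open>Finite-index normal subgroups\<close>

text \<open>The index sets of the lattices: a coset of an arbitrary subgroup of finite index splits into cosets of a normal one, and normality makes left and right cosets coincide and separation of points translation invariant.\<close>

definition finite_index_normal :: "('g, 'm) monoid_scheme \<Rightarrow> 'g set \<Rightarrow> bool" where
  "finite_index_normal G K \<longleftrightarrow> K \<lhd> G \<and> finite (rcosets\<^bsub>G\<^esub> K)"

text \<open>The property holds eventually along the directed family of normal subgroups of finite index.\<close>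

definition for_deep :: "('g, 'm) monoid_scheme \<Rightarrow> ('g set \<Rightarrow> bool) \<Rightarrow> bool" where
  "for_deep G P \<longleftrightarrow> (\<exists>K0. finite_index_normal G K0 \<and> (\<forall>K. finite_index_normal G K \<and> K \<subseteq> K0 \<longrightarrow> P K))"

text \<open>The sets \<open>D\<close> and \<open>D k\<close> are disjoint for \<open>1 \<noteq> k \<in> K\<close>.\<close>

definition separates :: "('g, 'm) monoid_scheme \<Rightarrow> 'g set \<Rightarrow> 'g set \<Rightarrow> bool" where
  "separates G K D \<longleftrightarrow> (\<forall>d\<in>D. \<forall>d'\<in>D. \<forall>k\<in>K. d \<otimes>\<^bsub>G\<^esub> k = d' \<longrightarrow> k = \<one>\<^bsub>G\<^esub>)"

context group
begin

lemma rcos_eq_iff: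
  assumes "subgroup H G" "x \<in> carrier G" "y \<in> carrier G"
  shows "H #> x = H #> y \<longleftrightarrow> x \<otimes> inv y \<in> H"
proof
  assume "H #> x = H #> y"
  then have "x \<in> H #> y" using rcos_self[OF assms(2,1)] by simp
  then obtain h where h: "h \<in> H" "x = h \<otimes> y" by (auto simp: r_coset_def)
  then have "h \<in> carrier G" using subgroup.mem_carrier[OF assms(1)] by simp
  then have "x \<otimes> inv y = h" using h assms by (simp add: m_assoc)
  then show "x \<otimes> inv y \<in> H" using h by simp
next
  assume *: "x \<otimes> inv y \<in> H"
  have "x = (x \<otimes> inv y) \<otimes> y" using assms by (simp add: m_assoc)
  then have "x \<in> H #> y" using * by (auto simp: r_coset_def)
  then show "H #> x = H #> y" using repr_independence[OF _ assms(3,1)] by simp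
qed

text \<open>An invariant with finitely many values that determines the coset bounds the index.\<close>

lemma finite_rcosets_by_invariant:
  assumes "subgroup C G" "finite (f ` carrier G)"
    and "\<And>x y. x \<in> carrier G \<Longrightarrow> y \<in> carrier G \<Longrightarrow> f x = f y \<Longrightarrow> x \<otimes> inv y \<in> C"
  shows "finite (rcosets C)"
proof -
  define h where "h v = C #> (SOME g. g \<in> carrier G \<and> f g = v)" for v
  have "C #> x = h (f x)" if x: "x \<in> carrier G" for x
  proof -
    let ?y = "SOME g. g \<in> carrier G \<and> f g = f x"
    have "?y \<in> carrier G \<and> f ?y = f x" by (rule someI[of _ x]) (use x in simp)
    then have "C #> x = C #> ?y" using rcos_eq_iff[OF assms(1)] assms(3)[of x ?y] x by simp
    then show ?thesis unfolding h_def .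
  qed
  then have "rcosets C \<subseteq> h ` f ` carrier G" unfolding RCOSETS_def by auto
  then show ?thesis using assms(2) finite_surj by blast
qed

lemma finite_rcosets_image: "finite (rcosets H) \<longleftrightarrow> finite ((\<lambda>g. H #> g) ` carrier G)"
proof -
  have "rcosets H = (\<lambda>g. H #> g) ` carrier G" unfolding RCOSETS_def by auto
  then show ?thesis by simp
qed

lemma finite_index_normalD:
  assumes "finite_index_normal G K"
  shows "K \<lhd> G" "subgroup K G" "K \<subseteq> carrier G" "finite (rcosets K)" "finite_index G K" "\<one> \<in> K"
  using assms normal_imp_subgroup subgroup.subset subgroup.one_closed
  unfolding finite_index_normal_def finite_index_def by blast+

lemma finite_index_normal_Int:
  assumes "finite_index_normal G K" "finite_index_normal G K'"
  shows "finite_index_normal G (K \<inter> K')"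
proof -
  note K = finite_index_normalD[OF assms(1)] and K' = finite_index_normalD[OF assms(2)]
  have n: "K \<inter> K' \<lhd> G" using K(1) K'(1) by (rule normal_subgroup_intersect)
  let ?f = "\<lambda>g. (K #> g, K' #> g)"
  have "?f ` carrier G \<subseteq> (\<lambda>g. K #> g) ` carrier G \<times> (\<lambda>g. K' #> g) ` carrier G" by auto
  then have "finite (?f ` carrier G)"
    using K(4) K'(4) finite_rcosets_image by (meson finite_SigmaI finite_subset)
  then have "finite (rcosets (K \<inter> K'))"
    by (rule finite_rcosets_by_invariant[OF normal_imp_subgroup[OF n]])
      (use rcos_eq_iff[OF K(2)] rcos_eq_iff[OF K'(2)] in auto)
  then show ?thesis using n by (simp add: finite_index_normal_def)
qed

lemma finite_index_normal_carrier: "finite_index_normal G (carrier G)"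
proof -
  have "rcosets (carrier G) = {carrier G}"
    unfolding RCOSETS_def using coset_join2[OF _ subgroup_self] one_closed by auto
  then show ?thesis using normal_self by (simp add: finite_index_normal_def)
qed

text \<open>The kernel of the action of the group on the cosets of \<open>H\<close> by right multiplication; its index is finite because there are finitely many self-maps of a finite set.\<close>

lemma normal_core:
  assumes "finite_index G H"
  shows "\<exists>C. finite_index_normal G C \<and> C \<subseteq> H"
proof -
  have H: "subgroup H G" "finite (rcosets H)" using assms by (auto simp: finite_index_def)
  have Hc: "H \<subseteq> carrier G" using H(1) subgroup.subset by blast
  define C where "C = {g \<in> carrier G. \<forall>x\<in>carrier G. x \<otimes> g \<otimes> inv x \<in> H}"
  have sg: "subgroup C G"
  proof (rule subgroupI)
    show "C \<subseteq> carrier G" by (auto simp: C_def)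
    show "C \<noteq> {}" using subgroup.one_closed[OF H(1)] by (auto simp: C_def intro!: exI[of _ \<one>])
    fix a assume a: "a \<in> C"
    then have aG: "a \<in> carrier G" by (simp add: C_def)
    have "x \<otimes> inv a \<otimes> inv x \<in> H" if x: "x \<in> carrier G" for x
    proof -
      have "x \<otimes> inv a \<otimes> inv x = inv (x \<otimes> a \<otimes> inv x)"
        using x aG by (simp add: inv_mult_group m_assoc)
      moreover have "x \<otimes> a \<otimes> inv x \<in> H" using a x by (simp add: C_def)
      ultimately show ?thesis using subgroup.m_inv_closed[OF H(1)] by simp
    qed
    then show "inv a \<in> C" using aG by (simp add: C_def)
    fix b assume b: "b \<in> C"
    then have bG: "b \<in> carrier G" by (simp add: C_def)
    have "x \<otimes> (a \<otimes> b) \<otimes> inv x \<in> H" if x: "x \<in> carrier G" for x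
    proof -
      have "x \<otimes> (a \<otimes> b) \<otimes> inv x = (x \<otimes> a \<otimes> inv x) \<otimes> (x \<otimes> b \<otimes> inv x)"
        using x aG bG by (simp add: m_assoc inv_solve_left)
      moreover have "x \<otimes> a \<otimes> inv x \<in> H" "x \<otimes> b \<otimes> inv x \<in> H" using a b x by (auto simp: C_def)
      ultimately show ?thesis using subgroup.m_closed[OF H(1)] by simp
    qed
    then show "a \<otimes> b \<in> C" using aG bG by (simp add: C_def)
  qed
  have "C \<lhd> G"
  proof (rule normal_invI[OF sg])
    fix y h assume y: "y \<in> carrier G" and h: "h \<in> C"
    then have hG: "h \<in> carrier G" by (simp add: C_def)
    have "x \<otimes> (y \<otimes> h \<otimes> inv y) \<otimes> inv x \<in> H" if x: "x \<in> carrier G" for x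
    proof -
      have "x \<otimes> (y \<otimes> h \<otimes> inv y) \<otimes> inv x = (x \<otimes> y) \<otimes> h \<otimes> inv (x \<otimes> y)"
        using x y hG by (simp add: inv_mult_group m_assoc)
      then show ?thesis using h x y by (simp add: C_def)
    qed
    then show "y \<otimes> h \<otimes> inv y \<in> C" using y hG by (simp add: C_def)
  qed
  moreover have "finite (rcosets C)"
  proof (rule finite_rcosets_by_invariant[OF sg])
    \<comment> \<open>The permutation of the cosets of \<open>H\<close> induced by \<open>g\<close>.\<close>
    let ?f = "\<lambda>g. \<lambda>A\<in>rcosets H. A #> g"
    have "?f ` carrier G \<subseteq> rcosets H \<rightarrow>\<^sub>E rcosets H"
    proof
      fix p assume "p \<in> ?f ` carrier G"
      then obtain g where g: "g \<in> carrier G" "p = ?f g" by blast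
      have "A #> g \<in> rcosets H" if A: "A \<in> rcosets H" for A
      proof -
        obtain a where a: "a \<in> carrier G" "A = H #> a" using A by (auto simp: RCOSETS_def)
        then show ?thesis using g coset_mult_assoc[OF Hc] rcosetsI[OF Hc] by simp
      qed
      then show "p \<in> rcosets H \<rightarrow>\<^sub>E rcosets H" using g by auto
    qed
    then show "finite (?f ` carrier G)"
      using finite_PiE[OF H(2), of "\<lambda>_. rcosets H"] H(2) finite_subset by blast
    fix g g' assume g: "g \<in> carrier G" "g' \<in> carrier G" "?f g = ?f g'"
    have "x \<otimes> (g \<otimes> inv g') \<otimes> inv x \<in> H" if x: "x \<in> carrier G" for x
    proof -
      have xr: "H #> x \<in> rcosets H" using x Hc rcosetsI by blast
      have "(H #> x) #> g = (H #> x) #> g'" using fun_cong[OF g(3), of "H #> x"] xr by simp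
      then have "H #> (x \<otimes> g) = H #> (x \<otimes> g')" using coset_mult_assoc[OF Hc] g x by simp
      then have "(x \<otimes> g) \<otimes> inv (x \<otimes> g') \<in> H" using rcos_eq_iff[OF H(1)] g x by simp
      then show ?thesis using g x by (simp add: inv_mult_group m_assoc)
    qed
    then show "g \<otimes> inv g' \<in> C" using g by (simp add: C_def)
  qed
  moreover have "C \<subseteq> H" using Hc by (force simp: C_def dest: bspec[of _ _ \<one>])
  ultimately show ?thesis by (auto simp: finite_index_normal_def)
qed

lemma for_deep_conj:
  assumes "for_deep G P" "for_deep G Q"
  shows "for_deep G (\<lambda>K. P K \<and> Q K)"
proof -
  obtain K0 K1 where "finite_index_normal G K0" "\<And>K. finite_index_normal G K \<Longrightarrow> K \<subseteq> K0 \<Longrightarrow> P K"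
    "finite_index_normal G K1" "\<And>K. finite_index_normal G K \<Longrightarrow> K \<subseteq> K1 \<Longrightarrow> Q K"
    using assms unfolding for_deep_def by blast
  then show ?thesis
    unfolding for_deep_def using finite_index_normal_Int by (intro exI[of _ "K0 \<inter> K1"]) auto
qed

lemma for_deep_mono:
  assumes "for_deep G P" "\<And>K. finite_index_normal G K \<Longrightarrow> P K \<Longrightarrow> Q K"
  shows "for_deep G Q"
  using assms unfolding for_deep_def by blast

lemma for_deep_True: "(\<And>K. finite_index_normal G K \<Longrightarrow> P K) \<Longrightarrow> for_deep G P"
  unfolding for_deep_def using finite_index_normal_carrier by blast

lemma for_deep_ball:
  assumes "finite I" "\<And>i. i \<in> I \<Longrightarrow> for_deep G (P i)"
  shows "for_deep G (\<lambda>K. \<forall>i\<in>I. P i K)"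
  using assms
proof (induction rule: finite_induct)
  case empty show ?case by (rule for_deep_True) simp
next
  case (insert i I)
  have "for_deep G (\<lambda>K. P i K \<and> (\<forall>i\<in>I. P i K))"
    by (rule for_deep_conj) (use insert in auto)
  then show ?case by (rule for_deep_mono) auto
qed

lemma for_deep_obtain:
  assumes "for_deep G P" obtains K where "finite_index_normal G K" "P K"
  using assms unfolding for_deep_def by blast

lemma for_deep_subset: "finite_index G H \<Longrightarrow> for_deep G (\<lambda>K. K \<subseteq> H)"
  using normal_core[of H] unfolding for_deep_def by (meson order_trans)

lemma for_deep_avoid:
  assumes "residually_finite G" "g \<in> carrier G" "g \<noteq> \<one>"
  shows "for_deep G (\<lambda>K. g \<notin> K)"
  using assms unfolding residually_finite_def for_deep_def finite_index_normal_def by blast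

lemma for_deep_separates:
  assumes "residually_finite G" "finite D" "D \<subseteq> carrier G"
  shows "for_deep G (\<lambda>K. separates G K D)"
proof -
  let ?Q = "{inv d \<otimes> d' | d d'. d \<in> D \<and> d' \<in> D} - {\<one>}"
  have "?Q \<subseteq> (\<lambda>(d, d'). inv d \<otimes> d') ` (D \<times> D)" by auto
  then have "finite ?Q" using assms(2) finite_subset by blast
  moreover have "for_deep G (\<lambda>K. g \<notin> K)" if "g \<in> ?Q" for g
    by (rule for_deep_avoid) (use assms that in auto)
  ultimately have "for_deep G (\<lambda>K. \<forall>g\<in>?Q. g \<notin> K)" by (rule for_deep_ball)
  then show ?thesis
  proof (rule for_deep_mono)
    fix K assume K: "finite_index_normal G K" and Q: "\<forall>g\<in>?Q. g \<notin> K"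
    show "separates G K D"
      unfolding separates_def
    proof (intro ballI impI)
      fix d d' k assume d: "d \<in> D" "d' \<in> D" "k \<in> K" "d \<otimes> k = d'"
      then have "k \<in> carrier G" "d \<in> carrier G" using finite_index_normalD(3)[OF K] assms(3) by auto
      then have "inv d \<otimes> d' = k" by (simp add: m_assoc[symmetric] flip: d(4))
      then show "k = \<one>" using Q d by blast
    qed
  qed
qed

lemma separates_mono: "separates G K D \<Longrightarrow> D' \<subseteq> D \<Longrightarrow> separates G K D'"
  unfolding separates_def by blast

lemma separates_translate:
  assumes "K \<lhd> G" "separates G K D" "D \<subseteq> carrier G" "g \<in> carrier G"
  shows "separates G K (D #> g)"
  unfolding separates_def
proof (intro ballI impI)
  fix e e' k assume e: "e \<in> D #> g" "e' \<in> D #> g" "k \<in> K" "e \<otimes> k = e'"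
  then obtain d d' where d: "d \<in> D" "d' \<in> D" "e = d \<otimes> g" "e' = d' \<otimes> g" by (auto simp: r_coset_def)
  have kG: "k \<in> carrier G" using subgroup.mem_carrier[OF normal_imp_subgroup[OF assms(1)] e(3)] .
  have dG: "d \<in> carrier G" "d' \<in> carrier G" using d assms(3) by auto
  have "d \<otimes> (g \<otimes> k \<otimes> inv g) = (d \<otimes> g \<otimes> k) \<otimes> inv g"
    using dG kG assms(4) by (simp add: m_assoc)
  also have "\<dots> = d'" using e(4) d dG kG assms(4) by (simp add: m_assoc)
  finally have "d \<otimes> (g \<otimes> k \<otimes> inv g) = d'" .
  moreover have "g \<otimes> k \<otimes> inv g \<in> K" using normal.inv_op_closed2[OF assms(1,4) e(3)] .
  ultimately have "g \<otimes> k \<otimes> inv g = \<one>" using assms(2) d unfolding separates_def by blast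
  then have "inv g \<otimes> (g \<otimes> k \<otimes> inv g) \<otimes> g = \<one>" using assms(4) by simp
  moreover have "inv g \<otimes> (g \<otimes> k \<otimes> inv g) \<otimes> g = k"
    using kG assms(4) by (simp add: m_assoc) (simp add: m_assoc[symmetric])
  ultimately show "k = \<one>" by simp
qed

end

section \<open>Uniform continuity\<close>

definition agree :: "'g set \<Rightarrow> ('g \<Rightarrow> 's) \<Rightarrow> ('g \<Rightarrow> 's) \<Rightarrow> bool" where
  "agree D x y \<longleftrightarrow> (\<forall>g\<in>D. x g = y g)"

lemma agree_sym: "agree D x y \<Longrightarrow> agree D y x" by (simp add: agree_def)
lemma agree_trans: "agree D x y \<Longrightarrow> agree D y z \<Longrightarrow> agree D x z" by (simp add: agree_def)
lemma agree_mono: "agree D x y \<Longrightarrow> E \<subseteq> D \<Longrightarrow> agree E x y" by (auto simp: agree_def)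
lemma agree_refl: "agree D x x" by (simp add: agree_def)

lemma topspace_full_shift: "topspace (full_shift G \<Sigma>) = carrier G \<rightarrow>\<^sub>E \<Sigma>"
  by (simp add: full_shift_def)

lemma openin_cylinder:
  assumes "finite D" "D \<subseteq> carrier G"
  shows "openin (full_shift G \<Sigma>) {y \<in> carrier G \<rightarrow>\<^sub>E \<Sigma>. agree D x y}"
  unfolding full_shift_def openin_product_topology_alt
proof
  fix z assume z: "z \<in> {y \<in> carrier G \<rightarrow>\<^sub>E \<Sigma>. agree D x y}"
  let ?U = "\<lambda>g. if g \<in> D then {z g} else \<Sigma>"
  have "{i \<in> carrier G. ?U i \<noteq> topspace (discrete_topology \<Sigma>)} \<subseteq> D" by auto
  then have "finite {i \<in> carrier G. ?U i \<noteq> topspace (discrete_topology \<Sigma>)}"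
    using assms(1) finite_subset by blast
  moreover have "\<forall>i\<in>carrier G. openin (discrete_topology \<Sigma>) (?U i)"
    using z by (auto simp: PiE_iff)
  moreover have "z \<in> Pi\<^sub>E (carrier G) ?U" using z by (auto simp: PiE_iff)
  moreover have "Pi\<^sub>E (carrier G) ?U \<subseteq> {y \<in> carrier G \<rightarrow>\<^sub>E \<Sigma>. agree D x y}"
  proof
    fix y assume y: "y \<in> Pi\<^sub>E (carrier G) ?U"
    have "y g = z g" if "g \<in> D" for g using y that assms(2) by (auto simp: PiE_iff subset_iff dest!: bspec[of _ _ g])
    moreover have "y g \<in> \<Sigma>" if "g \<in> carrier G" for g
      using y z that by (cases "g \<in> D") (auto simp: PiE_iff dest!: bspec[of _ _ g])
    ultimately show "y \<in> {y \<in> carrier G \<rightarrow>\<^sub>E \<Sigma>. agree D x y}"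
      using y z by (auto simp: PiE_iff agree_def)
  qed
  ultimately show "\<exists>U. finite {i \<in> carrier G. U i \<noteq> topspace (discrete_topology \<Sigma>)} \<and>
      (\<forall>i\<in>carrier G. openin (discrete_topology \<Sigma>) (U i)) \<and> z \<in> Pi\<^sub>E (carrier G) U \<and>
      Pi\<^sub>E (carrier G) U \<subseteq> {y \<in> carrier G \<rightarrow>\<^sub>E \<Sigma>. agree D x y}"
    by (intro exI[of _ ?U] conjI)
qed

lemma openin_contains_cylinder:
  assumes "openin (full_shift G \<Sigma>) U" "x \<in> U"
  shows "\<exists>D. finite D \<and> D \<subseteq> carrier G \<and> (\<forall>y\<in>carrier G \<rightarrow>\<^sub>E \<Sigma>. agree D x y \<longrightarrow> y \<in> U)"
proof -
  obtain V where V: "finite {i \<in> carrier G. V i \<noteq> topspace (discrete_topology \<Sigma>)}"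
      "x \<in> Pi\<^sub>E (carrier G) V" "Pi\<^sub>E (carrier G) V \<subseteq> U"
    using assms unfolding full_shift_def openin_product_topology_alt by blast
  let ?D = "{i \<in> carrier G. V i \<noteq> topspace (discrete_topology \<Sigma>)}"
  have "y \<in> U" if y: "y \<in> carrier G \<rightarrow>\<^sub>E \<Sigma>" "agree ?D x y" for y
  proof -
    have "y i \<in> V i" if i: "i \<in> carrier G" for i
    proof (cases "i \<in> ?D")
      case True
      then have "y i = x i" using y(2) by (simp add: agree_def)
      then show ?thesis using V(2) i by auto
    next
      case False then show ?thesis using y(1) i by auto
    qed
    then have "y \<in> Pi\<^sub>E (carrier G) V" using y(1) by (auto simp: PiE_iff)
    then show ?thesis using V(3) by blast
  qed
  then show ?thesis using V(1) by blast
qed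

lemma compactin_closed_full_shift:
  assumes "finite \<Sigma>" "closedin (full_shift G \<Sigma>) Y"
  shows "compactin (full_shift G \<Sigma>) Y"
proof -
  have "compact_space (full_shift G \<Sigma>)"
    unfolding full_shift_def compact_space_product_topology
    using assms(1) by (simp add: compact_space_discrete_topology)
  then show ?thesis using assms(2) closedin_compact_space by blast
qed

text \<open>Compactness: near each point membership in \<open>C\<close> depends on finitely many coordinates, and finitely many such neighbourhoods cover \<open>Y\<close>.\<close>

lemma clopen_finite_window:
  assumes "finite \<Sigma>" "closedin (full_shift G \<Sigma>) Y"
    and C: "openin (subtopology (full_shift G \<Sigma>) Y) C" "openin (subtopology (full_shift G \<Sigma>) Y) (Y - C)"
  shows "\<exists>D. finite D \<and> D \<subseteq> carrier G \<and> (\<forall>x\<in>Y. \<forall>y\<in>Y. agree D x y \<longrightarrow> (x \<in> C \<longleftrightarrow> y \<in> C))"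
proof -
  have Y: "Y \<subseteq> carrier G \<rightarrow>\<^sub>E \<Sigma>"
    using assms(2) closedin_subset topspace_full_shift by metis
  obtain U V where UV: "openin (full_shift G \<Sigma>) U" "C = U \<inter> Y" "openin (full_shift G \<Sigma>) V" "Y - C = V \<inter> Y"
    using C unfolding openin_subtopology by blast
  have "\<exists>D. finite D \<and> D \<subseteq> carrier G \<and> (\<forall>y\<in>Y. agree D x y \<longrightarrow> (x \<in> C \<longleftrightarrow> y \<in> C))" if x: "x \<in> Y" for x
  proof (cases "x \<in> C")
    case True
    then have "x \<in> U" using UV by blast
    then obtain D where "finite D" "D \<subseteq> carrier G" "\<And>y. y \<in> carrier G \<rightarrow>\<^sub>E \<Sigma> \<Longrightarrow> agree D x y \<Longrightarrow> y \<in> U"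
      using openin_contains_cylinder[OF UV(1)] by metis
    then show ?thesis using True UV(2) Y by (intro exI[of _ D]) auto
  next
    case False
    then have "x \<in> V" using UV x by blast
    then obtain D where "finite D" "D \<subseteq> carrier G" "\<And>y. y \<in> carrier G \<rightarrow>\<^sub>E \<Sigma> \<Longrightarrow> agree D x y \<Longrightarrow> y \<in> V"
      using openin_contains_cylinder[OF UV(3)] by metis
    moreover have "y \<notin> C" if "y \<in> V" "y \<in> Y" for y using that UV(4) by auto
    ultimately show ?thesis using False Y by (intro exI[of _ D]) auto
  qed
  then obtain D where D: "\<And>x. x \<in> Y \<Longrightarrow> finite (D x)" "\<And>x. x \<in> Y \<Longrightarrow> D x \<subseteq> carrier G"
      "\<And>x y. x \<in> Y \<Longrightarrow> y \<in> Y \<Longrightarrow> agree (D x) x y \<Longrightarrow> (x \<in> C \<longleftrightarrow> y \<in> C)" by metis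
  let ?W = "\<lambda>x. {y \<in> carrier G \<rightarrow>\<^sub>E \<Sigma>. agree (D x) x y}"
  have cover: "Y \<subseteq> \<Union> (?W ` Y)"
  proof
    fix x assume "x \<in> Y"
    then have "x \<in> ?W x" using subsetD[OF Y] by (simp add: agree_refl)
    then show "x \<in> \<Union> (?W ` Y)" using \<open>x \<in> Y\<close> by (rule UN_I[rotated])
  qed
  have "openin (full_shift G \<Sigma>) W" if "W \<in> ?W ` Y" for W
    using that openin_cylinder D by blast
  then obtain \<F> where \<F>: "finite \<F>" "\<F> \<subseteq> ?W ` Y" "Y \<subseteq> \<Union> \<F>"
    using compactinD[OF compactin_closed_full_shift[OF assms(1,2)], of "?W ` Y"] cover by blast
  obtain Z where Z: "finite Z" "Z \<subseteq> Y" "\<F> = ?W ` Z" using finite_subset_image[OF \<F>(1,2)] by blast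
  have "x \<in> C \<longleftrightarrow> y \<in> C" if xy: "x \<in> Y" "y \<in> Y" "agree (\<Union> (D ` Z)) x y" for x y
  proof -
    obtain z where z: "z \<in> Z" "agree (D z) z x" using \<F>(3) Z(3) xy(1) by blast
    have "agree (D z) x y" using agree_mono[OF xy(3)] z(1) by blast
    then have "agree (D z) z y" using z(2) agree_trans by blast
    then show ?thesis using D(3) z Z(2) xy by blast
  qed
  moreover have "finite (\<Union> (D ` Z))" "\<Union> (D ` Z) \<subseteq> carrier G" using Z D by auto
  ultimately show ?thesis by blast
qed

section \<open>Self-homeomorphisms of a subshift\<close>

lemma (in group) inv_cancel:
  assumes "x \<in> carrier G" "y \<in> carrier G"
  shows "inv x \<otimes> (x \<otimes> y) = y" "x \<otimes> (inv x \<otimes> y) = y"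
  using assms by (simp_all add: m_assoc[symmetric])

locale subshift_space = group G for G :: "('g, 'm) monoid_scheme" (structure) +
  fixes \<Sigma> :: "'s set" and X :: "('g \<Rightarrow> 's) set"
  assumes finite_alphabet: "finite \<Sigma>" and is_subshift: "subshift G \<Sigma> X"
begin

abbreviation BX :: "(('g \<Rightarrow> 's) \<Rightarrow> 'g \<Rightarrow> 's) monoid" where "BX \<equiv> BijGroup X"

abbreviation bmult (infixl "\<odot>" 70) where "f \<odot> g \<equiv> f \<otimes>\<^bsub>BX\<^esub> g"

abbreviation binv where "binv f \<equiv> inv\<^bsub>BX\<^esub> f"

abbreviation bone where "bone \<equiv> \<one>\<^bsub>BX\<^esub>"

lemma carrier_BX: "carrier BX = Bij X"
  by (simp add: BijGroup_def)

sublocale BX: group BX rewrites "carrier BX = Bij X"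
  by (rule group_BijGroup) (rule carrier_BX)

lemma Bij_mem: "f \<in> Bij X \<Longrightarrow> x \<in> X \<Longrightarrow> f x \<in> X"
  using Bij_imp_funcset[of f X] by (rule funcset_mem)

lemma bmult_apply: "f \<in> Bij X \<Longrightarrow> g \<in> Bij X \<Longrightarrow> x \<in> X \<Longrightarrow> (f \<odot> g) x = f (g x)"
  by (simp add: BijGroup_def compose_def)

lemma bone_apply: "x \<in> X \<Longrightarrow> bone x = x"
  by (simp add: BijGroup_def)

lemma Bij_eqI:
  assumes "f \<in> Bij X" "g \<in> Bij X" "\<And>x. x \<in> X \<Longrightarrow> f x = g x"
  shows "f = g"
  using assms extensionalityI[of f X g] by (auto simp: Bij_def)

lemma binv_apply:
  assumes "f \<in> Bij X" "x \<in> X"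
  shows "f (binv f x) = x" "binv f (f x) = x"
proof -
  have "f (binv f x) = (f \<odot> binv f) x" "binv f (f x) = (binv f \<odot> f) x"
    by (rule bmult_apply[symmetric]; use assms in simp)+
  then show "f (binv f x) = x" "binv f (f x) = x"
    using assms by (simp_all add: bone_apply)
qed

lemma X_config: "x \<in> X \<Longrightarrow> x \<in> carrier G \<rightarrow>\<^sub>E \<Sigma>"
  using is_subshift closedin_subset[of "full_shift G \<Sigma>" X] topspace_full_shift[of G \<Sigma>]
  unfolding subshift_def by auto

lemma X_closed: "closedin (full_shift G \<Sigma>) X"
  using is_subshift by (simp add: subshift_def)

lemma X_eqI: "x \<in> X \<Longrightarrow> y \<in> X \<Longrightarrow> (\<And>g. g \<in> carrier G \<Longrightarrow> x g = y g) \<Longrightarrow> x = y"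
  by (rule PiE_ext[OF X_config X_config])

text \<open>Uniform continuity in combinatorial form. Unlike continuity it can be used coordinate by coordinate; by compactness the two agree, see \<open>Homeo_iff\<close>.\<close>

definition local_map :: "(('g \<Rightarrow> 's) \<Rightarrow> 'g \<Rightarrow> 's) \<Rightarrow> bool" where
  "local_map f \<longleftrightarrow> (\<forall>g\<in>carrier G. \<exists>D. finite D \<and> D \<subseteq> carrier G \<and>
     (\<forall>x\<in>X. \<forall>y\<in>X. agree D x y \<longrightarrow> f x g = f y g))"

lemma local_map_finite:
  assumes "local_map f" "finite E" "E \<subseteq> carrier G"
  obtains D where "finite D" "D \<subseteq> carrier G"
    "\<And>x y. x \<in> X \<Longrightarrow> y \<in> X \<Longrightarrow> agree D x y \<Longrightarrow> agree E (f x) (f y)"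
proof -
  have "\<forall>g\<in>carrier G. \<exists>D. finite D \<and> D \<subseteq> carrier G \<and> (\<forall>x\<in>X. \<forall>y\<in>X. agree D x y \<longrightarrow> f x g = f y g)"
    using assms(1) by (simp add: local_map_def)
  then obtain D where D: "\<And>g. g \<in> carrier G \<Longrightarrow> finite (D g)" "\<And>g. g \<in> carrier G \<Longrightarrow> D g \<subseteq> carrier G"
    "\<And>g x y. g \<in> carrier G \<Longrightarrow> x \<in> X \<Longrightarrow> y \<in> X \<Longrightarrow> agree (D g) x y \<Longrightarrow> f x g = f y g"
    by metis
  show thesis
  proof (rule that[of "\<Union> (D ` E)"])
    show "finite (\<Union> (D ` E))" using assms D(1) by auto
    show "\<Union> (D ` E) \<subseteq> carrier G" using assms D(2) by auto
    fix x y assume xy: "x \<in> X" "y \<in> X" "agree (\<Union> (D ` E)) x y"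
    have "f x g = f y g" if g: "g \<in> E" for g
    proof -
      have "agree (D g) x y" using agree_mono[OF xy(3)] g by auto
      then show ?thesis using D(3) xy g assms(3) by auto
    qed
    then show "agree E (f x) (f y)" by (simp add: agree_def)
  qed
qed

lemma topspace_X: "topspace (subtopology (full_shift G \<Sigma>) X) = X"
  using X_config by (auto simp: topspace_subtopology topspace_full_shift)

lemma continuous_imp_local:
  assumes f: "continuous_map (subtopology (full_shift G \<Sigma>) X) (subtopology (full_shift G \<Sigma>) X) f"
  shows "local_map f"
  unfolding local_map_def
proof
  fix g assume g: "g \<in> carrier G"
  let ?T = "subtopology (full_shift G \<Sigma>) X"
  have fX: "f x \<in> X" if "x \<in> X" for x
    using continuous_map_funspace[OF f] that unfolding topspace_X by auto
  have c: "continuous_map ?T (discrete_topology \<Sigma>) (\<lambda>x. f x g)"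
  proof -
    have "continuous_map ?T (full_shift G \<Sigma>) f"
      using f continuous_map_in_subtopology by blast
    then show ?thesis
      unfolding full_shift_def continuous_map_componentwise using g by blast
  qed
  have pre: "openin ?T {x \<in> X. f x g \<in> U}" if "U \<subseteq> \<Sigma>" for U
    using c that unfolding continuous_map_def topspace_X by simp
  have "\<exists>D. finite D \<and> D \<subseteq> carrier G \<and> (\<forall>x\<in>X. \<forall>y\<in>X. agree D x y \<longrightarrow> (f x g = s \<longleftrightarrow> f y g = s))"
    if s: "s \<in> \<Sigma>" for s
  proof -
    have fxg: "f x g \<in> \<Sigma>" if "x \<in> X" for x using X_config[OF fX[OF that]] g by auto
    have 1: "{x \<in> X. f x g \<in> {s}} = {x \<in> X. f x g = s}" by auto
    have 2: "{x \<in> X. f x g \<in> \<Sigma> - {s}} = X - {x \<in> X. f x g = s}" using fxg by auto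
    have "\<exists>D. finite D \<and> D \<subseteq> carrier G \<and>
      (\<forall>x\<in>X. \<forall>y\<in>X. agree D x y \<longrightarrow> (x \<in> {x \<in> X. f x g = s} \<longleftrightarrow> y \<in> {x \<in> X. f x g = s}))"
      using clopen_finite_window[OF finite_alphabet X_closed, of "{x \<in> X. f x g = s}"]
        pre[of "{s}"] pre[of "\<Sigma> - {s}"] s unfolding 1 2 by simp
    then show ?thesis by simp
  qed
  then obtain D where D: "\<And>s. s \<in> \<Sigma> \<Longrightarrow> finite (D s)" "\<And>s. s \<in> \<Sigma> \<Longrightarrow> D s \<subseteq> carrier G"
    "\<And>s x y. s \<in> \<Sigma> \<Longrightarrow> x \<in> X \<Longrightarrow> y \<in> X \<Longrightarrow> agree (D s) x y \<Longrightarrow> (f x g = s \<longleftrightarrow> f y g = s)"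
    by metis
  have "f x g = f y g" if xy: "x \<in> X" "y \<in> X" "agree (\<Union> (D ` \<Sigma>)) x y" for x y
  proof -
    have s: "f x g \<in> \<Sigma>" using X_config[OF fX[OF xy(1)]] g by auto
    have "agree (D (f x g)) x y" using agree_mono[OF xy(3)] s by auto
    then show ?thesis using D(3)[OF s xy(1,2)] by simp
  qed
  moreover have "finite (\<Union> (D ` \<Sigma>))" "\<Union> (D ` \<Sigma>) \<subseteq> carrier G" using D finite_alphabet by auto
  ultimately show "\<exists>D. finite D \<and> D \<subseteq> carrier G \<and> (\<forall>x\<in>X. \<forall>y\<in>X. agree D x y \<longrightarrow> f x g = f y g)"
    by (intro exI[of _ "\<Union> (D ` \<Sigma>)"]) simp
qed

lemma local_imp_continuous:
  assumes "local_map f" and fX: "\<And>x. x \<in> X \<Longrightarrow> f x \<in> X"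
  shows "continuous_map (subtopology (full_shift G \<Sigma>) X) (subtopology (full_shift G \<Sigma>) X) f"
proof -
  let ?T = "subtopology (full_shift G \<Sigma>) X"
  have "continuous_map ?T (discrete_topology \<Sigma>) (\<lambda>x. f x g)" if g: "g \<in> carrier G" for g
    unfolding continuous_map_def topspace_X
  proof (intro conjI allI impI)
    show "(\<lambda>x. f x g) \<in> X \<rightarrow> topspace (discrete_topology \<Sigma>)"
      using X_config[OF fX] g by auto
    fix U
    obtain D where D: "finite D" "D \<subseteq> carrier G" "\<And>x y. x \<in> X \<Longrightarrow> y \<in> X \<Longrightarrow> agree D x y \<Longrightarrow> f x g = f y g"
      using assms(1) g unfolding local_map_def by metis
    show "openin ?T {x \<in> X. f x g \<in> U}"
    proof (subst openin_subopen, intro ballI)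
      fix x assume x: "x \<in> {x \<in> X. f x g \<in> U}"
      let ?W = "{y \<in> carrier G \<rightarrow>\<^sub>E \<Sigma>. agree D x y} \<inter> X"
      have "openin ?T ?W"
        using openin_cylinder[OF D(1,2)] unfolding openin_subtopology by blast
      moreover have "x \<in> ?W" using x X_config by (simp add: agree_refl)
      moreover have "?W \<subseteq> {x \<in> X. f x g \<in> U}"
      proof
        fix y assume y: "y \<in> ?W"
        then have "f y g = f x g" using D(3)[of x y] x by simp
        then show "y \<in> {x \<in> X. f x g \<in> U}" using x y by simp
      qed
      ultimately show "\<exists>W. openin ?T W \<and> x \<in> W \<and> W \<subseteq> {x \<in> X. f x g \<in> U}"
        by (intro exI[of _ ?W]) simp
    qed
  qed
  moreover have "f \<in> X \<rightarrow> extensional (carrier G)"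
    using X_config[OF fX] by (auto simp: PiE_iff)
  ultimately have "continuous_map ?T (full_shift G \<Sigma>) f"
    unfolding full_shift_def continuous_map_componentwise
    using topspace_X by (auto simp: full_shift_def)
  then show ?thesis
    using fX topspace_X by (auto simp: continuous_map_in_subtopology)
qed

text \<open>One direction is compactness; conversely a continuous bijection of a compact Hausdorff space is a homeomorphism.\<close>

lemma Homeo_iff: "f \<in> Homeo G \<Sigma> X \<longleftrightarrow> f \<in> Bij X \<and> local_map f"
proof
  assume "f \<in> Homeo G \<Sigma> X"
  then show "f \<in> Bij X \<and> local_map f"
    using continuous_imp_local homeomorphic_imp_continuous_map by (auto simp: Homeo_def)
next
  assume f: "f \<in> Bij X \<and> local_map f"
  let ?T = "subtopology (full_shift G \<Sigma>) X"
  have "continuous_map ?T ?T f" using f local_imp_continuous Bij_mem by simp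
  moreover have "compact_space ?T"
    using compactin_closed_full_shift[OF finite_alphabet X_closed] by (simp add: compact_space_subtopology)
  moreover have "Hausdorff_space ?T"
    by (intro Hausdorff_space_subtopology) (simp add: full_shift_def Hausdorff_space_product_topology)
  moreover have "f ` X = X" "inj_on f X" using f by (auto simp: Bij_def bij_betw_def)
  ultimately have "homeomorphic_map ?T ?T f"
    using continuous_imp_homeomorphic_map[of ?T ?T f] topspace_X by simp
  then show "f \<in> Homeo G \<Sigma> X" using f by (simp add: Homeo_def)
qed

lemma Homeo_Bij: "f \<in> Homeo G \<Sigma> X \<Longrightarrow> f \<in> Bij X"
  by (simp add: Homeo_def)

lemma Homeo_mult:
  assumes "f \<in> Homeo G \<Sigma> X" "g \<in> Homeo G \<Sigma> X" shows "f \<odot> g \<in> Homeo G \<Sigma> X"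
proof -
  have fg: "f \<in> Bij X" "local_map f" "g \<in> Bij X" "local_map g" using assms Homeo_iff by auto
  have "local_map (f \<odot> g)"
    unfolding local_map_def
  proof
    fix h assume "h \<in> carrier G"
    then obtain E where E: "finite E" "E \<subseteq> carrier G" "\<And>x y. x \<in> X \<Longrightarrow> y \<in> X \<Longrightarrow> agree E x y \<Longrightarrow> f x h = f y h"
      using fg(2) unfolding local_map_def by metis
    obtain D where D: "finite D" "D \<subseteq> carrier G" "\<And>x y. x \<in> X \<Longrightarrow> y \<in> X \<Longrightarrow> agree D x y \<Longrightarrow> agree E (g x) (g y)"
      using local_map_finite[OF fg(4) E(1,2)] by metis
    show "\<exists>D. finite D \<and> D \<subseteq> carrier G \<and> (\<forall>x\<in>X. \<forall>y\<in>X. agree D x y \<longrightarrow> (f \<odot> g) x h = (f \<odot> g) y h)"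
      using D E(3) fg by (intro exI[of _ D]) (simp add: bmult_apply Bij_mem)
  qed
  then show ?thesis using fg Homeo_iff by simp
qed

lemma Homeo_one: "bone \<in> Homeo G \<Sigma> X"
proof -
  have "local_map bone"
    unfolding local_map_def
  proof
    fix h assume "h \<in> carrier G"
    then show "\<exists>D. finite D \<and> D \<subseteq> carrier G \<and> (\<forall>x\<in>X. \<forall>y\<in>X. agree D x y \<longrightarrow> bone x h = bone y h)"
      by (intro exI[of _ "{h}"]) (simp add: bone_apply agree_def)
  qed
  then show ?thesis using Homeo_iff by simp
qed

lemma Homeo_inv:
  assumes "f \<in> Homeo G \<Sigma> X" shows "binv f \<in> Homeo G \<Sigma> X"
proof -
  let ?T = "subtopology (full_shift G \<Sigma>) X"
  have f: "f \<in> Bij X" "homeomorphic_map ?T ?T f" using assms by (auto simp: Homeo_def)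
  obtain g where g: "homeomorphic_maps ?T ?T f g" using f(2) homeomorphic_map_maps by blast
  then have gc: "continuous_map ?T ?T g" and gf: "\<And>x. x \<in> X \<Longrightarrow> g (f x) = x"
    unfolding homeomorphic_maps_def topspace_X by auto
  have "binv f x = g x" if x: "x \<in> X" for x
    using gf[of "binv f x"] x f(1) by (simp add: binv_apply Bij_mem)
  then have "local_map (binv f) \<longleftrightarrow> local_map g"
    unfolding local_map_def by (metis (no_types))
  then show ?thesis using continuous_imp_local[OF gc] Homeo_iff f(1) by simp
qed

section \<open>Finite products of commuting bijections\<close>

text \<open>The bijection group is not commutative, but finite products of such a family do not depend on the order of the factors.\<close>

definition commuting :: "('i \<Rightarrow> ('g \<Rightarrow> 's) \<Rightarrow> 'g \<Rightarrow> 's) \<Rightarrow> 'i set \<Rightarrow> bool" where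
  "commuting a I \<longleftrightarrow> (\<forall>i\<in>I. a i \<in> Bij X) \<and> (\<forall>i\<in>I. \<forall>j\<in>I. a i \<odot> a j = a j \<odot> a i)"

lemma commuting_mono: "commuting a I \<Longrightarrow> J \<subseteq> I \<Longrightarrow> commuting a J"
  unfolding commuting_def by (meson subsetD)

lemma commuting_Bij: "commuting a I \<Longrightarrow> i \<in> I \<Longrightarrow> a i \<in> Bij X"
  by (simp add: commuting_def)

lemma commuting_insertD:
  assumes "commuting a (insert i F)"
  shows "commuting a F" "a i \<in> Bij X"
  using assms unfolding commuting_def by auto

lemma commuting_cong:
  assumes "\<And>i. i \<in> I \<Longrightarrow> a i = b i"
  shows "commuting a I \<longleftrightarrow> commuting b I"
  unfolding commuting_def by (intro conj_cong ball_cong refl) (simp_all add: assms)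

lemma finite_prod_empty: "finprod BX a {} = bone"
  unfolding finprod_def using carrier_BX by simp

text \<open>The fold behind finite products only needs the factors to commute with each other.\<close>

lemma finite_prod_insert:
  assumes c: "commuting a (insert i F)" and "finite F" "i \<notin> F"
  shows "finprod BX a (insert i F) = a i \<odot> finprod BX a F"
proof -
  interpret LCD "insert i F" "carrier BX" "mult BX \<circ> a"
  proof
    fix x y z assume xyz: "x \<in> insert i F" "y \<in> insert i F" "z \<in> carrier BX"
    then have b: "a x \<in> Bij X" "a y \<in> Bij X" "z \<in> Bij X" "a x \<odot> a y = a y \<odot> a x"
      using c carrier_BX unfolding commuting_def by auto
    then show "(mult BX \<circ> a) x ((mult BX \<circ> a) y z) = (mult BX \<circ> a) y ((mult BX \<circ> a) x z)"
      by (simp add: BX.m_assoc[symmetric])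
  next
    fix x y assume "x \<in> insert i F" "y \<in> carrier BX"
    then show "(mult BX \<circ> a) x y \<in> carrier BX"
      using c carrier_BX unfolding commuting_def by auto
  qed
  have "foldD (carrier BX) (mult BX \<circ> a) bone (insert i F) = (mult BX \<circ> a) i (foldD (carrier BX) (mult BX \<circ> a) bone F)"
    by (rule foldD_insert) (use assms carrier_BX in auto)
  then show ?thesis unfolding finprod_def using assms(2) by simp
qed

lemma finite_prod_closed:
  assumes "finite F" "commuting a F"
  shows "finprod BX a F \<in> Bij X"
  using assms
proof (induction rule: finite_induct)
  case empty then show ?case by (simp add: finite_prod_empty)
next
  case (insert i F)
  then have "commuting a F" "a i \<in> Bij X" using commuting_mono by (auto simp: commuting_def)
  then show ?case using insert by (simp add: finite_prod_insert)
qed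

lemma finite_prod_commute:
  assumes "finite F" "commuting a F" "z \<in> Bij X" "\<And>i. i \<in> F \<Longrightarrow> z \<odot> a i = a i \<odot> z"
  shows "z \<odot> finprod BX a F = finprod BX a F \<odot> z"
  using assms
proof (induction rule: finite_induct)
  case empty then show ?case by (simp add: finite_prod_empty)
next
  case (insert i F)
  note c = commuting_insertD[OF insert.prems(1)]
  have cl: "finprod BX a F \<in> Bij X" using finite_prod_closed insert c by blast
  have z: "z \<in> Bij X" "z \<odot> a i = a i \<odot> z" using insert.prems by auto
  have IH: "z \<odot> finprod BX a F = finprod BX a F \<odot> z"
    using insert.IH c insert.prems by blast
  have "z \<odot> (a i \<odot> finprod BX a F) = (z \<odot> a i) \<odot> finprod BX a F"
    using z(1) c cl by (simp add: BX.m_assoc)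
  also have "\<dots> = a i \<odot> (z \<odot> finprod BX a F)"
    unfolding z(2) using z(1) c cl by (simp add: BX.m_assoc)
  also have "\<dots> = a i \<odot> finprod BX a F \<odot> z"
    unfolding IH using z(1) c cl by (simp add: BX.m_assoc)
  finally show ?case using finite_prod_insert[OF insert.prems(1) insert.hyps] by simp
qed

lemma finite_prod_union:
  assumes "finite E" "finite F" "E \<inter> F = {}" "commuting a (E \<union> F)"
  shows "finprod BX a (E \<union> F) = finprod BX a E \<odot> finprod BX a F"
  using assms
proof (induction rule: finite_induct)
  case empty then show ?case using finite_prod_closed[of F a] by (simp add: finite_prod_empty)
next
  case (insert i E)
  have c: "commuting a (insert i (E \<union> F))" using insert.prems by simp
  have c': "commuting a (E \<union> F)" "commuting a E" "commuting a F" "commuting a (insert i E)"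
    by (rule commuting_mono[OF c], auto)+
  have ai: "a i \<in> Bij X" using commuting_Bij[OF c, of i] by simp
  have "finprod BX a (insert i E \<union> F) = a i \<odot> finprod BX a (E \<union> F)"
    using finite_prod_insert[OF c] insert by simp
  also have "\<dots> = a i \<odot> finprod BX a E \<odot> finprod BX a F"
    using insert.IH insert.prems insert.hyps(1) c' ai finite_prod_closed[of E a] finite_prod_closed[of F a]
    by (simp add: BX.m_assoc)
  finally show ?case using finite_prod_insert[OF c'(4)] insert by simp
qed

lemma finite_prod_cong:
  assumes "finite F" "commuting a F" "\<And>i. i \<in> F \<Longrightarrow> a i = b i"
  shows "finprod BX a F = finprod BX b F"
  using assms
proof (induction rule: finite_induct)
  case empty then show ?case by (simp add: finite_prod_empty)
next
  case (insert i F)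
  have "commuting b (insert i F)" using insert.prems(1) commuting_cong[of "insert i F" a b] insert.prems(2) by blast
  moreover have "commuting a F" by (rule commuting_insertD(1)[OF insert.prems(1)])
  ultimately show ?case using insert by (simp add: finite_prod_insert)
qed

lemma finite_prod_reindex:
  assumes "finite F" "inj_on \<theta> F" "commuting a (\<theta> ` F)"
  shows "finprod BX a (\<theta> ` F) = finprod BX (\<lambda>i. a (\<theta> i)) F"
  using assms
proof (induction rule: finite_induct)
  case empty then show ?case by (simp add: finite_prod_empty)
next
  case (insert i F)
  have 1: "commuting a (\<theta> ` F)" using insert.prems(2) commuting_mono by (metis image_mono subset_insertI)
  have 2: "commuting (\<lambda>i. a (\<theta> i)) (insert i F)" using insert.prems(2) unfolding commuting_def by blast
  have 3: "commuting a (insert (\<theta> i) (\<theta> ` F))" using insert.prems(2) by simp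
  have "\<theta> i \<notin> \<theta> ` F" using insert by auto
  then have "finprod BX a (\<theta> ` insert i F) = a (\<theta> i) \<odot> finprod BX a (\<theta> ` F)"
    using finite_prod_insert[OF 3] insert.hyps(1) by simp
  also have "finprod BX a (\<theta> ` F) = finprod BX (\<lambda>i. a (\<theta> i)) F"
    using insert.IH insert.prems(1) 1 by simp
  finally show ?case unfolding finite_prod_insert[OF 2 insert.hyps] .
qed

lemma finite_prod_mult:
  assumes "finite F" "commuting a F" "commuting b F"
    and "\<And>i j. i \<in> F \<Longrightarrow> j \<in> F \<Longrightarrow> i \<noteq> j \<Longrightarrow> a i \<odot> b j = b j \<odot> a i"
    and "commuting (\<lambda>i. a i \<odot> b i) F"
  shows "finprod BX (\<lambda>i. a i \<odot> b i) F = finprod BX a F \<odot> finprod BX b F"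
  using assms
proof (induction rule: finite_induct)
  case empty then show ?case by (simp add: finite_prod_empty)
next
  case (insert i F)
  note c = commuting_insertD(1)[OF insert.prems(1)] commuting_insertD(1)[OF insert.prems(2)]
    commuting_insertD(1)[OF insert.prems(4)] commuting_insertD(2)[OF insert.prems(1)]
    commuting_insertD(2)[OF insert.prems(2)]
  have cl: "finprod BX a F \<in> Bij X" "finprod BX b F \<in> Bij X" using finite_prod_closed insert c by blast+
  have sw: "b i \<odot> finprod BX a F = finprod BX a F \<odot> b i"
    by (rule finite_prod_commute[OF insert.hyps(1) c(1) c(5)]) (rule insert.prems(3)[symmetric], use insert.hyps in auto)
  have "finprod BX (\<lambda>i. a i \<odot> b i) (insert i F) = (a i \<odot> b i) \<odot> (finprod BX a F \<odot> finprod BX b F)"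
    using finite_prod_insert[OF insert.prems(4)] insert c by simp
  also have "\<dots> = a i \<odot> (b i \<odot> finprod BX a F) \<odot> finprod BX b F"
    using c cl by (simp add: BX.m_assoc)
  also have "\<dots> = (a i \<odot> finprod BX a F) \<odot> (b i \<odot> finprod BX b F)"
    using c cl unfolding sw by (simp add: BX.m_assoc)
  finally show ?case using finite_prod_insert[OF insert.prems(1)] finite_prod_insert[OF insert.prems(2)] insert by simp
qed

lemma conj_mult:
  assumes "f \<in> Bij X" "a \<in> Bij X" "b \<in> Bij X"
  shows "(f \<odot> a \<odot> binv f) \<odot> (f \<odot> b \<odot> binv f) = f \<odot> (a \<odot> b) \<odot> binv f"
  using assms by (simp add: BX.m_assoc BX.inv_cancel)

lemma commuting_conj:
  assumes "commuting a I" "f \<in> Bij X"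
  shows "commuting (\<lambda>i. f \<odot> a i \<odot> binv f) I"
  using assms unfolding commuting_def by (simp add: conj_mult)

lemma finite_prod_conj:
  assumes "finite F" "commuting a F" "f \<in> Bij X"
  shows "finprod BX (\<lambda>i. f \<odot> a i \<odot> binv f) F = f \<odot> finprod BX a F \<odot> binv f"
  using assms
proof (induction rule: finite_induct)
  case empty then show ?case by (simp add: finite_prod_empty)
next
  case (insert i F)
  note c = commuting_insertD[OF insert.prems(1)]
  have "finprod BX (\<lambda>i. f \<odot> a i \<odot> binv f) (insert i F) = (f \<odot> a i \<odot> binv f) \<odot> (f \<odot> finprod BX a F \<odot> binv f)"
    using finite_prod_insert[OF commuting_conj[OF insert.prems]] insert c by simp
  also have "\<dots> = f \<odot> (a i \<odot> finprod BX a F) \<odot> binv f"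
    by (rule conj_mult) (use insert c finite_prod_closed in auto)
  finally show ?case using finite_prod_insert[OF insert.prems(1)] insert by simp
qed

lemma finite_prod_Homeo:
  assumes "finite F" "commuting a F" "\<And>i. i \<in> F \<Longrightarrow> a i \<in> Homeo G \<Sigma> X"
  shows "finprod BX a F \<in> Homeo G \<Sigma> X"
  using assms
proof (induction rule: finite_induct)
  case empty then show ?case by (simp add: finite_prod_empty Homeo_one)
next
  case (insert i F)
  then have "commuting a F" using commuting_mono by blast
  then show ?case using insert by (simp add: finite_prod_insert Homeo_mult)
qed

lemma finite_prod_fixes_coordinate:
  assumes "finite F" "commuting a F" "\<And>i x. i \<in> F \<Longrightarrow> x \<in> X \<Longrightarrow> a i x g = x g" "x \<in> X"
  shows "finprod BX a F x g = x g"
  using assms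
proof (induction rule: finite_induct)
  case empty then show ?case by (simp add: finite_prod_empty bone_apply)
next
  case (insert i F)
  note c = commuting_insertD[OF insert.prems(1)]
  have "finprod BX a F \<in> Bij X" by (rule finite_prod_closed[OF insert.hyps(1) c(1)])
  then show ?case using insert c by (simp add: finite_prod_insert bmult_apply Bij_mem)
qed

end

section \<open>Infinite products of locally finite commuting families\<close>

lemma (in group) commute_products:
  assumes G: "a \<in> carrier G" "b \<in> carrier G" "c \<in> carrier G" "d \<in> carrier G"
    and "a \<otimes> c = c \<otimes> a" "a \<otimes> d = d \<otimes> a" "b \<otimes> c = c \<otimes> b" "b \<otimes> d = d \<otimes> b"
  shows "(a \<otimes> b) \<otimes> (c \<otimes> d) = (c \<otimes> d) \<otimes> (a \<otimes> b)"
proof -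
  have "(a \<otimes> b) \<otimes> (c \<otimes> d) = a \<otimes> (b \<otimes> c) \<otimes> d" using G by (simp add: m_assoc)
  also have "\<dots> = (a \<otimes> c) \<otimes> (b \<otimes> d)" unfolding assms(7) using G by (simp add: m_assoc)
  also have "\<dots> = c \<otimes> (a \<otimes> d) \<otimes> b" unfolding assms(5,8) using G by (simp add: m_assoc)
  also have "\<dots> = (c \<otimes> d) \<otimes> (a \<otimes> b)" unfolding assms(6) using G by (simp add: m_assoc)
  finally show ?thesis .
qed

lemma (in group) commute_inv:
  assumes "a \<in> carrier G" "b \<in> carrier G" "a \<otimes> b = b \<otimes> a"
  shows "a \<otimes> inv b = inv b \<otimes> a"
proof -
  have "a \<otimes> inv b = inv b \<otimes> (b \<otimes> a) \<otimes> inv b"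
    using assms(1,2) by (simp add: m_assoc[symmetric])
  also have "\<dots> = inv b \<otimes> a"
    unfolding assms(3)[symmetric] using assms(1,2) by (simp add: m_assoc)
  finally show ?thesis .
qed

context subshift_space
begin

definition touching :: "('i \<Rightarrow> ('g \<Rightarrow> 's) \<Rightarrow> 'g \<Rightarrow> 's) \<Rightarrow> 'i set \<Rightarrow> 'g \<Rightarrow> 'i set" where
  "touching a I g = {i \<in> I. \<exists>x\<in>X. a i x g \<noteq> x g}"

definition locally_finite :: "('i \<Rightarrow> ('g \<Rightarrow> 's) \<Rightarrow> 'g \<Rightarrow> 's) \<Rightarrow> 'i set \<Rightarrow> bool" where
  "locally_finite a I \<longleftrightarrow> (\<forall>i\<in>I. a i \<in> Homeo G \<Sigma> X) \<and> commuting a I \<and>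
     (\<forall>g\<in>carrier G. finite (touching a I g))"

text \<open>The definition of the powers of a gate, for an arbitrary family in place of the translates of a gate.\<close>

definition lim_prod :: "('i \<Rightarrow> ('g \<Rightarrow> 's) \<Rightarrow> 'g \<Rightarrow> 's) \<Rightarrow> 'i set \<Rightarrow> ('g \<Rightarrow> 's) \<Rightarrow> 'g \<Rightarrow> 's" where
  "lim_prod a I = (\<lambda>x\<in>X. THE y. limitin (full_shift G \<Sigma>)
     (\<lambda>F. finprod BX a F x) y (finite_subsets_at_top I))"

lemma locally_finiteD:
  assumes "locally_finite a I"
  shows "i \<in> I \<Longrightarrow> a i \<in> Homeo G \<Sigma> X" "i \<in> I \<Longrightarrow> a i \<in> Bij X" "commuting a I"
    "g \<in> carrier G \<Longrightarrow> finite (touching a I g)"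
    "i \<in> I \<Longrightarrow> j \<in> I \<Longrightarrow> a i \<odot> a j = a j \<odot> a i"
  using assms Homeo_Bij unfolding locally_finite_def commuting_def by auto

lemma touching_subset: "touching a I g \<subseteq> I"
  by (auto simp: touching_def)

lemma locally_finite_mono:
  assumes "locally_finite a I" "J \<subseteq> I" shows "locally_finite a J"
proof -
  have "touching a J g \<subseteq> touching a I g" for g using assms(2) by (auto simp: touching_def)
  then show ?thesis
    using assms commuting_mono[OF locally_finiteD(3)[OF assms(1)] assms(2)] finite_subset
    unfolding locally_finite_def by (meson subsetD)
qed

text \<open>The factors outside \<open>touching a I g\<close> can be applied last, and they do not change the value at \<open>g\<close>.\<close>

lemma finite_prod_stable:
  assumes lf: "locally_finite a I" and F: "finite F" "touching a I g \<subseteq> F" "F \<subseteq> I" and x: "x \<in> X"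
  shows "finprod BX a F x g = finprod BX a (touching a I g) x g"
proof -
  let ?T = "touching a I g"
  have fin: "finite ?T" "finite (F - ?T)" using F finite_subset by auto
  have c: "commuting a F" "commuting a ?T" "commuting a (F - ?T)"
    using commuting_mono[OF locally_finiteD(3)[OF lf]] F touching_subset by blast+
  have eq: "F - ?T \<union> ?T = F" using F by blast
  have "finprod BX a F = finprod BX a (F - ?T) \<odot> finprod BX a ?T"
    using finite_prod_union[OF fin(2,1), of a] c eq by auto
  then have "finprod BX a F x = finprod BX a (F - ?T) (finprod BX a ?T x)"
    using finite_prod_closed[OF fin(2) c(3)] finite_prod_closed[OF fin(1) c(2)] x by (simp add: bmult_apply)
  moreover have "finprod BX a (F - ?T) (finprod BX a ?T x) g = finprod BX a ?T x g"
    by (rule finite_prod_fixes_coordinate[OF fin(2) c(3)])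
      (use F x Bij_mem[OF finite_prod_closed[OF fin(1) c(2)]] in \<open>auto simp: touching_def\<close>)
  ultimately show ?thesis by simp
qed

text \<open>At each coordinate the finite products are eventually constant, so they converge; the limit stays in the closed set \<open>X\<close>.\<close>

lemma lim_prod_limit:
  assumes lf: "locally_finite a I" and x: "x \<in> X"
  shows "lim_prod a I x \<in> X"
    and "\<And>g F. g \<in> carrier G \<Longrightarrow> finite F \<Longrightarrow> touching a I g \<subseteq> F \<Longrightarrow> F \<subseteq> I
          \<Longrightarrow> lim_prod a I x g = finprod BX a F x g"
proof -
  let ?f = "\<lambda>F. finprod BX a F x"
  let ?S = "finite_subsets_at_top I"
  define y where "y = (\<lambda>g\<in>carrier G. ?f (touching a I g) g)"
  have mem: "?f F \<in> X" if "finite F" "F \<subseteq> I" for F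
    using Bij_mem[OF finite_prod_closed] commuting_mono[OF locally_finiteD(3)[OF lf]] that x by blast
  have y: "y g = ?f F g" if "g \<in> carrier G" "finite F" "touching a I g \<subseteq> F" "F \<subseteq> I" for g F
    using finite_prod_stable[OF lf that(2,3,4) x] that(1) by (simp add: y_def)
  have evX: "eventually (\<lambda>F. ?f F \<in> X) ?S"
    unfolding eventually_finite_subsets_at_top using mem by (intro exI[of _ "{}"]) auto
  have lim: "limitin (full_shift G \<Sigma>) ?f y ?S"
    unfolding full_shift_def limitin_componentwise
  proof (intro conjI ballI)
    show "y \<in> extensional (carrier G)" by (simp add: y_def)
    show "eventually (\<lambda>F. ?f F \<in> topspace (product_topology (\<lambda>_. discrete_topology \<Sigma>) (carrier G))) ?S"
      by (rule eventually_mono[OF evX]) (use X_config in auto)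
    fix g assume g: "g \<in> carrier G"
    have fin: "finite (touching a I g)" using locally_finiteD(4)[OF lf g] .
    have "?f (touching a I g) g \<in> \<Sigma>" using X_config[OF mem[OF fin touching_subset]] g by auto
    moreover have "y g = ?f (touching a I g) g" by (rule y[OF g fin order_refl touching_subset])
    moreover have "eventually (\<lambda>F. ?f F g = y g) ?S"
      unfolding eventually_finite_subsets_at_top
    proof (intro exI[of _ "touching a I g"] conjI allI impI)
      fix Y assume "finite Y \<and> touching a I g \<subseteq> Y \<and> Y \<subseteq> I"
      then show "?f Y g = y g" using y[OF g, of Y] by simp
    qed (use fin touching_subset[of a I g] in simp_all)
    ultimately show "limitin (discrete_topology \<Sigma>) (\<lambda>F. ?f F g) (y g) ?S"
      by (intro limitin_eventually) auto
  qed
  have haus: "Hausdorff_space (full_shift G \<Sigma>)"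
    by (simp add: full_shift_def Hausdorff_space_product_topology)
  have "(THE y. limitin (full_shift G \<Sigma>) ?f y ?S) = y"
  proof (rule the_equality)
    show "limitin (full_shift G \<Sigma>) ?f y ?S" by (rule lim)
    fix z assume z: "limitin (full_shift G \<Sigma>) ?f z ?S"
    show "z = y" by (rule limitin_Hausdorff_unique[OF z lim _ haus]) simp
  qed
  then have eq: "lim_prod a I x = y" using x by (simp add: lim_prod_def)
  show "lim_prod a I x \<in> X"
    unfolding eq by (rule limitin_closedin[OF lim X_closed evX]) simp
  show "lim_prod a I x g = ?f F g" if "g \<in> carrier G" "finite F" "touching a I g \<subseteq> F" "F \<subseteq> I" for g F
    unfolding eq by (rule y[OF that])
qed

lemmas lim_prod_mem = lim_prod_limit(1)
lemmas lim_prod_apply = lim_prod_limit(2)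

lemma lim_prod_agree:
  assumes lf: "locally_finite a I" and x: "x \<in> X" and E: "finite E" "E \<subseteq> carrier G"
  obtains F0 where "finite F0" "F0 \<subseteq> I"
    "\<And>F. finite F \<Longrightarrow> F0 \<subseteq> F \<Longrightarrow> F \<subseteq> I \<Longrightarrow> agree E (lim_prod a I x) (finprod BX a F x)"
proof -
  let ?F = "\<Union> (touching a I ` E)"
  show thesis
  proof (rule that[of ?F])
    show "finite ?F" using E locally_finiteD(4)[OF lf] by auto
    show "?F \<subseteq> I" using touching_subset[of a I] by (rule UN_least)
    fix F assume F: "finite F" "?F \<subseteq> F" "F \<subseteq> I"
    have "lim_prod a I x g = finprod BX a F x g" if g: "g \<in> E" for g
    proof (rule lim_prod_apply[OF lf x])
      show "g \<in> carrier G" using g E by blast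
      show "touching a I g \<subseteq> F" using g F(2) by auto
    qed (use F in simp_all)
    then show "agree E (lim_prod a I x) (finprod BX a F x)" by (simp add: agree_def)
  qed
qed

lemma finite_prod_mem: "locally_finite a I \<Longrightarrow> finite F \<Longrightarrow> F \<subseteq> I \<Longrightarrow> finprod BX a F \<in> Bij X"
  by (rule finite_prod_closed[OF _ commuting_mono[OF locally_finiteD(3)]])

lemma finite_prod_local:
  assumes "locally_finite a I" "finite F" "F \<subseteq> I" shows "local_map (finprod BX a F)"
proof -
  have "finprod BX a F \<in> Homeo G \<Sigma> X"
    by (rule finite_prod_Homeo[OF assms(2) commuting_mono[OF locally_finiteD(3)[OF assms(1)] assms(3)]])
      (rule locally_finiteD(1)[OF assms(1) subsetD[OF assms(3)]])
  then show ?thesis using Homeo_iff by simp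
qed

text \<open>The value at \<open>g\<close> of a composition of two infinite products is reached by finite products: finitely many factors of the outer product act on \<open>g\<close>, and together they read finitely many coordinates, on which the inner product is reached by a finite product.\<close>

lemma lim_prod_comp:
  assumes a: "locally_finite a I" and b: "locally_finite b J" and x: "x \<in> X" and g: "g \<in> carrier G"
  obtains F1 F2 where "finite F1" "F1 \<subseteq> I" "finite F2" "F2 \<subseteq> J"
    "\<And>E1 E2. finite E1 \<Longrightarrow> F1 \<subseteq> E1 \<Longrightarrow> E1 \<subseteq> I \<Longrightarrow> finite E2 \<Longrightarrow> F2 \<subseteq> E2 \<Longrightarrow> E2 \<subseteq> J \<Longrightarrow>
       lim_prod a I (lim_prod b J x) g = finprod BX a E1 (finprod BX b E2 x) g"
proof -
  let ?T = "touching a I g"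
  have T: "finite ?T" "?T \<subseteq> I" using locally_finiteD(4)[OF a g] touching_subset[of a I g] by auto
  obtain D where D: "finite D" "D \<subseteq> carrier G"
    "\<And>x y. x \<in> X \<Longrightarrow> y \<in> X \<Longrightarrow> agree D x y \<Longrightarrow> finprod BX a ?T x g = finprod BX a ?T y g"
    using finite_prod_local[OF a T] g unfolding local_map_def by metis
  obtain F2 where F2: "finite F2" "F2 \<subseteq> J"
    "\<And>F. finite F \<Longrightarrow> F2 \<subseteq> F \<Longrightarrow> F \<subseteq> J \<Longrightarrow> agree D (lim_prod b J x) (finprod BX b F x)"
    using lim_prod_agree[OF b x D(1,2)] by metis
  show thesis
  proof (rule that[OF T F2(1,2)])
    fix E1 E2 assume E: "finite E1" "?T \<subseteq> E1" "E1 \<subseteq> I" "finite E2" "F2 \<subseteq> E2" "E2 \<subseteq> J"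
    have m: "lim_prod b J x \<in> X" "finprod BX b E2 x \<in> X"
      using lim_prod_mem[OF b x] Bij_mem[OF finite_prod_mem[OF b E(4,6)] x] by auto
    have "lim_prod a I (lim_prod b J x) g = finprod BX a ?T (lim_prod b J x) g"
      by (rule lim_prod_apply[OF a m(1) g T(1) order_refl T(2)])
    also have "\<dots> = finprod BX a ?T (finprod BX b E2 x) g"
      by (rule D(3)[OF m F2(3)[OF E(4-6)]])
    also have "\<dots> = finprod BX a E1 (finprod BX b E2 x) g"
      by (rule finite_prod_stable[OF a E(1-3) m(2), symmetric])
    finally show "lim_prod a I (lim_prod b J x) g = finprod BX a E1 (finprod BX b E2 x) g" .
  qed
qed

lemma locally_finite_mult:
  assumes a: "locally_finite a I" and b: "locally_finite b I"
    and cross: "\<And>i j. i \<in> I \<Longrightarrow> j \<in> I \<Longrightarrow> i \<noteq> j \<Longrightarrow> a i \<odot> b j = b j \<odot> a i"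
  shows "locally_finite (\<lambda>i. a i \<odot> b i) I"
  unfolding locally_finite_def commuting_def
proof (intro conjI ballI)
  fix i assume i: "i \<in> I"
  show "a i \<odot> b i \<in> Homeo G \<Sigma> X" using locally_finiteD(1)[OF a i] locally_finiteD(1)[OF b i] by (rule Homeo_mult)
  then show "a i \<odot> b i \<in> Bij X" by (rule Homeo_Bij)
  fix j assume j: "j \<in> I"
  show "(a i \<odot> b i) \<odot> (a j \<odot> b j) = (a j \<odot> b j) \<odot> (a i \<odot> b i)"
  proof (cases "i = j")
    case False
    show ?thesis
      by (rule BX.commute_products)
        (use locally_finiteD(2)[OF a] locally_finiteD(2)[OF b] i j in simp_all,
         rule locally_finiteD(5)[OF a i j], rule cross[OF i j False],
         rule cross[OF j i False[symmetric], symmetric], rule locally_finiteD(5)[OF b i j])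
  qed simp
next
  fix g assume g: "g \<in> carrier G"
  have "touching (\<lambda>i. a i \<odot> b i) I g \<subseteq> touching a I g \<union> touching b I g"
  proof
    fix i assume "i \<in> touching (\<lambda>i. a i \<odot> b i) I g"
    then obtain x where i: "i \<in> I" and x: "x \<in> X" "(a i \<odot> b i) x g \<noteq> x g" by (auto simp: touching_def)
    have bij: "a i \<in> Bij X" "b i \<in> Bij X" using locally_finiteD(2)[OF a i] locally_finiteD(2)[OF b i] .
    have "a i (b i x) g \<noteq> b i x g \<or> b i x g \<noteq> x g" using x bij by (auto simp: bmult_apply)
    then show "i \<in> touching a I g \<union> touching b I g"
      using i x(1) Bij_mem[OF bij(2) x(1)] by (auto simp: touching_def)
  qed
  then show "finite (touching (\<lambda>i. a i \<odot> b i) I g)"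
    using locally_finiteD(4)[OF a g] locally_finiteD(4)[OF b g] finite_subset by blast
qed

lemma lim_prod_mult_apply:
  assumes a: "locally_finite a I" and b: "locally_finite b I"
    and cross: "\<And>i j. i \<in> I \<Longrightarrow> j \<in> I \<Longrightarrow> i \<noteq> j \<Longrightarrow> a i \<odot> b j = b j \<odot> a i"
    and x: "x \<in> X"
  shows "lim_prod (\<lambda>i. a i \<odot> b i) I x = lim_prod a I (lim_prod b I x)"
proof (rule X_eqI)
  let ?c = "\<lambda>i. a i \<odot> b i"
  have c: "locally_finite ?c I" by (rule locally_finite_mult[OF a b cross])
  show "lim_prod ?c I x \<in> X" "lim_prod a I (lim_prod b I x) \<in> X"
    using lim_prod_mem[OF c x] lim_prod_mem[OF a lim_prod_mem[OF b x]] .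
  fix g assume g: "g \<in> carrier G"
  obtain F1 F2 where F: "finite F1" "F1 \<subseteq> I" "finite F2" "F2 \<subseteq> I"
    "\<And>E1 E2. finite E1 \<Longrightarrow> F1 \<subseteq> E1 \<Longrightarrow> E1 \<subseteq> I \<Longrightarrow> finite E2 \<Longrightarrow> F2 \<subseteq> E2 \<Longrightarrow> E2 \<subseteq> I \<Longrightarrow>
       lim_prod a I (lim_prod b I x) g = finprod BX a E1 (finprod BX b E2 x) g"
    using lim_prod_comp[OF a b x g] by metis
  define E where "E = F1 \<union> F2 \<union> touching ?c I g"
  have E: "finite E" "F1 \<subseteq> E" "F2 \<subseteq> E" "touching ?c I g \<subseteq> E" "E \<subseteq> I"
    using F locally_finiteD(4)[OF c g] touching_subset[of ?c I g] by (auto simp: E_def)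
  have cE: "commuting a E" "commuting b E" "commuting ?c E"
    using commuting_mono[OF locally_finiteD(3)] a b c E(5) by blast+
  have "finprod BX ?c E = finprod BX a E \<odot> finprod BX b E"
    by (rule finite_prod_mult[OF E(1) cE(1,2) cross cE(3)]) (use E(5) in auto)
  then have "lim_prod ?c I x g = (finprod BX a E \<odot> finprod BX b E) x g"
    using lim_prod_apply[OF c x g E(1,4,5)] by simp
  also have "\<dots> = finprod BX a E (finprod BX b E x) g"
    using finite_prod_mem[OF a E(1,5)] finite_prod_mem[OF b E(1,5)] x by (simp add: bmult_apply)
  also have "\<dots> = lim_prod a I (lim_prod b I x) g"
    by (rule F(5)[OF E(1,2,5,1,3,5), symmetric])
  finally show "lim_prod ?c I x g = lim_prod a I (lim_prod b I x) g" .
qed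

lemma locally_finite_inv:
  assumes a: "locally_finite a I" shows "locally_finite (\<lambda>i. binv (a i)) I"
  unfolding locally_finite_def commuting_def
proof (intro conjI ballI)
  fix i assume i: "i \<in> I"
  show "binv (a i) \<in> Homeo G \<Sigma> X" by (rule Homeo_inv[OF locally_finiteD(1)[OF a i]])
  then show "binv (a i) \<in> Bij X" by (rule Homeo_Bij)
  fix j assume j: "j \<in> I"
  note ij = locally_finiteD(2)[OF a i] locally_finiteD(2)[OF a j]
  show "binv (a i) \<odot> binv (a j) = binv (a j) \<odot> binv (a i)"
    using locally_finiteD(5)[OF a i j] BX.inv_mult_group[OF ij] BX.inv_mult_group[OF ij(2,1)] by simp
next
  fix g assume g: "g \<in> carrier G"
  have "touching (\<lambda>i. binv (a i)) I g \<subseteq> touching a I g"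
  proof
    fix i assume "i \<in> touching (\<lambda>i. binv (a i)) I g"
    then obtain x where i: "i \<in> I" and x: "x \<in> X" "binv (a i) x g \<noteq> x g" by (auto simp: touching_def)
    note bij = locally_finiteD(2)[OF a i]
    have "a i (binv (a i) x) g \<noteq> binv (a i) x g" using x bij by (simp add: binv_apply)
    then show "i \<in> touching a I g"
      using i Bij_mem[OF BX.inv_closed[OF bij] x(1)] by (auto simp: touching_def)
  qed
  then show "finite (touching (\<lambda>i. binv (a i)) I g)"
    using locally_finiteD(4)[OF a g] finite_subset by blast
qed

lemma lim_prod_trivial:
  assumes "\<And>i. i \<in> I \<Longrightarrow> a i = bone" "x \<in> X"
  shows "lim_prod a I x = x"
proof (rule X_eqI)
  have t: "touching a I g = {}" for g using assms(1) by (auto simp: touching_def bone_apply)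
  have lf: "locally_finite a I"
    unfolding locally_finite_def commuting_def using assms(1) Homeo_one t by simp
  show "lim_prod a I x \<in> X" by (rule lim_prod_mem[OF lf assms(2)])
  show "x \<in> X" by fact
  fix g assume g: "g \<in> carrier G"
  show "lim_prod a I x g = x g"
    using lim_prod_apply[OF lf assms(2) g, of "{}"] t assms(2) by (simp add: finite_prod_empty bone_apply)
qed

lemma lim_prod_inverse_apply:
  assumes a: "locally_finite a I" and x: "x \<in> X"
  shows "lim_prod a I (lim_prod (\<lambda>i. binv (a i)) I x) = x"
    "lim_prod (\<lambda>i. binv (a i)) I (lim_prod a I x) = x"
proof -
  note b = locally_finite_inv[OF a]
  have cross: "a i \<odot> binv (a j) = binv (a j) \<odot> a i" if "i \<in> I" "j \<in> I" for i j
    by (rule BX.commute_inv) (use locally_finiteD(2)[OF a] locally_finiteD(5)[OF a] that in blast)+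
  have "lim_prod a I (lim_prod (\<lambda>i. binv (a i)) I x) = lim_prod (\<lambda>i. a i \<odot> binv (a i)) I x"
    by (rule lim_prod_mult_apply[OF a b cross x, symmetric])
  also have "\<dots> = x" by (rule lim_prod_trivial[OF _ x]) (use locally_finiteD(2)[OF a] in simp)
  finally show "lim_prod a I (lim_prod (\<lambda>i. binv (a i)) I x) = x" .
  have "lim_prod (\<lambda>i. binv (a i)) I (lim_prod a I x) = lim_prod (\<lambda>i. binv (a i) \<odot> a i) I x"
    by (rule lim_prod_mult_apply[OF b a cross[symmetric] x, symmetric])
  also have "\<dots> = x" by (rule lim_prod_trivial[OF _ x]) (use locally_finiteD(2)[OF a] in simp)
  finally show "lim_prod (\<lambda>i. binv (a i)) I (lim_prod a I x) = x" .
qed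

text \<open>The infinite product of the inverses is inverse to the infinite product.\<close>

lemma lim_prod_Bij:
  assumes a: "locally_finite a I" shows "lim_prod a I \<in> Bij X"
proof -
  have "bij_betw (lim_prod a I) X X"
    by (rule bij_betw_byWitness[where f' = "lim_prod (\<lambda>i. binv (a i)) I"])
      (use lim_prod_inverse_apply[OF a] lim_prod_mem[OF a] lim_prod_mem[OF locally_finite_inv[OF a]] in auto)
  moreover have "lim_prod a I \<in> extensional X" by (simp add: lim_prod_def)
  ultimately show ?thesis by (simp add: Bij_def)
qed

lemma lim_prod_Homeo:
  assumes a: "locally_finite a I" shows "lim_prod a I \<in> Homeo G \<Sigma> X"
proof -
  have "local_map (lim_prod a I)"
    unfolding local_map_def
  proof
    fix g assume g: "g \<in> carrier G"
    let ?T = "touching a I g"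
    have T: "finite ?T" "?T \<subseteq> I" using locally_finiteD(4)[OF a g] touching_subset[of a I g] by auto
    have eq: "lim_prod a I x g = finprod BX a ?T x g" if "x \<in> X" for x
      by (rule lim_prod_apply[OF a that g T(1) order_refl T(2)])
    show "\<exists>D. finite D \<and> D \<subseteq> carrier G \<and>
      (\<forall>x\<in>X. \<forall>y\<in>X. agree D x y \<longrightarrow> lim_prod a I x g = lim_prod a I y g)"
      using finite_prod_local[OF a T] g eq unfolding local_map_def by simp
  qed
  then show ?thesis using lim_prod_Bij[OF a] Homeo_iff by blast
qed

lemma lim_prod_mult:
  assumes a: "locally_finite a I" and b: "locally_finite b I"
    and cross: "\<And>i j. i \<in> I \<Longrightarrow> j \<in> I \<Longrightarrow> i \<noteq> j \<Longrightarrow> a i \<odot> b j = b j \<odot> a i"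
  shows "lim_prod (\<lambda>i. a i \<odot> b i) I = lim_prod a I \<odot> lim_prod b I"
  by (rule Bij_eqI) (use lim_prod_Bij[OF locally_finite_mult[OF a b cross]] lim_prod_Bij[OF a] lim_prod_Bij[OF b]
      lim_prod_mult_apply[OF a b cross] in \<open>simp_all add: bmult_apply\<close>)

lemma lim_prod_inv:
  assumes a: "locally_finite a I"
  shows "lim_prod (\<lambda>i. binv (a i)) I = binv (lim_prod a I)"
proof -
  note bij = lim_prod_Bij[OF locally_finite_inv[OF a]] lim_prod_Bij[OF a]
  have "lim_prod (\<lambda>i. binv (a i)) I \<odot> lim_prod a I = bone"
    by (rule Bij_eqI) (use bij lim_prod_inverse_apply[OF a] in \<open>simp_all add: bmult_apply bone_apply\<close>)
  then show ?thesis using BX.inv_equality bij by metis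
qed

lemma lim_prod_union:
  assumes a: "locally_finite a (I \<union> J)" and disj: "I \<inter> J = {}"
  shows "lim_prod a (I \<union> J) = lim_prod a I \<odot> lim_prod a J"
proof (rule Bij_eqI)
  have ab: "locally_finite a I" "locally_finite a J" using locally_finite_mono[OF a] by blast+
  note bij = lim_prod_Bij[OF ab(1)] lim_prod_Bij[OF ab(2)]
  show "lim_prod a (I \<union> J) \<in> Bij X" by (rule lim_prod_Bij[OF a])
  show "lim_prod a I \<odot> lim_prod a J \<in> Bij X" using bij by simp
  fix x assume x: "x \<in> X"
  show "lim_prod a (I \<union> J) x = (lim_prod a I \<odot> lim_prod a J) x"
  proof (rule X_eqI)
    show "lim_prod a (I \<union> J) x \<in> X" by (rule lim_prod_mem[OF a x])
    show "(lim_prod a I \<odot> lim_prod a J) x \<in> X" using bij x by (simp add: Bij_mem)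
    fix g assume g: "g \<in> carrier G"
    obtain F1 F2 where F: "finite F1" "F1 \<subseteq> I" "finite F2" "F2 \<subseteq> J"
      "\<And>E1 E2. finite E1 \<Longrightarrow> F1 \<subseteq> E1 \<Longrightarrow> E1 \<subseteq> I \<Longrightarrow> finite E2 \<Longrightarrow> F2 \<subseteq> E2 \<Longrightarrow> E2 \<subseteq> J \<Longrightarrow>
         lim_prod a I (lim_prod a J x) g = finprod BX a E1 (finprod BX a E2 x) g"
      using lim_prod_comp[OF ab x g] by metis
    let ?T = "touching a (I \<union> J) g"
    define E1 E2 where "E1 = F1 \<union> (?T \<inter> I)" and "E2 = F2 \<union> (?T \<inter> J)"
    have E: "finite E1" "F1 \<subseteq> E1" "E1 \<subseteq> I" "finite E2" "F2 \<subseteq> E2" "E2 \<subseteq> J"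
      using F locally_finiteD(4)[OF a g] by (auto simp: E1_def E2_def)
    have T: "finite (E1 \<union> E2)" "?T \<subseteq> E1 \<union> E2" "E1 \<union> E2 \<subseteq> I \<union> J"
      using E touching_subset[of a "I \<union> J" g] by (auto simp: E1_def E2_def)
    have "lim_prod a (I \<union> J) x g = finprod BX a (E1 \<union> E2) x g"
      by (rule lim_prod_apply[OF a x g T])
    also have "finprod BX a (E1 \<union> E2) = finprod BX a E1 \<odot> finprod BX a E2"
      by (rule finite_prod_union[OF E(1,4)]) (use E disj commuting_mono[OF locally_finiteD(3)[OF a] T(3)] in auto)
    also have "(finprod BX a E1 \<odot> finprod BX a E2) x g = finprod BX a E1 (finprod BX a E2 x) g"
      using finite_prod_mem[OF ab(1) E(1,3)] finite_prod_mem[OF ab(2) E(4,6)] x by (simp add: bmult_apply)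
    also have "\<dots> = lim_prod a I (lim_prod a J x) g" by (rule F(5)[OF E, symmetric])
    finally show "lim_prod a (I \<union> J) x g = (lim_prod a I \<odot> lim_prod a J) x g"
      using bij x by (simp add: bmult_apply)
  qed
qed

lemma lim_prod_commute:
  assumes a: "locally_finite a I" and b: "locally_finite b J"
    and cross: "\<And>i j. i \<in> I \<Longrightarrow> j \<in> J \<Longrightarrow> a i \<odot> b j = b j \<odot> a i"
  shows "lim_prod a I \<odot> lim_prod b J = lim_prod b J \<odot> lim_prod a I"
proof (rule Bij_eqI)
  note bij = lim_prod_Bij[OF a] lim_prod_Bij[OF b]
  show "lim_prod a I \<odot> lim_prod b J \<in> Bij X" "lim_prod b J \<odot> lim_prod a I \<in> Bij X" using bij by simp_all
  fix x assume x: "x \<in> X"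
  have "lim_prod a I (lim_prod b J x) = lim_prod b J (lim_prod a I x)"
  proof (rule X_eqI)
    show "lim_prod a I (lim_prod b J x) \<in> X" "lim_prod b J (lim_prod a I x) \<in> X"
      using lim_prod_mem[OF a lim_prod_mem[OF b x]] lim_prod_mem[OF b lim_prod_mem[OF a x]] .
    fix g assume g: "g \<in> carrier G"
    obtain F1 F2 where F: "finite F1" "F1 \<subseteq> I" "finite F2" "F2 \<subseteq> J"
      "\<And>E1 E2. finite E1 \<Longrightarrow> F1 \<subseteq> E1 \<Longrightarrow> E1 \<subseteq> I \<Longrightarrow> finite E2 \<Longrightarrow> F2 \<subseteq> E2 \<Longrightarrow> E2 \<subseteq> J \<Longrightarrow>
         lim_prod a I (lim_prod b J x) g = finprod BX a E1 (finprod BX b E2 x) g"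
      using lim_prod_comp[OF a b x g] by metis
    obtain F3 F4 where F': "finite F3" "F3 \<subseteq> J" "finite F4" "F4 \<subseteq> I"
      "\<And>E1 E2. finite E1 \<Longrightarrow> F3 \<subseteq> E1 \<Longrightarrow> E1 \<subseteq> J \<Longrightarrow> finite E2 \<Longrightarrow> F4 \<subseteq> E2 \<Longrightarrow> E2 \<subseteq> I \<Longrightarrow>
         lim_prod b J (lim_prod a I x) g = finprod BX b E1 (finprod BX a E2 x) g"
      using lim_prod_comp[OF b a x g] by metis
    define E1 E2 where "E1 = F1 \<union> F4" and "E2 = F2 \<union> F3"
    have E: "finite E1" "finite E2" "E1 \<subseteq> I" "E2 \<subseteq> J" "F1 \<subseteq> E1" "F4 \<subseteq> E1" "F2 \<subseteq> E2" "F3 \<subseteq> E2"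
      using F F' by (auto simp: E1_def E2_def)
    note c = commuting_mono[OF locally_finiteD(3)[OF a] E(3)] commuting_mono[OF locally_finiteD(3)[OF b] E(4)]
    note m = finite_prod_mem[OF a E(1,3)] finite_prod_mem[OF b E(2,4)]
    have ai: "a i \<odot> finprod BX b E2 = finprod BX b E2 \<odot> a i" if i: "i \<in> E1" for i
    proof -
      have iI: "i \<in> I" using i E(3) by blast
      show ?thesis
        by (rule finite_prod_commute[OF E(2) c(2) locally_finiteD(2)[OF a iI]]) (rule cross[OF iI], use E(4) in blast)
    qed
    have eq: "finprod BX b E2 \<odot> finprod BX a E1 = finprod BX a E1 \<odot> finprod BX b E2"
      by (rule finite_prod_commute[OF E(1) c(1) m(2)]) (rule ai[symmetric])
    have "finprod BX a E1 (finprod BX b E2 x) = finprod BX b E2 (finprod BX a E1 x)"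
      using fun_cong[OF eq, of x] m x by (simp add: bmult_apply)
    then show "lim_prod a I (lim_prod b J x) g = lim_prod b J (lim_prod a I x) g"
      using F(5)[OF E(1,5,3,2,7,4)] F'(5)[OF E(2,8,4,1,6,3)] by simp
  qed
  then show "(lim_prod a I \<odot> lim_prod b J) x = (lim_prod b J \<odot> lim_prod a I) x"
    using bij x by (simp add: bmult_apply)
qed

lemma lim_prod_conj:
  assumes a: "locally_finite a I" and f: "f \<in> Homeo G \<Sigma> X"
    and b: "locally_finite (\<lambda>i. f \<odot> a i \<odot> binv f) I"
  shows "f \<odot> lim_prod a I \<odot> binv f = lim_prod (\<lambda>i. f \<odot> a i \<odot> binv f) I"
proof (rule Bij_eqI)
  let ?b = "\<lambda>i. f \<odot> a i \<odot> binv f"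
  have fB: "f \<in> Bij X" "local_map f" using f Homeo_iff by auto
  note bij = lim_prod_Bij[OF a] lim_prod_Bij[OF b]
  show "f \<odot> lim_prod a I \<odot> binv f \<in> Bij X" using bij fB by simp
  show "lim_prod ?b I \<in> Bij X" by (rule bij(2))
  fix x assume x: "x \<in> X"
  define y where "y = binv f x"
  have y: "y \<in> X" "f y = x" using fB x by (simp_all add: y_def Bij_mem binv_apply)
  have "f (lim_prod a I y) = lim_prod ?b I x"
  proof (rule X_eqI)
    show "f (lim_prod a I y) \<in> X" using fB lim_prod_mem[OF a y(1)] by (simp add: Bij_mem)
    show "lim_prod ?b I x \<in> X" by (rule lim_prod_mem[OF b x])
    fix g assume g: "g \<in> carrier G"
    obtain D where D: "finite D" "D \<subseteq> carrier G" "\<And>x y. x \<in> X \<Longrightarrow> y \<in> X \<Longrightarrow> agree D x y \<Longrightarrow> f x g = f y g"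
      using fB(2) g unfolding local_map_def by metis
    obtain F0 where F0: "finite F0" "F0 \<subseteq> I"
      "\<And>F. finite F \<Longrightarrow> F0 \<subseteq> F \<Longrightarrow> F \<subseteq> I \<Longrightarrow> agree D (lim_prod a I y) (finprod BX a F y)"
      using lim_prod_agree[OF a y(1) D(1,2)] by metis
    define E where "E = F0 \<union> touching ?b I g"
    have E: "finite E" "F0 \<subseteq> E" "E \<subseteq> I" "touching ?b I g \<subseteq> E"
      using F0 locally_finiteD(4)[OF b g] touching_subset[of ?b I g] by (auto simp: E_def)
    have c: "commuting a E" by (rule commuting_mono[OF locally_finiteD(3)[OF a] E(3)])
    note m = finite_prod_mem[OF a E(1,3)]
    have "f (lim_prod a I y) g = f (finprod BX a E y) g"
      by (rule D(3)[OF lim_prod_mem[OF a y(1)] Bij_mem[OF m y(1)] F0(3)[OF E(1-3)]])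
    also have "f (finprod BX a E y) = (f \<odot> finprod BX a E \<odot> binv f) x"
      using fB m x by (simp add: bmult_apply y_def Bij_mem)
    also have "(f \<odot> finprod BX a E \<odot> binv f) x = finprod BX ?b E x"
      using finite_prod_conj[OF E(1) c fB(1)] by simp
    also have "finprod BX ?b E x g = lim_prod ?b I x g"
      by (rule lim_prod_apply[OF b x g E(1,4,3), symmetric])
    finally show "f (lim_prod a I y) g = lim_prod ?b I x g" .
  qed
  then show "(f \<odot> lim_prod a I \<odot> binv f) x = lim_prod ?b I x"
    using fB bij x by (simp add: bmult_apply y_def Bij_mem)
qed

lemma lim_prod_reindex:
  assumes a: "locally_finite a (\<theta> ` I)" and inj: "inj_on \<theta> I"
  shows "locally_finite (\<lambda>i. a (\<theta> i)) I" "lim_prod a (\<theta> ` I) = lim_prod (\<lambda>i. a (\<theta> i)) I"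
proof -
  let ?b = "\<lambda>i. a (\<theta> i)"
  have t: "\<theta> ` touching ?b I g = touching a (\<theta> ` I) g" for g by (auto simp: touching_def)
  have ti: "inj_on \<theta> (touching ?b I g)" for g using inj touching_subset by (rule inj_on_subset)
  have "finite (touching ?b I g)" if "g \<in> carrier G" for g
    using finite_imageD[OF _ ti[of g]] locally_finiteD(4)[OF a that] unfolding t by blast
  then show b: "locally_finite ?b I"
    using a unfolding locally_finite_def commuting_def by blast
  show "lim_prod a (\<theta> ` I) = lim_prod ?b I"
  proof (rule Bij_eqI)
    fix x assume x: "x \<in> X"
    show "lim_prod a (\<theta> ` I) x = lim_prod ?b I x"
    proof (rule X_eqI)
      fix g assume g: "g \<in> carrier G"
      let ?T = "touching ?b I g"
      have T: "finite ?T" "?T \<subseteq> I" using locally_finiteD(4)[OF b g] touching_subset[of ?b I g] by auto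
      have "lim_prod a (\<theta> ` I) x g = finprod BX a (\<theta> ` ?T) x g"
        by (rule lim_prod_apply[OF a x g finite_imageI[OF T(1)] _ image_mono[OF T(2)]]) (simp add: t)
      also have "finprod BX a (\<theta> ` ?T) = finprod BX ?b ?T"
        by (rule finite_prod_reindex[OF T(1) ti]) (rule commuting_mono[OF locally_finiteD(3)[OF a] image_mono[OF T(2)]])
      also have "finprod BX ?b ?T x g = lim_prod ?b I x g"
        by (rule lim_prod_apply[OF b x g T(1) order_refl T(2), symmetric])
      finally show "lim_prod a (\<theta> ` I) x g = lim_prod ?b I x g" .
    qed (use lim_prod_mem[OF a x] lim_prod_mem[OF b x] in simp_all)
  qed (use lim_prod_Bij[OF a] lim_prod_Bij[OF b] in simp_all)
qed

end

section \<open>Parity of bijections of finite sets\<close>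

text \<open>Parity is invariant under conjugation by a bijection, here also between different sets.\<close>

lemma restrict_id_transport:
  assumes "inj_on h A" "bij_betw f A A" "\<And>x. x \<in> A \<Longrightarrow> g (h x) = h (f x)"
  shows "bij_betw g (h ` A) (h ` A)"
    and "finite A \<Longrightarrow> evenperm (restrict_id g (h ` A)) \<longleftrightarrow> evenperm (restrict_id f A)"
proof -
  have f: "f ` A = A" "inj_on f A" using assms(2) by (auto simp: bij_betw_def)
  have fA: "f x \<in> A" if "x \<in> A" for x using f(1) that by blast
  have "inj_on g (h ` A)"
  proof (rule inj_onI)
    fix u v assume "u \<in> h ` A" "v \<in> h ` A" and eq: "g u = g v"
    then obtain x y where xy: "x \<in> A" "y \<in> A" "u = h x" "v = h y" by blast
    have "h (f x) = h (f y)" using eq assms(3) xy by simp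
    then have "f x = f y" by (rule inj_onD[OF assms(1) _ fA[OF xy(1)] fA[OF xy(2)]])
    then have "x = y" by (rule inj_onD[OF f(2) _ xy(1,2)])
    then show "u = v" using xy by simp
  qed
  moreover have "g ` h ` A = h ` A"
  proof -
    have "g ` h ` A = h ` f ` A" using assms(3) by (force simp: image_image)
    then show ?thesis using f(1) by simp
  qed
  ultimately show "bij_betw g (h ` A) (h ` A)" by (simp add: bij_betw_def)
  assume fin: "finite A"
  have "restrict_id g (h ` A) = map_permutation A h (restrict_id f A)"
    using assms(3) inv_into_f_f[OF assms(1)] by (auto simp: fun_eq_iff restrict_id_def map_permutation_def)
  then show "evenperm (restrict_id g (h ` A)) \<longleftrightarrow> evenperm (restrict_id f A)"
    using evenperm_map_permutation[OF assms(1) permutes_restrict_id[OF assms(2)] fin] by simp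
qed

lemma permutation_restrict_id: "finite S \<Longrightarrow> bij_betw f S S \<Longrightarrow> permutation (restrict_id f S)"
  using permutes_imp_permutation permutes_restrict_id by blast

text \<open>The restriction to \<open>S\<close> is the product of its restrictions to the level sets of an invariant function.\<close>

lemma evenperm_restrict_id_partition:
  assumes fin: "finite S" and f: "bij_betw f S S" and \<kappa>: "\<And>z. z \<in> S \<Longrightarrow> \<kappa> (f z) = \<kappa> z"
    and ev: "\<And>z. z \<in> S \<Longrightarrow> evenperm (restrict_id f {w \<in> S. \<kappa> w = \<kappa> z})"
  shows "evenperm (restrict_id f S)"
proof -
  have fS: "f z \<in> S" if "z \<in> S" for z using f that by (auto simp: bij_betw_def)
  have inj: "inj_on f S" using f by (simp add: bij_betw_def)
  have bij: "bij_betw f {w \<in> S. \<kappa> w \<in> T} {w \<in> S. \<kappa> w \<in> T}" for T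
  proof -
    have "f ` {w \<in> S. \<kappa> w \<in> T} \<subseteq> {w \<in> S. \<kappa> w \<in> T}" using fS \<kappa> by auto
    moreover have "inj_on f {w \<in> S. \<kappa> w \<in> T}" using inj by (rule inj_on_subset) auto
    ultimately show ?thesis using fin endo_inj_surj[of "{w \<in> S. \<kappa> w \<in> T}" f] by (simp add: bij_betw_def)
  qed
  have "evenperm (restrict_id f {w \<in> S. \<kappa> w \<in> T})" if "finite T" "T \<subseteq> \<kappa> ` S" for T
    using that
  proof (induction rule: finite_induct)
    case empty
    have "restrict_id f {w \<in> S. \<kappa> w \<in> {}} = id" by (auto simp: restrict_id_def)
    then show ?case by simp
  next
    case (insert k T)
    then obtain z where z: "z \<in> S" "k = \<kappa> z" by auto
    let ?A = "{w \<in> S. \<kappa> w \<in> {k}}" and ?B = "{w \<in> S. \<kappa> w \<in> T}"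
    have "restrict_id f {w \<in> S. \<kappa> w \<in> insert k T} = restrict_id f ?A \<circ> restrict_id f ?B"
      using insert.hyps(2) \<kappa> fS by (auto simp: restrict_id_def fun_eq_iff)
    moreover have "evenperm (restrict_id f ?A)" using ev[OF z(1)] z(2) by simp
    moreover have "evenperm (restrict_id f ?B)" using insert by simp
    moreover have p: "permutation (restrict_id f ?A)" "permutation (restrict_id f ?B)"
      by (rule permutation_restrict_id[OF _ bij], use fin in simp)+
    ultimately show ?case using evenperm_comp[OF p] by (simp only:)
  qed
  from this[of "\<kappa> ` S"] fin have "evenperm (restrict_id f {w \<in> S. \<kappa> w \<in> \<kappa> ` S})" by simp
  moreover have "{w \<in> S. \<kappa> w \<in> \<kappa> ` S} = S" by auto
  ultimately show ?thesis by simp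
qed

section \<open>Gates\<close>

context subshift_space
begin

definition shift_map :: "'g \<Rightarrow> ('g \<Rightarrow> 's) \<Rightarrow> 'g \<Rightarrow> 's" where
  "shift_map g = (\<lambda>x\<in>X. shift G g x)"

abbreviation cg where "cg \<phi> g \<equiv> conj_gate G X \<phi> g"

lemma shift_apply: "h \<in> carrier G \<Longrightarrow> shift G g x h = x (h \<otimes> g)"
  by (simp add: shift_def)

lemma shift_mem: "g \<in> carrier G \<Longrightarrow> x \<in> X \<Longrightarrow> shift G g x \<in> X"
  using is_subshift by (simp add: subshift_def)

lemma shift_map_apply: "x \<in> X \<Longrightarrow> shift_map g x = shift G g x"
  by (simp add: shift_map_def)

lemma shift_shift: "g \<in> carrier G \<Longrightarrow> h \<in> carrier G \<Longrightarrow> shift G g (shift G h x) = shift G (g \<otimes> h) x"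
  by (auto simp: shift_def m_assoc fun_eq_iff)

lemma shift_one: "x \<in> X \<Longrightarrow> shift G \<one> x = x"
  by (rule X_eqI) (simp_all add: shift_mem shift_apply)

lemma shift_inv_shift:
  assumes "g \<in> carrier G" "x \<in> X"
  shows "shift G (inv g) (shift G g x) = x" "shift G g (shift G (inv g) x) = x"
  using assms by (simp_all add: shift_shift shift_one)

lemma shift_map_Bij: assumes g: "g \<in> carrier G" shows "shift_map g \<in> Bij X"
proof -
  have "bij_betw (shift_map g) X X"
    by (rule bij_betw_byWitness[where f' = "shift_map (inv g)"])
      (use g shift_inv_shift[OF g] shift_mem in \<open>auto simp: shift_map_apply\<close>)
  then show ?thesis by (simp add: Bij_def shift_map_def)
qed

lemma shift_map_Homeo: assumes g: "g \<in> carrier G" shows "shift_map g \<in> Homeo G \<Sigma> X"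
proof -
  have "local_map (shift_map g)"
    unfolding local_map_def
  proof
    fix h assume h: "h \<in> carrier G"
    show "\<exists>D. finite D \<and> D \<subseteq> carrier G \<and> (\<forall>x\<in>X. \<forall>y\<in>X. agree D x y \<longrightarrow> shift_map g x h = shift_map g y h)"
      using g h by (intro exI[of _ "{h \<otimes> g}"]) (simp add: shift_map_apply shift_apply agree_def)
  qed
  then show ?thesis using shift_map_Bij[OF g] Homeo_iff by simp
qed

lemma shift_map_mult: assumes g: "g \<in> carrier G" "h \<in> carrier G" shows "shift_map (g \<otimes> h) = shift_map g \<odot> shift_map h"
  by (rule Bij_eqI) (use g in \<open>simp_all add: shift_map_Bij bmult_apply shift_map_apply shift_shift shift_mem\<close>)

lemma shift_map_inv: assumes g: "g \<in> carrier G" shows "shift_map (inv g) = binv (shift_map g)"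
proof -
  have "shift_map (inv g) \<odot> shift_map g = bone"
    by (rule Bij_eqI) (use g in \<open>simp_all add: shift_map_Bij bmult_apply bone_apply shift_map_apply shift_shift shift_mem shift_one\<close>)
  then show ?thesis using BX.inv_equality g shift_map_Bij by simp
qed

lemma cg_eq:
  assumes "\<phi> \<in> Bij X" "g \<in> carrier G"
  shows "cg \<phi> g = binv (shift_map g) \<odot> \<phi> \<odot> shift_map g"
proof (rule extensionalityI[of _ X])
  show "cg \<phi> g \<in> extensional X" by (simp add: conj_gate_def)
  show "binv (shift_map g) \<odot> \<phi> \<odot> shift_map g \<in> extensional X"
    by (rule Bij_imp_extensional) (use assms in \<open>simp add: shift_map_Bij\<close>)
  fix x assume x: "x \<in> X"
  show "cg \<phi> g x = (binv (shift_map g) \<odot> \<phi> \<odot> shift_map g) x"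
    unfolding conj_gate_def shift_map_inv[OF assms(2), symmetric]
    using assms x by (simp add: bmult_apply shift_map_Bij shift_map_apply Bij_mem shift_mem)
qed

lemma cg_eq_conj:
  assumes "\<phi> \<in> Bij X" "g \<in> carrier G"
  shows "cg \<phi> g = shift_map (inv g) \<odot> \<phi> \<odot> binv (shift_map (inv g))"
  using assms by (simp add: cg_eq shift_map_inv shift_map_Bij)

lemma cg_apply:
  assumes "\<phi> \<in> Bij X" "g \<in> carrier G" "x \<in> X" "h \<in> carrier G"
  shows "cg \<phi> g x h = \<phi> (shift G g x) (h \<otimes> inv g)"
  unfolding conj_gate_def using assms by (simp add: shift_apply)

lemma cg_Bij: "\<phi> \<in> Bij X \<Longrightarrow> g \<in> carrier G \<Longrightarrow> cg \<phi> g \<in> Bij X"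
  by (simp add: cg_eq shift_map_Bij)

lemma cg_Homeo: "\<phi> \<in> Homeo G \<Sigma> X \<Longrightarrow> g \<in> carrier G \<Longrightarrow> cg \<phi> g \<in> Homeo G \<Sigma> X"
  using Homeo_Bij by (simp add: cg_eq Homeo_mult Homeo_inv shift_map_Homeo)

lemma cg_mult:
  assumes "\<phi> \<in> Bij X" "\<psi> \<in> Bij X" "g \<in> carrier G"
  shows "cg (\<phi> \<odot> \<psi>) g = cg \<phi> g \<odot> cg \<psi> g"
  using assms conj_mult[of "shift_map (inv g)" \<phi> \<psi>] by (simp add: cg_eq_conj shift_map_Bij)

lemma cg_one: "g \<in> carrier G \<Longrightarrow> cg bone g = bone"
  by (simp add: cg_eq shift_map_Bij)

lemma cg_inv:
  assumes "\<phi> \<in> Bij X" "g \<in> carrier G"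
  shows "cg (binv \<phi>) g = binv (cg \<phi> g)"
proof -
  have "cg (binv \<phi>) g \<odot> cg \<phi> g = bone" using assms cg_mult[of "binv \<phi>" \<phi> g] by (simp add: cg_one)
  then show ?thesis using BX.inv_equality assms cg_Bij by simp
qed

lemma cg_cg:
  assumes "\<phi> \<in> Bij X" "g \<in> carrier G" "h \<in> carrier G"
  shows "cg (cg \<phi> g) h = cg \<phi> (g \<otimes> h)"
  using assms by (simp add: cg_eq cg_Bij shift_map_Bij shift_map_mult BX.inv_mult_group BX.m_assoc)

text \<open>The finite set \<open>D\<close> is a strong neighbourhood: \<open>\<phi>\<close> changes only coordinates in \<open>D\<close>, and the new values depend only on the old values in \<open>D\<close>. Strong neighbourhoods may be enlarged, so finitely many gates have a common one.\<close>

definition supported_in :: "'g set \<Rightarrow> (('g \<Rightarrow> 's) \<Rightarrow> 'g \<Rightarrow> 's) \<Rightarrow> bool" where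
  "supported_in D \<phi> \<longleftrightarrow> \<phi> \<in> Homeo G \<Sigma> X \<and> acts_within G X D \<phi> \<and>
     (\<forall>x\<in>X. \<forall>y\<in>X. agree D x y \<longrightarrow> agree D (\<phi> x) (\<phi> y))"

lemma supported_inD:
  assumes "supported_in D \<phi>"
  shows "\<phi> \<in> Homeo G \<Sigma> X" "\<phi> \<in> Bij X" "finite D" "D \<subseteq> carrier G"
    "x \<in> X \<Longrightarrow> h \<in> carrier G \<Longrightarrow> h \<notin> D \<Longrightarrow> \<phi> x h = x h"
    "x \<in> X \<Longrightarrow> y \<in> X \<Longrightarrow> agree D x y \<Longrightarrow> agree D (\<phi> x) (\<phi> y)"
  using assms Homeo_Bij unfolding supported_in_def acts_within_def by auto

lemma supported_in_mono:
  assumes "supported_in D \<phi>" "D \<subseteq> E" "finite E" "E \<subseteq> carrier G"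
  shows "supported_in E \<phi>"
  unfolding supported_in_def acts_within_def
proof (intro conjI ballI impI)
  note s = supported_inD[OF assms(1)]
  show "\<phi> \<in> Homeo G \<Sigma> X" "finite E" "E \<subseteq> carrier G" using s assms by auto
  show "\<phi> x g = x g" if "x \<in> X" "g \<in> carrier G - E" for x g using s(5) that assms(2) by auto
  fix x y assume xy: "x \<in> X" "y \<in> X" "agree E x y"
  have "agree D (\<phi> x) (\<phi> y)" by (rule s(6)[OF xy(1,2) agree_mono[OF xy(3) assms(2)]])
  moreover have "\<phi> x g = \<phi> y g" if "g \<in> E" "g \<notin> D" for g
    using s(5) xy that assms(4) by (auto simp: agree_def)
  ultimately show "agree E (\<phi> x) (\<phi> y)" by (auto simp: agree_def)
qed

text \<open>By local dependence, adding to the changed coordinates those on which they depend gives a strong neighbourhood.\<close>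

lemma gates_iff: "\<phi> \<in> gates G \<Sigma> X \<longleftrightarrow> (\<exists>D. supported_in D \<phi>)"
proof
  assume "\<exists>D. supported_in D \<phi>"
  then show "\<phi> \<in> gates G \<Sigma> X" unfolding supported_in_def gates_def by blast
next
  assume "\<phi> \<in> gates G \<Sigma> X"
  then obtain N where h: "\<phi> \<in> Homeo G \<Sigma> X" and N: "acts_within G X N \<phi>" unfolding gates_def by blast
  have N': "finite N" "N \<subseteq> carrier G" "\<And>x g. x \<in> X \<Longrightarrow> g \<in> carrier G \<Longrightarrow> g \<notin> N \<Longrightarrow> \<phi> x g = x g"
    using N unfolding acts_within_def by auto
  obtain E where E: "finite E" "E \<subseteq> carrier G"
    "\<And>x y. x \<in> X \<Longrightarrow> y \<in> X \<Longrightarrow> agree E x y \<Longrightarrow> agree N (\<phi> x) (\<phi> y)"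
    using local_map_finite[OF _ N'(1,2)] h Homeo_iff by metis
  have "supported_in (N \<union> E) \<phi>"
    unfolding supported_in_def acts_within_def
  proof (intro conjI ballI impI)
    show "\<phi> \<in> Homeo G \<Sigma> X" by (rule h)
    show "finite (N \<union> E)" "N \<union> E \<subseteq> carrier G" using N' E by auto
    show "\<phi> x g = x g" if "x \<in> X" "g \<in> carrier G - (N \<union> E)" for x g using N'(3) that by auto
    fix x y assume xy: "x \<in> X" "y \<in> X" "agree (N \<union> E) x y"
    have "agree N (\<phi> x) (\<phi> y)" by (rule E(3)[OF xy(1,2) agree_mono[OF xy(3)]]) auto
    moreover have "\<phi> x g = \<phi> y g" if "g \<in> E" "g \<notin> N" for g
      using N'(3)[of _ g] xy that E(2) by (auto simp: agree_def)
    ultimately show "agree (N \<union> E) (\<phi> x) (\<phi> y)" by (auto simp: agree_def)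
  qed
  then show "\<exists>D. supported_in D \<phi>" by blast
qed

lemma gates_common_support:
  assumes "finite \<Phi>" "\<Phi> \<subseteq> gates G \<Sigma> X"
  obtains D where "finite D" "D \<subseteq> carrier G" "\<And>\<phi>. \<phi> \<in> \<Phi> \<Longrightarrow> supported_in D \<phi>"
proof -
  have "\<exists>D. finite D \<and> D \<subseteq> carrier G \<and> (\<forall>\<phi>\<in>\<Phi>. supported_in D \<phi>)"
    using assms
  proof (induction rule: finite_induct)
    case empty then show ?case by (intro exI[of _ "{}"]) simp
  next
    case (insert \<phi> \<Phi>)
    then obtain D where D: "finite D" "D \<subseteq> carrier G" "\<forall>\<phi>\<in>\<Phi>. supported_in D \<phi>" by auto
    obtain E where E: "supported_in E \<phi>" using insert.prems gates_iff by auto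
    have DE: "finite (D \<union> E)" "D \<union> E \<subseteq> carrier G" using D supported_inD[OF E] by auto
    have "supported_in (D \<union> E) \<phi>" by (rule supported_in_mono[OF E _ DE]) simp
    moreover have "supported_in (D \<union> E) \<psi>" if "\<psi> \<in> \<Phi>" for \<psi>
      by (rule supported_in_mono[of D, OF _ _ DE]) (use D(3) that in auto)
    ultimately show ?case using DE by (intro exI[of _ "D \<union> E"]) simp
  qed
  then show thesis using that by blast
qed

lemma gates_Bij: "\<phi> \<in> gates G \<Sigma> X \<Longrightarrow> \<phi> \<in> Bij X"
  using Homeo_Bij by (auto simp: gates_def)

lemma gates_Homeo: "\<phi> \<in> gates G \<Sigma> X \<Longrightarrow> \<phi> \<in> Homeo G \<Sigma> X"
  by (auto simp: gates_def)

lemma supported_in_mult: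
  assumes "supported_in D \<phi>" "supported_in D \<psi>" shows "supported_in D (\<phi> \<odot> \<psi>)"
proof -
  note a = supported_inD[OF assms(1)] and b = supported_inD[OF assms(2)]
  show ?thesis
    unfolding supported_in_def acts_within_def
    using a(1-4) b(1,2) a(5,6) b(5,6) Homeo_mult by (simp add: bmult_apply Bij_mem)
qed

lemma acts_within_inv:
  assumes "\<phi> \<in> Bij X" "acts_within G X N \<phi>" shows "acts_within G X N (binv \<phi>)"
  unfolding acts_within_def
proof (intro conjI ballI)
  show "finite N" "N \<subseteq> carrier G" using assms(2) by (auto simp: acts_within_def)
  fix x g assume x: "x \<in> X" and g: "g \<in> carrier G - N"
  have "\<phi> (binv \<phi> x) g = binv \<phi> x g"
    using assms x g Bij_mem[OF BX.inv_closed[OF assms(1)] x] unfolding acts_within_def by auto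
  then show "binv \<phi> x g = x g" using assms(1) x by (simp add: binv_apply)
qed

lemma gates_inv: "\<phi> \<in> gates G \<Sigma> X \<Longrightarrow> binv \<phi> \<in> gates G \<Sigma> X"
  using acts_within_inv[OF Homeo_Bij] Homeo_inv unfolding gates_def by blast

lemma gates_mult:
  assumes "\<phi> \<in> gates G \<Sigma> X" "\<psi> \<in> gates G \<Sigma> X" shows "\<phi> \<odot> \<psi> \<in> gates G \<Sigma> X"
proof -
  obtain D where D: "finite D" "D \<subseteq> carrier G" "\<And>\<xi>. \<xi> \<in> {\<phi>, \<psi>} \<Longrightarrow> supported_in D \<xi>"
    by (rule gates_common_support[of "{\<phi>, \<psi>}"]) (use assms in auto)
  then have "supported_in D (\<phi> \<odot> \<psi>)" using supported_in_mult by simp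
  then show ?thesis using gates_iff by blast
qed

lemma gates_one: "bone \<in> gates G \<Sigma> X"
  unfolding gates_def acts_within_def by (auto simp: Homeo_one bone_apply intro!: exI[of _ "{}"])

lemma disjoint_support_commute:
  assumes "supported_in D \<phi>" "supported_in E \<psi>" "D \<inter> E = {}"
  shows "\<phi> \<odot> \<psi> = \<psi> \<odot> \<phi>"
proof (rule Bij_eqI)
  note a = supported_inD[OF assms(1)] and b = supported_inD[OF assms(2)]
  show "\<phi> \<odot> \<psi> \<in> Bij X" "\<psi> \<odot> \<phi> \<in> Bij X" using a(2) b(2) by simp_all
  fix x assume x: "x \<in> X"
  have m: "\<phi> x \<in> X" "\<psi> x \<in> X" using a(2) b(2) x Bij_mem by auto
  have D: "agree D (\<psi> x) x" using b(5)[OF x] a(4) assms(3) by (auto simp: agree_def)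
  have E: "agree E (\<phi> x) x" using a(5)[OF x] b(4) assms(3) by (auto simp: agree_def)
  have D': "agree D (\<phi> (\<psi> x)) (\<phi> x)" by (rule a(6)[OF m(2) x D])
  have E': "agree E (\<psi> (\<phi> x)) (\<psi> x)" by (rule b(6)[OF m(1) x E])
  have "\<phi> (\<psi> x) = \<psi> (\<phi> x)"
  proof (rule X_eqI)
    show "\<phi> (\<psi> x) \<in> X" "\<psi> (\<phi> x) \<in> X" using m a(2) b(2) Bij_mem by auto
    fix g assume g: "g \<in> carrier G"
    consider "g \<in> D" "g \<notin> E" | "g \<in> E" "g \<notin> D" | "g \<notin> D" "g \<notin> E" using assms(3) by blast
    then show "\<phi> (\<psi> x) g = \<psi> (\<phi> x) g"
    proof cases
      case 1
      then show ?thesis using D' b(5)[OF m(1) g] by (simp add: agree_def)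
    next
      case 2
      then show ?thesis using E' a(5)[OF m(2) g] by (simp add: agree_def)
    next
      case 3
      then show ?thesis using a(5)[OF m(2) g] b(5)[OF m(1) g] a(5)[OF x g] b(5)[OF x g] by simp
    qed
  qed
  then show "(\<phi> \<odot> \<psi>) x = (\<psi> \<odot> \<phi>) x" using x a(2) b(2) by (simp add: bmult_apply)
qed

text \<open>Since \<open>shift G g x\<close> has at \<open>h\<close> the value of \<open>x\<close> at \<open>h \<otimes> g\<close>, conjugating by a shift translates the support on the right.\<close>

lemma supported_in_cg:
  assumes "supported_in D \<phi>" "g \<in> carrier G"
  shows "supported_in (D #> g) (cg \<phi> g)"
  unfolding supported_in_def acts_within_def
proof (intro conjI ballI impI)
  note s = supported_inD[OF assms(1)]
  have mem: "h \<in> D #> g \<longleftrightarrow> h \<otimes> inv g \<in> D" if "h \<in> carrier G" for h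
  proof
    assume "h \<in> D #> g"
    then obtain d where d: "d \<in> D" "h = d \<otimes> g" by (auto simp: r_coset_def)
    then show "h \<otimes> inv g \<in> D" using s(4) assms(2) by (auto simp: m_assoc subset_iff)
  next
    assume d: "h \<otimes> inv g \<in> D"
    have "h = (h \<otimes> inv g) \<otimes> g" using that assms(2) by (simp add: m_assoc)
    then show "h \<in> D #> g" using d by (auto simp: r_coset_def)
  qed
  show "cg \<phi> g \<in> Homeo G \<Sigma> X" by (rule cg_Homeo[OF s(1) assms(2)])
  show "finite (D #> g)" using s(3) by (auto simp: r_coset_def)
  show sub: "D #> g \<subseteq> carrier G" by (rule r_coset_subset_G[OF s(4) assms(2)])
  show "cg \<phi> g x h = x h" if "x \<in> X" "h \<in> carrier G - (D #> g)" for x h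
    using that mem[of h] s(2,5) assms(2) by (simp add: cg_apply shift_mem shift_apply m_assoc)
  fix x y assume xy: "x \<in> X" "y \<in> X" "agree (D #> g) x y"
  have "agree D (shift G g x) (shift G g y)"
    unfolding agree_def
  proof
    fix d assume d: "d \<in> D"
    then have "d \<otimes> g \<in> D #> g" by (auto simp: r_coset_def)
    then show "shift G g x d = shift G g y d"
      using xy(3) d s(4) by (auto simp: agree_def shift_apply subset_iff)
  qed
  then have *: "agree D (\<phi> (shift G g x)) (\<phi> (shift G g y))"
    by (rule s(6)[OF shift_mem[OF assms(2) xy(1)] shift_mem[OF assms(2) xy(2)]])
  show "agree (D #> g) (cg \<phi> g x) (cg \<phi> g y)"
    unfolding agree_def
  proof
    fix h assume h: "h \<in> D #> g"
    then have hG: "h \<in> carrier G" using sub by blast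
    then have "h \<otimes> inv g \<in> D" using mem h by simp
    then show "cg \<phi> g x h = cg \<phi> g y h"
      using * xy s(2) assms(2) hG by (simp add: cg_apply agree_def)
  qed
qed

lemma cg_gates: "\<phi> \<in> gates G \<Sigma> X \<Longrightarrow> g \<in> carrier G \<Longrightarrow> cg \<phi> g \<in> gates G \<Sigma> X"
  using supported_in_cg gates_iff by blast

lemma locally_finite_cg:
  assumes \<phi>: "\<phi> \<in> gates G \<Sigma> X" and S: "S \<subseteq> carrier G" and c: "commutes_on G X \<phi> S"
  shows "locally_finite (conj_gate G X \<phi>) S"
  unfolding locally_finite_def commuting_def
proof (intro conjI ballI)
  obtain D where D: "supported_in D \<phi>" using \<phi> gates_iff by blast
  note s = supported_inD[OF D]
  fix i assume i: "i \<in> S"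
  then show "cg \<phi> i \<in> Homeo G \<Sigma> X" "cg \<phi> i \<in> Bij X" using cg_Homeo cg_Bij s S by auto
  fix j assume "j \<in> S"
  then show "cg \<phi> i \<odot> cg \<phi> j = cg \<phi> j \<odot> cg \<phi> i" using c i unfolding commutes_on_def by blast
next
  obtain D where D: "supported_in D \<phi>" using \<phi> gates_iff by blast
  fix g assume g: "g \<in> carrier G"
  have "touching (conj_gate G X \<phi>) S g \<subseteq> (\<lambda>d. inv d \<otimes> g) ` D"
  proof
    fix i assume "i \<in> touching (conj_gate G X \<phi>) S g"
    then obtain x where i: "i \<in> S" and x: "x \<in> X" "cg \<phi> i x g \<noteq> x g" by (auto simp: touching_def)
    have iG: "i \<in> carrier G" using i S by blast
    have "g \<in> D #> i" using supported_inD(5)[OF supported_in_cg[OF D iG] x(1) g] x(2) by blast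
    then obtain d where d: "d \<in> D" "g = d \<otimes> i" by (auto simp: r_coset_def)
    then have "inv d \<otimes> g = i" using supported_inD(4)[OF D] iG by (auto simp: m_assoc[symmetric] subset_iff)
    then show "i \<in> (\<lambda>d. inv d \<otimes> g) ` D" using d by force
  qed
  then show "finite (touching (conj_gate G X \<phi>) S g)" using supported_inD(3)[OF D] finite_surj by blast
qed

lemma gate_power_eq: "gate_power G \<Sigma> X \<phi> S = lim_prod (conj_gate G X \<phi>) S"
  unfolding gate_power_def lim_prod_def ..

section \<open>Even gates\<close>

text \<open>The fillings of \<open>N\<close>, kept as whole configurations. A map that acts within \<open>N\<close> permutes each of these finite sets.\<close>

definition tail_class :: "'g set \<Rightarrow> ('g \<Rightarrow> 's) \<Rightarrow> ('g \<Rightarrow> 's) set" where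
  "tail_class N x = {z \<in> X. agree (carrier G - N) z x}"

text \<open>Evenness in terms of configurations instead of fillings. In this form it passes to larger sets \<open>N\<close> and to conjugates.\<close>

definition even_on :: "'g set \<Rightarrow> (('g \<Rightarrow> 's) \<Rightarrow> 'g \<Rightarrow> 's) \<Rightarrow> bool" where
  "even_on N \<phi> \<longleftrightarrow> \<phi> \<in> Homeo G \<Sigma> X \<and> acts_within G X N \<phi> \<and>
     (\<forall>x\<in>X. evenperm (restrict_id \<phi> (tail_class N x)))"

lemma inj_on_tail_class: "inj_on (\<lambda>z. restrict z N) (tail_class N x)"
proof (rule inj_onI)
  fix z w assume zw: "z \<in> tail_class N x" "w \<in> tail_class N x" "restrict z N = restrict w N"
  show "z = w"
  proof (rule X_eqI)
    fix g assume g: "g \<in> carrier G"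
    show "z g = w g"
    proof (cases "g \<in> N")
      case True then show ?thesis using fun_cong[OF zw(3), of g] by simp
    next
      case False then show ?thesis using zw g by (auto simp: tail_class_def agree_def)
    qed
  qed (use zw in \<open>auto simp: tail_class_def\<close>)
qed

lemma finite_tail_class:
  assumes "finite N" "N \<subseteq> carrier G" shows "finite (tail_class N x)"
proof -
  have "(\<lambda>z. restrict z N) ` tail_class N x \<subseteq> N \<rightarrow>\<^sub>E \<Sigma>"
    using X_config assms(2) by (fastforce simp: tail_class_def PiE_iff subset_iff)
  then have "finite ((\<lambda>z. restrict z N) ` tail_class N x)"
    using finite_PiE[OF assms(1), of "\<lambda>_. \<Sigma>"] finite_alphabet finite_subset by blast
  then show ?thesis using inj_on_tail_class finite_imageD by blast
qed

lemma bij_betw_tail_class: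
  assumes "\<phi> \<in> Bij X" "acts_within G X N \<phi>"
  shows "bij_betw \<phi> (tail_class N x) (tail_class N x)"
proof -
  have N: "finite N" "N \<subseteq> carrier G" "\<And>x g. x \<in> X \<Longrightarrow> g \<in> carrier G - N \<Longrightarrow> \<phi> x g = x g"
    using assms(2) by (auto simp: acts_within_def)
  have "\<phi> ` tail_class N x \<subseteq> tail_class N x"
    using N(3) Bij_mem[OF assms(1)] by (auto simp: tail_class_def agree_def)
  moreover have "inj_on \<phi> (tail_class N x)"
    using assms(1) by (auto simp: Bij_def bij_betw_def tail_class_def intro: inj_on_subset)
  ultimately show ?thesis
    using endo_inj_surj[OF finite_tail_class[OF N(1,2)]] by (simp add: bij_betw_def)
qed

text \<open>Changing \<open>x\<close> at finitely many places changes \<open>f x\<close> at finitely many places, with a bound that is uniform in \<open>x\<close>. Conjugation by such maps preserves gates and their parity.\<close>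

definition spreads :: "(('g \<Rightarrow> 's) \<Rightarrow> 'g \<Rightarrow> 's) \<Rightarrow> bool" where
  "spreads f \<longleftrightarrow> (\<forall>N. finite N \<and> N \<subseteq> carrier G \<longrightarrow> (\<exists>N'. finite N' \<and> N' \<subseteq> carrier G \<and>
     (\<forall>x\<in>X. \<forall>y\<in>X. agree (carrier G - N) x y \<longrightarrow> agree (carrier G - N') (f x) (f y))))"

text \<open>The preimage under \<open>f\<close> of a class modulo \<open>N'\<close> is a finite union of classes modulo \<open>N\<close>. On each of them \<open>\<phi>\<close> is even, so \<open>\<phi>\<close> is even on the union, and \<open>f\<close> carries this to the conjugate.\<close>

lemma even_on_conj:
  assumes f: "f \<in> Homeo G \<Sigma> X" and ev: "even_on N \<phi>" and N': "finite N'" "N' \<subseteq> carrier G"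
    and sp: "\<And>x y. x \<in> X \<Longrightarrow> y \<in> X \<Longrightarrow> agree (carrier G - N) x y \<Longrightarrow> agree (carrier G - N') (f x) (f y)"
  shows "even_on N' (f \<odot> \<phi> \<odot> binv f)"
  unfolding even_on_def
proof (intro conjI ballI)
  let ?\<psi> = "f \<odot> \<phi> \<odot> binv f"
  have fB: "f \<in> Bij X" "binv f \<in> Bij X" using f Homeo_Bij by auto
  have \<phi>: "\<phi> \<in> Homeo G \<Sigma> X" "\<phi> \<in> Bij X" "acts_within G X N \<phi>"
    using ev Homeo_Bij by (auto simp: even_on_def)
  have N: "finite N" "N \<subseteq> carrier G" "\<And>x g. x \<in> X \<Longrightarrow> g \<in> carrier G - N \<Longrightarrow> \<phi> x g = x g"
    using \<phi>(3) by (auto simp: acts_within_def)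
  show h: "?\<psi> \<in> Homeo G \<Sigma> X" using f \<phi> Homeo_mult Homeo_inv by simp
  have ap: "?\<psi> y = f (\<phi> (binv f y))" if "y \<in> X" for y
    using fB \<phi>(2) that by (simp add: bmult_apply Bij_mem)
  show act: "acts_within G X N' ?\<psi>"
    unfolding acts_within_def
  proof (intro conjI ballI N')
    fix y g assume y: "y \<in> X" and g: "g \<in> carrier G - N'"
    have m: "binv f y \<in> X" "\<phi> (binv f y) \<in> X" using y fB \<phi>(2) Bij_mem by auto
    have "agree (carrier G - N) (\<phi> (binv f y)) (binv f y)" using N(3)[OF m(1)] by (simp add: agree_def)
    then have "agree (carrier G - N') (f (\<phi> (binv f y))) (f (binv f y))" by (rule sp[OF m(2,1)])
    then show "?\<psi> y g = y g" using g ap[OF y] fB y by (simp add: agree_def binv_apply)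
  qed
  fix y assume y: "y \<in> X"
  let ?S = "binv f ` tail_class N' y"
  have clsX: "tail_class N' y \<subseteq> X" by (auto simp: tail_class_def)
  have SX: "?S \<subseteq> X" using Bij_mem[OF fB(2)] clsX by auto
  have fS: "f ` ?S = tail_class N' y"
  proof -
    have "f ` ?S = (\<lambda>z. z) ` tail_class N' y"
      unfolding image_image by (rule image_cong) (use clsX fB binv_apply in auto)
    then show ?thesis by simp
  qed
  have fin: "finite ?S" using finite_tail_class[OF N'] by simp
  have injf: "inj_on f ?S" using fB(1) SX by (auto simp: Bij_def bij_betw_def intro: inj_on_subset)
  have memS: "w \<in> ?S" if w: "w \<in> X" "f w \<in> tail_class N' y" for w
    using binv_apply(2)[OF fB(1) w(1)] w(2) by force
  have closed: "w \<in> ?S" if z: "z \<in> ?S" and w: "w \<in> X" "agree (carrier G - N) w z" for w z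
  proof (rule memS[OF w(1)])
    have zX: "z \<in> X" using z SX by blast
    have "f z \<in> tail_class N' y" using z fS by blast
    then show "f w \<in> tail_class N' y"
      using sp[OF w(1) zX w(2)] Bij_mem[OF fB(1) w(1)] agree_trans by (auto simp: tail_class_def)
  qed
  have \<phi>S: "bij_betw \<phi> ?S ?S"
  proof -
    have "\<phi> z \<in> ?S" if z: "z \<in> ?S" for z
    proof (rule closed[OF z])
      have zX: "z \<in> X" using z SX by blast
      then show "\<phi> z \<in> X" by (rule Bij_mem[OF \<phi>(2)])
      show "agree (carrier G - N) (\<phi> z) z" using N(3)[OF zX] by (simp add: agree_def)
    qed
    then have "\<phi> ` ?S \<subseteq> ?S" by blast
    moreover have "inj_on \<phi> ?S" using \<phi>(2) SX by (auto simp: Bij_def bij_betw_def intro: inj_on_subset)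
    ultimately show ?thesis using endo_inj_surj[OF fin] by (simp add: bij_betw_def)
  qed
  have "evenperm (restrict_id \<phi> ?S)"
  proof (rule evenperm_restrict_id_partition[OF fin \<phi>S, of "\<lambda>z. restrict z (carrier G - N)"])
    fix z assume z: "z \<in> ?S"
    have zX: "z \<in> X" using z SX by blast
    show "restrict (\<phi> z) (carrier G - N) = restrict z (carrier G - N)"
      using N(3)[OF zX] by (auto simp: restrict_def fun_eq_iff)
    have "{w \<in> ?S. restrict w (carrier G - N) = restrict z (carrier G - N)} = tail_class N z"
    proof (intro equalityI subsetI)
      fix w assume "w \<in> {w \<in> ?S. restrict w (carrier G - N) = restrict z (carrier G - N)}"
      then have w: "w \<in> ?S" "restrict w (carrier G - N) = restrict z (carrier G - N)" by auto
      then have "w \<in> X" using SX by blast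
      moreover have "w g = z g" if "g \<in> carrier G - N" for g
        using fun_cong[OF w(2), of g] that by simp
      ultimately show "w \<in> tail_class N z" by (simp add: tail_class_def agree_def)
    next
      fix w assume w: "w \<in> tail_class N z"
      then have "w \<in> X" "agree (carrier G - N) w z" by (auto simp: tail_class_def)
      then show "w \<in> {w \<in> ?S. restrict w (carrier G - N) = restrict z (carrier G - N)}"
        using closed[OF z] by (auto simp: agree_def restrict_def fun_eq_iff)
    qed
    then show "evenperm (restrict_id \<phi> {w \<in> ?S. restrict w (carrier G - N) = restrict z (carrier G - N)})"
      using ev zX by (simp add: even_on_def)
  qed
  moreover have "evenperm (restrict_id ?\<psi> (f ` ?S)) \<longleftrightarrow> evenperm (restrict_id \<phi> ?S)"
  proof (rule restrict_id_transport(2)[OF injf \<phi>S _ fin])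
    fix z assume "z \<in> ?S"
    then have "z \<in> X" using SX by blast
    then show "?\<psi> (f z) = f (\<phi> z)" using ap[of "f z"] fB by (simp add: Bij_mem binv_apply)
  qed
  ultimately show "evenperm (restrict_id ?\<psi> (tail_class N' y))" using fS by simp
qed

text \<open>Conjugation by the identity.\<close>

lemma even_on_mono:
  assumes "even_on N \<phi>" "N \<subseteq> N'" "finite N'" "N' \<subseteq> carrier G"
  shows "even_on N' \<phi>"
proof -
  have "even_on N' (bone \<odot> \<phi> \<odot> binv bone)"
  proof (rule even_on_conj[OF Homeo_one assms(1,3,4)])
    fix x y assume "x \<in> X" "y \<in> X" "agree (carrier G - N) x y"
    then show "agree (carrier G - N') (bone x) (bone y)" using assms(2) by (auto simp: bone_apply agree_def)
  qed
  moreover have "\<phi> \<in> Bij X" using assms(1) Homeo_Bij by (simp add: even_on_def)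
  ultimately show ?thesis by simp
qed

lemma fillings_eq:
  assumes "x \<in> X"
  shows "fillings G X N (restrict x (carrier G - N)) = (\<lambda>z. restrict z N) ` tail_class N x"
proof -
  have "restrict z (carrier G - N) = restrict x (carrier G - N) \<longleftrightarrow> agree (carrier G - N) z x" for z
    by (auto simp: restrict_def fun_eq_iff agree_def)
  then show ?thesis unfolding fillings_def tail_class_def by auto
qed

text \<open>Restricting to \<open>N\<close> identifies a class modulo \<open>N\<close> with the fillings of \<open>N\<close>. For the converse \<open>N\<close> must first be enlarged to a strong neighbourhood.\<close>

lemma even_gates_iff: "\<phi> \<in> even_gates G \<Sigma> X \<longleftrightarrow> (\<exists>N. even_on N \<phi>)"
proof
  assume "\<phi> \<in> even_gates G \<Sigma> X"
  then obtain N \<phi>' where g: "\<phi> \<in> gates G \<Sigma> X" and sn: "strong_neighborhood G X \<phi> N \<phi>'"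
    and ev: "\<And>y. y \<in> restrictions X (carrier G - N) \<Longrightarrow> even_perm_on \<phi>' (fillings G X N y)"
    unfolding even_gates_def by blast
  have act: "acts_within G X N \<phi>" and loc: "\<And>x. x \<in> X \<Longrightarrow> restrict (\<phi> x) N = \<phi>' (restrict x N)"
    using sn by (auto simp: strong_neighborhood_def)
  have N: "finite N" "N \<subseteq> carrier G" using act by (auto simp: acts_within_def)
  have "evenperm (restrict_id \<phi> (tail_class N x))" if x: "x \<in> X" for x
  proof -
    have "even_perm_on \<phi>' (fillings G X N (restrict x (carrier G - N)))"
      using ev x unfolding restrictions_def by blast
    then have "evenperm (restrict_id \<phi>' ((\<lambda>z. restrict z N) ` tail_class N x))"
      unfolding fillings_eq[OF x] even_perm_on_def by blast
    moreover have "evenperm (restrict_id \<phi>' ((\<lambda>z. restrict z N) ` tail_class N x)) \<longleftrightarrow> evenperm (restrict_id \<phi> (tail_class N x))"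
      by (rule restrict_id_transport(2)[OF inj_on_tail_class bij_betw_tail_class[OF gates_Bij[OF g] act] _ finite_tail_class[OF N]])
        (use loc in \<open>simp add: tail_class_def\<close>)
    ultimately show ?thesis by simp
  qed
  then show "\<exists>N. even_on N \<phi>" using act gates_Homeo[OF g] unfolding even_on_def by blast
next
  assume "\<exists>N. even_on N \<phi>"
  then obtain N0 where N0: "even_on N0 \<phi>" by blast
  then have g: "\<phi> \<in> gates G \<Sigma> X" and fN0: "finite N0" "N0 \<subseteq> carrier G"
    unfolding even_on_def gates_def acts_within_def by auto
  obtain D where D: "supported_in D \<phi>" using g gates_iff by blast
  define N where "N = N0 \<union> D"
  have N: "finite N" "N \<subseteq> carrier G" using fN0 supported_inD[OF D] by (auto simp: N_def)
  have ev: "even_on N \<phi>" by (rule even_on_mono[OF N0 _ N]) (simp add: N_def)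
  have s: "supported_in N \<phi>" by (rule supported_in_mono[OF D _ N]) (simp add: N_def)
  note sD = supported_inD[OF s]
  have act: "acts_within G X N \<phi>" using s by (simp add: supported_in_def)
  define \<phi>' where "\<phi>' p = restrict (\<phi> (SOME x. x \<in> X \<and> restrict x N = p)) N" for p
  have loc: "restrict (\<phi> x) N = \<phi>' (restrict x N)" if x: "x \<in> X" for x
  proof -
    obtain y where y: "y = (SOME y. y \<in> X \<and> restrict y N = restrict x N)" by blast
    have yX: "y \<in> X \<and> restrict y N = restrict x N" unfolding y by (rule someI[of _ x]) (use x in simp)
    have "x g = y g" if "g \<in> N" for g
      using fun_cong[OF conjunct2[OF yX], of g] that by simp
    then have "agree N x y" by (simp add: agree_def)
    then have "agree N (\<phi> x) (\<phi> y)" using sD(6) x yX by blast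
    then have "restrict (\<phi> x) N = restrict (\<phi> y) N" by (auto simp: agree_def restrict_def fun_eq_iff)
    then show ?thesis unfolding \<phi>'_def y .
  qed
  have "strong_neighborhood G X \<phi> N \<phi>'"
    unfolding strong_neighborhood_def
  proof (intro conjI ballI)
    show "\<phi>' \<in> restrictions X N \<rightarrow> restrictions X N"
      using loc[symmetric] Bij_mem[OF sD(2)] by (auto simp: restrictions_def)
  qed (use act loc in auto)
  moreover have "even_perm_on \<phi>' (fillings G X N y)" if "y \<in> restrictions X (carrier G - N)" for y
  proof -
    obtain x where x: "x \<in> X" "y = restrict x (carrier G - N)" using \<open>y \<in> _\<close> by (auto simp: restrictions_def)
    have l: "\<phi>' (restrict z N) = restrict (\<phi> z) N" if "z \<in> tail_class N x" for z
      using that loc by (simp add: tail_class_def)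
    have "evenperm (restrict_id \<phi>' ((\<lambda>z. restrict z N) ` tail_class N x)) \<longleftrightarrow> evenperm (restrict_id \<phi> (tail_class N x))"
      by (rule restrict_id_transport(2)[OF inj_on_tail_class bij_betw_tail_class[OF sD(2) act] _ finite_tail_class[OF N]]) (rule l)
    then have "evenperm (restrict_id \<phi>' ((\<lambda>z. restrict z N) ` tail_class N x))"
      using ev x(1) by (simp add: even_on_def)
    moreover have "bij_betw \<phi>' ((\<lambda>z. restrict z N) ` tail_class N x) ((\<lambda>z. restrict z N) ` tail_class N x)"
      by (rule restrict_id_transport(1)[OF inj_on_tail_class bij_betw_tail_class[OF sD(2) act]]) (rule l)
    then have "restrict_id \<phi>' ((\<lambda>z. restrict z N) ` tail_class N x) permutes ((\<lambda>z. restrict z N) ` tail_class N x)"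
      by (rule permutes_restrict_id)
    ultimately show ?thesis unfolding x(2) fillings_eq[OF x(1)] even_perm_on_def by simp
  qed
  ultimately show "\<phi> \<in> even_gates G \<Sigma> X" using g unfolding even_gates_def by blast
qed

lemma even_gates_subset: "even_gates G \<Sigma> X \<subseteq> gates G \<Sigma> X"
  by (auto simp: even_gates_def)

lemma even_gates_conj:
  assumes "f \<in> Homeo G \<Sigma> X" "spreads f" "\<phi> \<in> even_gates G \<Sigma> X"
  shows "f \<odot> \<phi> \<odot> binv f \<in> even_gates G \<Sigma> X"
proof -
  obtain N where N: "even_on N \<phi>" using assms(3) even_gates_iff by blast
  then have fN: "finite N" "N \<subseteq> carrier G" by (auto simp: even_on_def acts_within_def)
  obtain N' where "finite N'" "N' \<subseteq> carrier G"
    "\<And>x y. x \<in> X \<Longrightarrow> y \<in> X \<Longrightarrow> agree (carrier G - N) x y \<Longrightarrow> agree (carrier G - N') (f x) (f y)"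
    using assms(2) fN unfolding spreads_def by metis
  then have "even_on N' (f \<odot> \<phi> \<odot> binv f)" by (rule even_on_conj[OF assms(1) N])
  then show ?thesis using even_gates_iff by blast
qed

lemma gates_conj:
  assumes f: "f \<in> Homeo G \<Sigma> X" "spreads f" and \<phi>: "\<phi> \<in> gates G \<Sigma> X"
  shows "f \<odot> \<phi> \<odot> binv f \<in> gates G \<Sigma> X"
proof -
  have B: "f \<in> Bij X" "\<phi> \<in> Bij X" using f \<phi> Homeo_Bij gates_Bij by auto
  obtain N where N: "finite N" "N \<subseteq> carrier G" "\<And>x g. x \<in> X \<Longrightarrow> g \<in> carrier G - N \<Longrightarrow> \<phi> x g = x g"
    using \<phi> by (auto simp: gates_def acts_within_def)
  obtain N' where N': "finite N'" "N' \<subseteq> carrier G"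
    "\<And>x y. x \<in> X \<Longrightarrow> y \<in> X \<Longrightarrow> agree (carrier G - N) x y \<Longrightarrow> agree (carrier G - N') (f x) (f y)"
    using f(2) N(1,2) unfolding spreads_def by metis
  have "acts_within G X N' (f \<odot> \<phi> \<odot> binv f)"
    unfolding acts_within_def
  proof (intro conjI ballI N'(1,2))
    fix y g assume y: "y \<in> X" and g: "g \<in> carrier G - N'"
    have m: "binv f y \<in> X" "\<phi> (binv f y) \<in> X" using y B Bij_mem BX.inv_closed by auto
    have "agree (carrier G - N) (\<phi> (binv f y)) (binv f y)" using N(3)[OF m(1)] by (simp add: agree_def)
    then have "agree (carrier G - N') (f (\<phi> (binv f y))) (f (binv f y))" by (rule N'(3)[OF m(2,1)])
    then show "(f \<odot> \<phi> \<odot> binv f) y g = y g"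
      using g B y m by (simp add: agree_def binv_apply bmult_apply)
  qed
  moreover have "f \<odot> \<phi> \<odot> binv f \<in> Homeo G \<Sigma> X" using f \<phi> gates_Homeo Homeo_mult Homeo_inv by simp
  ultimately show ?thesis unfolding gates_def by blast
qed

lemma spreads_shift_map:
  assumes g: "g \<in> carrier G" shows "spreads (shift_map g)"
  unfolding spreads_def
proof (intro allI impI)
  fix N assume N: "finite N \<and> N \<subseteq> carrier G"
  have gi: "inv g \<in> carrier G" using g by simp
  have "agree (carrier G - (N #> inv g)) (shift_map g x) (shift_map g y)"
    if xy: "x \<in> X" "y \<in> X" "agree (carrier G - N) x y" for x y
    unfolding agree_def
  proof
    fix h assume h: "h \<in> carrier G - (N #> inv g)"
    have "h \<otimes> g \<notin> N"
    proof
      assume *: "h \<otimes> g \<in> N"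
      have "h = (h \<otimes> g) \<otimes> inv g" using h g by (simp add: m_assoc)
      then show False using h * by (auto simp: r_coset_def)
    qed
    then show "shift_map g x h = shift_map g y h" using xy h g by (simp add: shift_map_apply shift_apply agree_def)
  qed
  moreover have "finite (N #> inv g)" using N by (auto simp: r_coset_def)
  moreover have "N #> inv g \<subseteq> carrier G" using r_coset_subset_G[OF _ gi] N by blast
  ultimately show "\<exists>N'. finite N' \<and> N' \<subseteq> carrier G \<and> (\<forall>x\<in>X. \<forall>y\<in>X. agree (carrier G - N) x y \<longrightarrow>
      agree (carrier G - N') (shift_map g x) (shift_map g y))" by blast
qed

lemma cg_even: "\<phi> \<in> even_gates G \<Sigma> X \<Longrightarrow> g \<in> carrier G \<Longrightarrow> cg \<phi> g \<in> even_gates G \<Sigma> X"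
  using even_gates_conj[OF shift_map_Homeo spreads_shift_map, of "inv g" \<phi>] even_gates_subset gates_Bij
  by (auto simp: cg_eq_conj)

text \<open>The parity of a product of permutations is the product of the parities, so the parities in a commutator cancel on every class.\<close>

lemma even_commutator:
  assumes "\<phi> \<in> gates G \<Sigma> X" "\<psi> \<in> gates G \<Sigma> X"
  shows "\<phi> \<odot> \<psi> \<odot> binv \<phi> \<odot> binv \<psi> \<in> even_gates G \<Sigma> X"
proof -
  let ?c = "\<phi> \<odot> \<psi> \<odot> binv \<phi> \<odot> binv \<psi>"
  have B: "\<phi> \<in> Bij X" "\<psi> \<in> Bij X" using assms gates_Bij by auto
  have gc: "?c \<in> gates G \<Sigma> X" using assms gates_mult gates_inv by simp
  obtain N where N: "finite N" "N \<subseteq> carrier G" "\<And>\<xi>. \<xi> \<in> {\<phi>, \<psi>, ?c} \<Longrightarrow> supported_in N \<xi>"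
    by (rule gates_common_support[of "{\<phi>, \<psi>, ?c}"]) (use assms gc in auto)
  then have act: "acts_within G X N \<phi>" "acts_within G X N \<psi>" "acts_within G X N ?c"
    unfolding supported_in_def by auto
  have "evenperm (restrict_id ?c (tail_class N x))" if x: "x \<in> X" for x
  proof -
    let ?S = "tail_class N x"
    have SX: "z \<in> X" if "z \<in> ?S" for z using that by (simp add: tail_class_def)
    note bij = bij_betw_tail_class[OF B(1) act(1), of x] bij_betw_tail_class[OF B(2) act(2), of x]
      bij_betw_tail_class[OF BX.inv_closed[OF B(1)] acts_within_inv[OF B(1) act(1)], of x]
      bij_betw_tail_class[OF BX.inv_closed[OF B(2)] acts_within_inv[OF B(2) act(2)], of x]
    note mem = bij_betw_apply[OF bij(1)] bij_betw_apply[OF bij(2)] bij_betw_apply[OF bij(3)] bij_betw_apply[OF bij(4)]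
    note perm = permutation_restrict_id[OF finite_tail_class[OF N(1,2)] bij(1)] permutation_restrict_id[OF finite_tail_class[OF N(1,2)] bij(2)]
      permutation_restrict_id[OF finite_tail_class[OF N(1,2)] bij(3)] permutation_restrict_id[OF finite_tail_class[OF N(1,2)] bij(4)]
    have inv_parity: "evenperm (restrict_id (binv \<xi>) ?S) = evenperm (restrict_id \<xi> ?S)"
      if \<xi>: "\<xi> \<in> Bij X" "bij_betw \<xi> ?S ?S" "bij_betw (binv \<xi>) ?S ?S" for \<xi>
    proof -
      have "restrict_id (binv \<xi>) ?S \<circ> restrict_id \<xi> ?S = id"
        using binv_apply[OF \<xi>(1) SX] bij_betw_apply[OF \<xi>(2)] by (auto simp: restrict_id_def fun_eq_iff)
      then have "evenperm (restrict_id (binv \<xi>) ?S \<circ> restrict_id \<xi> ?S)" by simp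
      then show ?thesis
        using evenperm_comp[OF permutation_restrict_id[OF finite_tail_class[OF N(1,2)] \<xi>(3)]
            permutation_restrict_id[OF finite_tail_class[OF N(1,2)] \<xi>(2)]] by simp
    qed
    have "restrict_id ?c ?S = restrict_id \<phi> ?S \<circ> (restrict_id \<psi> ?S \<circ> (restrict_id (binv \<phi>) ?S \<circ> restrict_id (binv \<psi>) ?S))"
      using mem SX B by (auto simp: restrict_id_def fun_eq_iff bmult_apply)
    then show ?thesis
      using inv_parity[OF B(1) bij(1,3)] inv_parity[OF B(2) bij(2,4)] perm
      by (auto simp: evenperm_comp permutation_compose)
  qed
  then have "even_on N ?c" using act(3) gates_Homeo[OF gc] unfolding even_on_def by blast
  then show ?thesis using even_gates_iff by blast
qed

end

section \<open>Cosets and conjugation in abstract groups\<close>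

lemma (in group) rcos_eq_lcos: "K \<lhd> G \<Longrightarrow> g \<in> carrier G \<Longrightarrow> K #> g = g <# K"
  using normal.coset_eq by blast

lemma (in group) coset_representatives:
  assumes "finite_index_normal G K"
  obtains R where "finite R" "R \<subseteq> carrier G" "\<And>g. g \<in> carrier G \<Longrightarrow> \<exists>r\<in>R. \<exists>k\<in>K. g = r \<otimes> k"
proof -
  note K = finite_index_normalD[OF assms]
  have "finite ((\<lambda>g. K #> g) ` carrier G)" using K(4) finite_rcosets_image by blast
  then obtain R where R: "finite R" "R \<subseteq> carrier G" "(\<lambda>g. K #> g) ` carrier G = (\<lambda>g. K #> g) ` R"
    using finite_subset_image[of "(\<lambda>g. K #> g) ` carrier G" "\<lambda>g. K #> g" "carrier G"] by auto
  have "\<exists>r\<in>R. \<exists>k\<in>K. g = r \<otimes> k" if g: "g \<in> carrier G" for g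
  proof -
    obtain r where r: "r \<in> R" "K #> g = K #> r" using R(3) g by blast
    then have "g \<in> r <# K" using rcos_self[OF g K(2)] rcos_eq_lcos[OF K(1)] R(2) by auto
    then show ?thesis using r(1) by (auto simp: l_coset_def)
  qed
  then show thesis using that R(1,2) by blast
qed

lemma (in group) generate_induct_subgroup:
  assumes "subgroup N G" "S \<subseteq> N" "x \<in> generate G S"
  shows "x \<in> N"
  using generate_subgroup_incl[OF assms(2,1)] assms(3) by blast

lemma (in group) conj_closed_subgroup:
  assumes "subgroup M G" "f \<in> carrier G"
  shows "subgroup {x \<in> carrier G. f \<otimes> x \<otimes> inv f \<in> M} G"
proof (rule subgroupI)
  have *: "f \<otimes> (a \<otimes> b) \<otimes> inv f = (f \<otimes> a \<otimes> inv f) \<otimes> (f \<otimes> b \<otimes> inv f)"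
    if "a \<in> carrier G" "b \<in> carrier G" for a b
    using that assms(2) by (simp add: m_assoc inv_cancel)
  show "{x \<in> carrier G. f \<otimes> x \<otimes> inv f \<in> M} \<noteq> {}"
    using subgroup.one_closed[OF assms(1)] assms(2) by (auto intro!: exI[of _ \<one>])
  fix a assume a: "a \<in> {x \<in> carrier G. f \<otimes> x \<otimes> inv f \<in> M}"
  have "f \<otimes> inv a \<otimes> inv f = inv (f \<otimes> a \<otimes> inv f)"
    using a assms(2) by (simp add: inv_mult_group m_assoc)
  then show "inv a \<in> {x \<in> carrier G. f \<otimes> x \<otimes> inv f \<in> M}"
    using a subgroup.m_inv_closed[OF assms(1)] by simp
  fix b assume b: "b \<in> {x \<in> carrier G. f \<otimes> x \<otimes> inv f \<in> M}"
  then show "a \<otimes> b \<in> {x \<in> carrier G. f \<otimes> x \<otimes> inv f \<in> M}"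
    using a *[of a b] subgroup.m_closed[OF assms(1)] by simp
qed auto

text \<open>The elements that commute with \<open>g\<close> modulo \<open>N\<close>. It suffices to check generators, which is how commutators of lattices are reduced to commutators of gates.\<close>

lemma (in group) centralizing_mod_subgroup:
  assumes N: "subgroup N G" and H: "H \<subseteq> carrier G" "subgroup H G" and g: "g \<in> carrier G"
    and norm: "\<And>h n. h \<in> H \<Longrightarrow> n \<in> N \<Longrightarrow> h \<otimes> n \<otimes> inv h \<in> N"
  shows "subgroup {h \<in> H. h \<otimes> g \<otimes> inv h \<otimes> inv g \<in> N} G"
proof (rule subgroupI)
  show "{h \<in> H. h \<otimes> g \<otimes> inv h \<otimes> inv g \<in> N} \<subseteq> carrier G" using H by auto
  show "{h \<in> H. h \<otimes> g \<otimes> inv h \<otimes> inv g \<in> N} \<noteq> {}"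
    using subgroup.one_closed[OF N] subgroup.one_closed[OF H(2)] g by (auto intro!: exI[of _ \<one>])
  fix a assume a: "a \<in> {h \<in> H. h \<otimes> g \<otimes> inv h \<otimes> inv g \<in> N}"
  then have aG: "a \<in> carrier G" "inv a \<in> H" using H subgroup.m_inv_closed[OF H(2)] by auto
  have "inv a \<otimes> inv (a \<otimes> g \<otimes> inv a \<otimes> inv g) \<otimes> inv (inv a) \<in> N"
    using norm[OF aG(2)] subgroup.m_inv_closed[OF N] a by blast
  moreover have "inv a \<otimes> inv (a \<otimes> g \<otimes> inv a \<otimes> inv g) \<otimes> inv (inv a) = inv a \<otimes> g \<otimes> inv (inv a) \<otimes> inv g"
    using aG(1) g by (simp add: inv_mult_group m_assoc inv_cancel)
  ultimately show "inv a \<in> {h \<in> H. h \<otimes> g \<otimes> inv h \<otimes> inv g \<in> N}" using aG by simp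
  fix b assume b: "b \<in> {h \<in> H. h \<otimes> g \<otimes> inv h \<otimes> inv g \<in> N}"
  then have bG: "b \<in> carrier G" using H by auto
  have "(a \<otimes> (b \<otimes> g \<otimes> inv b \<otimes> inv g) \<otimes> inv a) \<otimes> (a \<otimes> g \<otimes> inv a \<otimes> inv g) \<in> N"
    using norm a b subgroup.m_closed[OF N] by simp
  moreover have "(a \<otimes> (b \<otimes> g \<otimes> inv b \<otimes> inv g) \<otimes> inv a) \<otimes> (a \<otimes> g \<otimes> inv a \<otimes> inv g) =
      (a \<otimes> b) \<otimes> g \<otimes> inv (a \<otimes> b) \<otimes> inv g"
    using aG(1) bG g by (simp add: inv_mult_group m_assoc inv_cancel)
  ultimately show "a \<otimes> b \<in> {h \<in> H. h \<otimes> g \<otimes> inv h \<otimes> inv g \<in> N}"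
    using a b subgroup.m_closed[OF H(2)] by simp
qed

context subshift_space
begin

abbreviation gp where "gp \<phi> S \<equiv> gate_power G \<Sigma> X \<phi> S"

lemma lim_prod_cong:
  assumes a: "locally_finite a I" and eq: "\<And>i. i \<in> I \<Longrightarrow> a i = b i"
  shows "locally_finite b I" "lim_prod b I = lim_prod a I"
proof -
  have t: "touching b I g = touching a I g" for g using eq by (auto simp: touching_def)
  have c: "commuting b I" using locally_finiteD(3)[OF a] commuting_cong[of I a b] eq by blast
  have "b i \<in> Homeo G \<Sigma> X" if "i \<in> I" for i using locally_finiteD(1)[OF a that] eq[OF that] by simp
  then show b: "locally_finite b I"
    unfolding locally_finite_def using c t locally_finiteD(4)[OF a] by simp
  show "lim_prod b I = lim_prod a I"
  proof (rule Bij_eqI[OF lim_prod_Bij[OF b] lim_prod_Bij[OF a]])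
    fix x assume x: "x \<in> X"
    show "lim_prod b I x = lim_prod a I x"
    proof (rule X_eqI[OF lim_prod_mem[OF b x] lim_prod_mem[OF a x]])
      fix g assume g: "g \<in> carrier G"
      let ?T = "touching a I g"
      note T = locally_finiteD(4)[OF a g]
      have "finprod BX a ?T = finprod BX b ?T"
        by (rule finite_prod_cong[OF T commuting_mono[OF locally_finiteD(3)[OF a] touching_subset]])
          (rule eq[OF subsetD[OF touching_subset]])
      then show "lim_prod b I x g = lim_prod a I x g"
        using lim_prod_apply[OF a x g T order_refl touching_subset]
          lim_prod_apply[OF b x g, of ?T] T t touching_subset[of a I g] by simp
    qed
  qed
qed

section \<open>Sparse gate lattices\<close>

text \<open>The translates by distinct elements of \<open>K\<close> of any two gates in \<open>\<Phi>\<close> have disjoint supports. The lattices over \<open>K\<close> of the gates generated by \<open>\<Phi>\<close> then multiply like the gates.\<close>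

definition sparse :: "'g set \<Rightarrow> (('g \<Rightarrow> 's) \<Rightarrow> 'g \<Rightarrow> 's) set \<Rightarrow> bool" where
  "sparse K \<Phi> \<longleftrightarrow> finite_index_normal G K \<and>
     (\<exists>D. finite D \<and> D \<subseteq> carrier G \<and> separates G K D \<and> (\<forall>\<phi>\<in>\<Phi>. supported_in D \<phi>))"

lemma for_deep_sparse:
  assumes "residually_finite G" "finite \<Phi>" "\<Phi> \<subseteq> gates G \<Sigma> X"
  shows "for_deep G (\<lambda>K. sparse K \<Phi>)"
proof -
  obtain D where D: "finite D" "D \<subseteq> carrier G" "\<And>\<phi>. \<phi> \<in> \<Phi> \<Longrightarrow> supported_in D \<phi>"
    using gates_common_support[OF assms(2,3)] by metis
  show ?thesis
    by (rule for_deep_mono[OF for_deep_separates[OF assms(1) D(1,2)]]) (use D in \<open>auto simp: sparse_def\<close>)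
qed

lemma sparse_insert_mult:
  assumes "sparse K \<Phi>" "\<phi> \<in> \<Phi>" "\<psi> \<in> \<Phi>" shows "sparse K (insert (\<phi> \<odot> \<psi>) \<Phi>)"
proof -
  obtain D where D: "finite_index_normal G K" "finite D" "D \<subseteq> carrier G" "separates G K D"
    "\<And>\<phi>. \<phi> \<in> \<Phi> \<Longrightarrow> supported_in D \<phi>"
    using assms(1) unfolding sparse_def by metis
  have "supported_in D (\<phi> \<odot> \<psi>)" by (rule supported_in_mult[OF D(5)[OF assms(2)] D(5)[OF assms(3)]])
  then show ?thesis unfolding sparse_def using D by (intro conjI exI[of _ D]) auto
qed

text \<open>The same \<open>K\<close> serves all translates of the gates at once. This gives bounds on the depth of \<open>K\<close> that are uniform in the translation.\<close>

lemma sparse_translate: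
  assumes "sparse K \<Phi>" "g \<in> carrier G" shows "sparse K ((\<lambda>\<phi>. cg \<phi> g) ` \<Phi>)"
proof -
  obtain D where K: "finite_index_normal G K" and D: "finite D" "D \<subseteq> carrier G" "separates G K D"
    "\<And>\<phi>. \<phi> \<in> \<Phi> \<Longrightarrow> supported_in D \<phi>"
    using assms(1) unfolding sparse_def by metis
  have "finite (D #> g)" using D(1) by (auto simp: r_coset_def)
  moreover have "D #> g \<subseteq> carrier G" by (rule r_coset_subset_G[OF D(2) assms(2)])
  moreover have "separates G K (D #> g)"
    by (rule separates_translate[OF finite_index_normalD(1)[OF K] D(3,2) assms(2)])
  moreover have "\<forall>\<psi>\<in>(\<lambda>\<phi>. cg \<phi> g) ` \<Phi>. supported_in (D #> g) \<psi>" using supported_in_cg[OF D(4) assms(2)] by blast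
  ultimately show ?thesis unfolding sparse_def using K by blast
qed

lemma sparse_gates: "sparse K \<Phi> \<Longrightarrow> \<phi> \<in> \<Phi> \<Longrightarrow> \<phi> \<in> gates G \<Sigma> X"
  unfolding sparse_def using gates_iff by blast

text \<open>If \<open>D k\<close> meets \<open>D k'\<close>, then separation forces \<open>k = k'\<close>.\<close>

lemma sparse_cross:
  assumes "sparse K \<Phi>" "\<phi> \<in> \<Phi>" "\<psi> \<in> \<Phi>" and k: "k \<in> K" "k' \<in> K" "k \<noteq> k'"
  shows "cg \<phi> k \<odot> cg \<psi> k' = cg \<psi> k' \<odot> cg \<phi> k"
proof -
  obtain D where K: "finite_index_normal G K" and D: "finite D" "D \<subseteq> carrier G" "separates G K D"
    "\<And>\<phi>. \<phi> \<in> \<Phi> \<Longrightarrow> supported_in D \<phi>"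
    using assms(1) unfolding sparse_def by metis
  note Kn = finite_index_normalD[OF K]
  have kG: "k \<in> carrier G" "k' \<in> carrier G" using k Kn(3) by auto
  have "(D #> k) \<inter> (D #> k') = {}"
  proof (rule ccontr)
    assume "(D #> k) \<inter> (D #> k') \<noteq> {}"
    then obtain d d' where d: "d \<in> D" "d' \<in> D" "d \<otimes> k = d' \<otimes> k'" by (auto simp: r_coset_def)
    then have dG: "d \<in> carrier G" "d' \<in> carrier G" using D(2) by auto
    have "d \<otimes> (k \<otimes> inv k') = (d \<otimes> k) \<otimes> inv k'" using dG kG by (simp add: m_assoc)
    also have "\<dots> = d'" unfolding d(3) using dG kG by (simp add: m_assoc)
    finally have "d \<otimes> (k \<otimes> inv k') = d'" .
    moreover have "k \<otimes> inv k' \<in> K"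
      using k subgroup.m_closed[OF Kn(2)] subgroup.m_inv_closed[OF Kn(2)] by blast
    ultimately have "k \<otimes> inv k' = \<one>" using D(3) d unfolding separates_def by blast
    then show False using k(3) kG inv_solve_right'[of \<one> k k'] by simp
  qed
  then show ?thesis
    by (rule disjoint_support_commute[OF supported_in_cg[OF D(4)[OF assms(2)] kG(1)] supported_in_cg[OF D(4)[OF assms(3)] kG(2)]])
qed

lemma sparse_commutes:
  assumes "sparse K \<Phi>" "\<phi> \<in> \<Phi>" shows "commutes_on G X \<phi> K"
  unfolding commutes_on_def
proof (intro ballI)
  fix s t assume "s \<in> K" "t \<in> K"
  then show "cg \<phi> s \<odot> cg \<phi> t = cg \<phi> t \<odot> cg \<phi> s"
    using sparse_cross[OF assms assms(2), of s t] by (cases "s = t") auto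
qed

lemma sparse_carrier: "sparse K \<Phi> \<Longrightarrow> K \<subseteq> carrier G"
  unfolding sparse_def using finite_index_normalD(3) by blast

lemma sparse_locally_finite:
  assumes "sparse K \<Phi>" "\<phi> \<in> \<Phi>" shows "locally_finite (conj_gate G X \<phi>) K"
  by (rule locally_finite_cg[OF sparse_gates[OF assms] sparse_carrier[OF assms(1)] sparse_commutes[OF assms]])

lemma gp_Homeo:
  assumes "\<phi> \<in> gates G \<Sigma> X" "S \<subseteq> carrier G" "commutes_on G X \<phi> S"
  shows "gp \<phi> S \<in> Homeo G \<Sigma> X"
  unfolding gate_power_eq by (rule lim_prod_Homeo[OF locally_finite_cg[OF assms]])

lemma sparse_gp_mult:
  assumes s: "sparse K \<Phi>" "\<phi> \<in> \<Phi>" "\<psi> \<in> \<Phi>"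
  shows "gp (\<phi> \<odot> \<psi>) K = gp \<phi> K \<odot> gp \<psi> K"
proof -
  note lf = sparse_locally_finite[OF s(1,2)] sparse_locally_finite[OF s(1,3)]
  have B: "\<phi> \<in> Bij X" "\<psi> \<in> Bij X" using sparse_gates[OF s(1)] s gates_Bij by auto
  have cross: "\<And>i j. i \<in> K \<Longrightarrow> j \<in> K \<Longrightarrow> i \<noteq> j \<Longrightarrow> cg \<phi> i \<odot> cg \<psi> j = cg \<psi> j \<odot> cg \<phi> i"
    by (rule sparse_cross[OF s])
  have eq: "cg \<phi> i \<odot> cg \<psi> i = cg (\<phi> \<odot> \<psi>) i" if "i \<in> K" for i
    using cg_mult[OF B] sparse_carrier[OF s(1)] that by auto
  have "lim_prod (conj_gate G X (\<phi> \<odot> \<psi>)) K = lim_prod (\<lambda>i. cg \<phi> i \<odot> cg \<psi> i) K"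
    by (rule lim_prod_cong(2)[OF locally_finite_mult[OF lf cross] eq])
  also have "\<dots> = lim_prod (conj_gate G X \<phi>) K \<odot> lim_prod (conj_gate G X \<psi>) K"
    by (rule lim_prod_mult[OF lf cross])
  finally show ?thesis unfolding gate_power_eq .
qed

lemma sparse_gp_inv:
  assumes s: "sparse K \<Phi>" "\<phi> \<in> \<Phi>"
  shows "gp (binv \<phi>) K = binv (gp \<phi> K)"
proof -
  note lf = sparse_locally_finite[OF s]
  have B: "\<phi> \<in> Bij X" using sparse_gates[OF s] gates_Bij by auto
  have eq: "binv (cg \<phi> i) = cg (binv \<phi>) i" if "i \<in> K" for i
    using cg_inv[OF B] sparse_carrier[OF s(1)] that by auto
  have "lim_prod (conj_gate G X (binv \<phi>)) K = lim_prod (\<lambda>i. binv (cg \<phi> i)) K"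
    by (rule lim_prod_cong(2)[OF locally_finite_inv[OF lf] eq])
  then show ?thesis unfolding gate_power_eq lim_prod_inv[OF lf] .
qed

lemma sparse_gp_commutator:
  assumes s: "sparse K \<Phi>" "{\<phi>, \<psi>, binv \<phi>, binv \<psi>} \<subseteq> \<Phi>"
  shows "gp (\<phi> \<odot> \<psi> \<odot> binv \<phi> \<odot> binv \<psi>) K = gp \<phi> K \<odot> gp \<psi> K \<odot> binv (gp \<phi> K) \<odot> binv (gp \<psi> K)"
    and "commutes_on G X (\<phi> \<odot> \<psi> \<odot> binv \<phi> \<odot> binv \<psi>) K"
proof -
  have m: "\<phi> \<in> \<Phi>" "\<psi> \<in> \<Phi>" "binv \<phi> \<in> \<Phi>" "binv \<psi> \<in> \<Phi>" using s(2) by auto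
  note s1 = sparse_insert_mult[OF s(1) m(1,2)]
  note s2 = sparse_insert_mult[OF s1 insertI1 insertI2[OF m(3)]]
  note s3 = sparse_insert_mult[OF s2 insertI1 insertI2[OF insertI2[OF m(4)]]]
  show "commutes_on G X (\<phi> \<odot> \<psi> \<odot> binv \<phi> \<odot> binv \<psi>) K" by (rule sparse_commutes[OF s3 insertI1])
  show "gp (\<phi> \<odot> \<psi> \<odot> binv \<phi> \<odot> binv \<psi>) K = gp \<phi> K \<odot> gp \<psi> K \<odot> binv (gp \<phi> K) \<odot> binv (gp \<psi> K)"
    unfolding sparse_gp_mult[OF s2 insertI1 insertI2[OF insertI2[OF m(4)]]]
      sparse_gp_mult[OF s1 insertI1 insertI2[OF m(3)]] sparse_gp_mult[OF s(1) m(1,2)]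
      sparse_gp_inv[OF s(1) m(1)] sparse_gp_inv[OF s(1) m(2)] ..
qed

section \<open>Splitting gate lattices along cosets\<close>

text \<open>Translating the gate instead of the index set: \<open>(\<phi>\<^sup>g)\<^sup>K\<close> is the lattice over \<open>g K = K g\<close>.\<close>

lemma gp_coset:
  assumes K: "K \<lhd> G" and g: "g \<in> carrier G" and \<phi>: "\<phi> \<in> gates G \<Sigma> X"
    and c: "commutes_on G X \<phi> (K #> g)"
  shows "commutes_on G X (cg \<phi> g) K" "gp (cg \<phi> g) K = gp \<phi> (K #> g)"
proof -
  have KG: "K \<subseteq> carrier G" using K normal_imp_subgroup subgroup.subset by blast
  have im: "K #> g = (\<lambda>k. g \<otimes> k) ` K" unfolding rcos_eq_lcos[OF K g] l_coset_def by auto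
  have inj: "inj_on (\<lambda>k. g \<otimes> k) K" 
    by (rule inj_on_inverseI[where g = "\<lambda>u. inv g \<otimes> u"]) (use KG g in \<open>auto simp: inv_cancel subset_iff\<close>)
  have eq: "cg \<phi> (g \<otimes> k) = cg (cg \<phi> g) k" if "k \<in> K" for k
    using cg_cg[OF gates_Bij[OF \<phi>] g] that KG by auto
  have KgG: "K #> g \<subseteq> carrier G" by (rule r_coset_subset_G[OF KG g])
  have lf: "locally_finite (conj_gate G X \<phi>) ((\<lambda>k. g \<otimes> k) ` K)"
    using locally_finite_cg[OF \<phi> KgG c] unfolding im .
  note r = lim_prod_reindex[OF lf inj]
  note cg = lim_prod_cong[OF r(1) eq]
  show "commutes_on G X (cg \<phi> g) K"
    unfolding commutes_on_def using locally_finiteD(5)[OF cg(1)] by blast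
  show "gp (cg \<phi> g) K = gp \<phi> (K #> g)" using cg(2) r(2) by (simp add: gate_power_eq im)
qed

lemma commutes_on_mono: "commutes_on G X \<phi> S \<Longrightarrow> T \<subseteq> S \<Longrightarrow> commutes_on G X \<phi> T"
  unfolding commutes_on_def by blast

text \<open>The coset \<open>H g\<close> is a finite disjoint union of cosets \<open>K r\<close>, and the lattice is the product of the corresponding lattices \<open>(\<phi>\<^sup>r)\<^sup>K\<close>.\<close>

lemma gp_coset_decomposition:
  assumes H: "subgroup H G" and g: "g \<in> carrier G" and \<phi>: "\<phi> \<in> gates G \<Sigma> X"
    and c: "commutes_on G X \<phi> (H #> g)" and K: "finite_index_normal G K" "K \<subseteq> H"
    and M: "subgroup M BX"
    and mem: "\<And>r. r \<in> H #> g \<Longrightarrow> commutes_on G X (cg \<phi> r) K \<Longrightarrow> gp (cg \<phi> r) K \<in> M"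
  shows "gp \<phi> (H #> g) \<in> M"
proof -
  note Kn = finite_index_normalD[OF K(1)]
  have HG: "H \<subseteq> carrier G" using H subgroup.subset by blast
  have HgG: "H #> g \<subseteq> carrier G" by (rule r_coset_subset_G[OF HG g])
  let ?C = "(\<lambda>r. K #> r) ` (H #> g)"
  have sub: "K #> r \<subseteq> H #> g" if r: "r \<in> H #> g" for r
  proof
    fix u assume "u \<in> K #> r"
    then obtain k where k: "k \<in> K" "u = k \<otimes> r" by (auto simp: r_coset_def)
    obtain h where h: "h \<in> H" "r = h \<otimes> g" using r by (auto simp: r_coset_def)
    have "u = (k \<otimes> h) \<otimes> g" using k h K(2) HG g by (auto simp: m_assoc subset_iff)
    moreover have "k \<otimes> h \<in> H" using k h K(2) subgroup.m_closed[OF H] by blast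
    ultimately show "u \<in> H #> g" by (auto simp: r_coset_def)
  qed
  have union: "\<Union> ?C = H #> g"
  proof
    show "\<Union> ?C \<subseteq> H #> g" using sub by blast
    show "H #> g \<subseteq> \<Union> ?C" using rcos_self[OF _ Kn(2)] HgG by blast
  qed
  have fin: "finite ?C"
  proof (rule finite_subset)
    show "?C \<subseteq> rcosets K" using HgG rcosetsI[OF Kn(3)] by blast
  qed (rule Kn(4))
  note lf = locally_finite_cg[OF \<phi> HgG c]
  have "lim_prod (conj_gate G X \<phi>) (\<Union> \<D>) \<in> M" if "finite \<D>" "\<D> \<subseteq> ?C" for \<D>
    using that
  proof (induction rule: finite_induct)
    case empty
    have "lim_prod (conj_gate G X \<phi>) {} = bone"
    proof (rule Bij_eqI)
      show "lim_prod (conj_gate G X \<phi>) {} \<in> Bij X"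
        by (rule lim_prod_Bij[OF locally_finite_mono[OF lf]]) simp
      show "lim_prod (conj_gate G X \<phi>) {} x = bone x" if "x \<in> X" for x
        using lim_prod_trivial[of "{}" "conj_gate G X \<phi>" x] that by (simp add: bone_apply)
    qed simp
    then show ?case using subgroup.one_closed[OF M] by simp
  next
    case (insert A \<D>)
    then obtain r where r: "r \<in> H #> g" "A = K #> r" by blast
    have rG: "r \<in> carrier G" using r(1) HgG by blast
    have disj: "A \<inter> \<Union> \<D> = {}"
    proof -
      have "A \<inter> B = {}" if "B \<in> \<D>" for B
      proof -
        have "A \<in> rcosets K" "B \<in> rcosets K"
          using insert.prems that HgG rcosetsI[OF Kn(3)] by blast+
        moreover have "A \<noteq> B" using insert.hyps(2) that by blast
        ultimately show ?thesis using rcos_disjoint[OF Kn(2)] unfolding pairwise_def disjnt_def by blast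
      qed
      then show ?thesis by blast
    qed
    have U: "A \<union> \<Union> \<D> \<subseteq> H #> g" using insert.prems union by blast
    have cA: "commutes_on G X \<phi> (K #> r)" by (rule commutes_on_mono[OF c sub[OF r(1)]])
    note gc = gp_coset[OF Kn(1) rG \<phi> cA]
    have "gp \<phi> A \<in> M" using mem[OF r(1) gc(1)] gc(2) r(2) by simp
    then have "lim_prod (conj_gate G X \<phi>) A \<in> M" unfolding gate_power_eq .
    moreover have "lim_prod (conj_gate G X \<phi>) (\<Union> \<D>) \<in> M" using insert by blast
    ultimately show ?case
      using lim_prod_union[OF locally_finite_mono[OF lf U] disj] subgroup.m_closed[OF M] by simp
  qed
  from this[OF fin order_refl] show ?thesis unfolding union gate_power_eq .
qed

section \<open>The stabilized automorphism group\<close>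

text \<open>Passing to the normal core, the defining subgroup may be taken normal.\<close>

lemma SAut_iff:
  "f \<in> SAut G \<Sigma> X \<longleftrightarrow> f \<in> Homeo G \<Sigma> X \<and> (\<exists>K. finite_index_normal G K \<and> (\<forall>k\<in>K. shift_map k \<odot> f = f \<odot> shift_map k))"
proof -
  have eq: "shift_map k \<odot> f = f \<odot> shift_map k \<longleftrightarrow> (\<forall>x\<in>X. f (shift G k x) = shift G k (f x))"
    if f: "f \<in> Homeo G \<Sigma> X" and k: "k \<in> carrier G" for f k
  proof -
    have B: "f \<in> Bij X" "shift_map k \<in> Bij X" using f k Homeo_Bij shift_map_Bij by auto
    have 1: "(shift_map k \<odot> f) x = shift G k (f x)" "(f \<odot> shift_map k) x = f (shift G k x)" if "x \<in> X" for x
      using that B by (simp_all add: bmult_apply shift_map_apply Bij_mem)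
    show ?thesis
    proof
      assume "shift_map k \<odot> f = f \<odot> shift_map k"
      then show "\<forall>x\<in>X. f (shift G k x) = shift G k (f x)" using 1 by metis
    next
      assume "\<forall>x\<in>X. f (shift G k x) = shift G k (f x)"
      then show "shift_map k \<odot> f = f \<odot> shift_map k" by (intro Bij_eqI) (use B 1 in simp_all)
    qed
  qed
  show ?thesis
  proof
    assume "f \<in> SAut G \<Sigma> X"
    then obtain H where H: "finite_index G H" "f \<in> Homeo G \<Sigma> X"
      "\<And>h x. h \<in> H \<Longrightarrow> x \<in> X \<Longrightarrow> f (shift G h x) = shift G h (f x)"
      unfolding SAut_def Aut_def by blast
    obtain K where K: "finite_index_normal G K" "K \<subseteq> H" using normal_core[OF H(1)] by blast
    have "shift_map k \<odot> f = f \<odot> shift_map k" if k: "k \<in> K" for k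
      using eq[OF H(2), of k] H(3)[of k] K k finite_index_normalD(3)[OF K(1)] by blast
    then show "f \<in> Homeo G \<Sigma> X \<and> (\<exists>K. finite_index_normal G K \<and> (\<forall>k\<in>K. shift_map k \<odot> f = f \<odot> shift_map k))"
      using H(2) K(1) by blast
  next
    assume "f \<in> Homeo G \<Sigma> X \<and> (\<exists>K. finite_index_normal G K \<and> (\<forall>k\<in>K. shift_map k \<odot> f = f \<odot> shift_map k))"
    then obtain K where f: "f \<in> Homeo G \<Sigma> X" and K: "finite_index_normal G K"
      "\<And>k. k \<in> K \<Longrightarrow> shift_map k \<odot> f = f \<odot> shift_map k" by blast
    have "f \<in> Aut G \<Sigma> X K"
      unfolding Aut_def using f eq[OF f] K(2) finite_index_normalD(3)[OF K(1)] by blast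
    then show "f \<in> SAut G \<Sigma> X" unfolding SAut_def using finite_index_normalD(5)[OF K(1)] by blast
  qed
qed

lemma SAut_Homeo: "f \<in> SAut G \<Sigma> X \<Longrightarrow> f \<in> Homeo G \<Sigma> X"
  using SAut_iff by blast

lemma subgroup_SAut: "subgroup (SAut G \<Sigma> X) BX"
proof (rule BX.subgroupI)
  show "SAut G \<Sigma> X \<subseteq> Bij X" using SAut_Homeo Homeo_Bij by blast
  have "bone \<in> SAut G \<Sigma> X"
    unfolding SAut_iff
    using Homeo_one finite_index_normal_carrier shift_map_Bij by (intro conjI exI[of _ "carrier G"]) simp_all
  then show "SAut G \<Sigma> X \<noteq> {}" by blast
  fix f assume f: "f \<in> SAut G \<Sigma> X"
  obtain K where K: "finite_index_normal G K" "\<And>k. k \<in> K \<Longrightarrow> shift_map k \<odot> f = f \<odot> shift_map k"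
    using f unfolding SAut_iff by blast
  have fB: "f \<in> Homeo G \<Sigma> X" "f \<in> Bij X" using f SAut_Homeo Homeo_Bij by auto
  have shB: "shift_map k \<in> Bij X" if "k \<in> K" for k using that finite_index_normalD(3)[OF K(1)] shift_map_Bij by blast
  have "shift_map k \<odot> binv f = binv f \<odot> shift_map k" if "k \<in> K" for k
    by (rule BX.commute_inv[OF shB[OF that] fB(2) K(2)[OF that]])
  then show "binv f \<in> SAut G \<Sigma> X" unfolding SAut_iff using Homeo_inv[OF fB(1)] K(1) by blast
  fix f' assume f': "f' \<in> SAut G \<Sigma> X"
  obtain K' where K': "finite_index_normal G K'" "\<And>k. k \<in> K' \<Longrightarrow> shift_map k \<odot> f' = f' \<odot> shift_map k"
    using f' unfolding SAut_iff by blast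
  have f'B: "f' \<in> Homeo G \<Sigma> X" "f' \<in> Bij X" using f' SAut_Homeo Homeo_Bij by auto
  have "shift_map k \<odot> (f \<odot> f') = (f \<odot> f') \<odot> shift_map k" if k: "k \<in> K" "k \<in> K'" for k
  proof -
    have "shift_map k \<odot> (f \<odot> f') = (shift_map k \<odot> f) \<odot> f'" using shB[OF k(1)] fB f'B by (simp add: BX.m_assoc)
    also have "\<dots> = f \<odot> (shift_map k \<odot> f')" unfolding K(2)[OF k(1)] using shB[OF k(1)] fB f'B by (simp add: BX.m_assoc)
    also have "\<dots> = (f \<odot> f') \<odot> shift_map k" unfolding K'(2)[OF k(2)] using shB[OF k(1)] fB f'B by (simp add: BX.m_assoc)
    finally show ?thesis .
  qed
  then show "f \<odot> f' \<in> SAut G \<Sigma> X"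
    unfolding SAut_iff using Homeo_mult[OF fB(1) f'B(1)] finite_index_normal_Int[OF K(1) K'(1)] by blast
qed

text \<open>If \<open>f\<close> commutes with the shifts in \<open>K\<close> and \<open>R\<close> represents the cosets of \<open>K\<close>, then \<open>f x\<close> at \<open>r \<otimes> k\<close> is determined by \<open>x\<close> on \<open>D k\<close>, where \<open>D\<close> is a window for the coordinates in \<open>R\<close>. Only finitely many of these translates of \<open>D\<close> meet \<open>N\<close>.\<close>

lemma SAut_spreads:
  assumes f: "f \<in> SAut G \<Sigma> X" shows "spreads f"
  unfolding spreads_def
proof (intro allI impI)
  fix N assume N: "finite N \<and> N \<subseteq> carrier G"
  obtain K where K: "finite_index_normal G K" "\<And>k. k \<in> K \<Longrightarrow> shift_map k \<odot> f = f \<odot> shift_map k"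
    using f unfolding SAut_iff by blast
  have fB: "f \<in> Homeo G \<Sigma> X" "f \<in> Bij X" "local_map f" using f SAut_Homeo Homeo_iff by auto
  have KG: "K \<subseteq> carrier G" using finite_index_normalD(3)[OF K(1)] .
  obtain R where R: "finite R" "R \<subseteq> carrier G" "\<And>g. g \<in> carrier G \<Longrightarrow> \<exists>r\<in>R. \<exists>k\<in>K. g = r \<otimes> k"
    using coset_representatives[OF K(1)] by metis
  obtain D where D: "finite D" "D \<subseteq> carrier G"
    "\<And>x y. x \<in> X \<Longrightarrow> y \<in> X \<Longrightarrow> agree D x y \<Longrightarrow> agree R (f x) (f y)"
    using local_map_finite[OF fB(3) R(1,2)] by metis
  define N' where "N' = (\<lambda>(r, d, n). r \<otimes> (inv d \<otimes> n)) ` (R \<times> D \<times> N)"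
  have N': "finite N'" "N' \<subseteq> carrier G"
  proof -
    show "finite N'" unfolding N'_def using R D N by (intro finite_imageI finite_cartesian_product) auto
    show "N' \<subseteq> carrier G" unfolding N'_def using R(2) D(2) N by (auto simp: subset_iff)
  qed
  have "agree (carrier G - N') (f x) (f y)" if xy: "x \<in> X" "y \<in> X" "agree (carrier G - N) x y" for x y
    unfolding agree_def
  proof
    fix g assume g: "g \<in> carrier G - N'"
    obtain r k where r: "r \<in> R" "k \<in> K" "g = r \<otimes> k" using R(3) g by blast
    have rG: "r \<in> carrier G" "k \<in> carrier G" using r R(2) KG by auto
    have val: "f z g = f (shift G k z) r" if z: "z \<in> X" for z
    proof -
      have "(shift_map k \<odot> f) z r = (f \<odot> shift_map k) z r" using K(2)[OF r(2)] by simp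
      then show ?thesis
        using z fB(2) rG r(3) shift_map_Bij[OF rG(2)] by (simp add: bmult_apply shift_map_apply Bij_mem shift_apply)
    qed
    have "agree D (shift G k x) (shift G k y)"
      unfolding agree_def
    proof
      fix d assume d: "d \<in> D"
      then have dG: "d \<in> carrier G" using D(2) by blast
      have "d \<otimes> k \<notin> N"
      proof
        assume n: "d \<otimes> k \<in> N"
        have "g = r \<otimes> (inv d \<otimes> (d \<otimes> k))" using r(3) rG dG by (simp add: inv_cancel)
        moreover have "r \<otimes> (inv d \<otimes> (d \<otimes> k)) \<in> N'"
          unfolding N'_def by (rule image_eqI[of _ _ "(r, d, d \<otimes> k)"]) (use r d n in auto)
        ultimately show False using g by simp
      qed
      then show "shift G k x d = shift G k y d" using xy(3) dG rG by (simp add: shift_apply agree_def)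
    qed
    then have "agree R (f (shift G k x)) (f (shift G k y))"
      by (rule D(3)[OF shift_mem[OF rG(2) xy(1)] shift_mem[OF rG(2) xy(2)]])
    then show "f x g = f y g" using val[OF xy(1)] val[OF xy(2)] r(1) by (simp add: agree_def)
  qed
  then show "\<exists>N'. finite N' \<and> N' \<subseteq> carrier G \<and> (\<forall>x\<in>X. \<forall>y\<in>X. agree (carrier G - N) x y \<longrightarrow>
      agree (carrier G - N') (f x) (f y))" using N' by (intro exI[of _ N']) blast
qed

lemma cg_conj_commute:
  assumes f: "f \<in> Bij X" and k: "k \<in> carrier G" "shift_map k \<odot> f = f \<odot> shift_map k" and \<phi>: "\<phi> \<in> Bij X"
  shows "cg (f \<odot> \<phi> \<odot> binv f) k = f \<odot> cg \<phi> k \<odot> binv f"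
proof -
  have s: "shift_map k \<in> Bij X" by (rule shift_map_Bij[OF k(1)])
  have 1: "binv (shift_map k) \<odot> f = f \<odot> binv (shift_map k)" by (rule BX.commute_inv[OF f s k(2)[symmetric], symmetric])
  have 2: "shift_map k \<odot> binv f = binv f \<odot> shift_map k" by (rule BX.commute_inv[OF s f k(2)])
  have "cg (f \<odot> \<phi> \<odot> binv f) k = binv (shift_map k) \<odot> (f \<odot> \<phi> \<odot> binv f) \<odot> shift_map k"
    by (rule cg_eq) (use f \<phi> k in simp_all)
  also have "\<dots> = (binv (shift_map k) \<odot> f) \<odot> \<phi> \<odot> (binv f \<odot> shift_map k)" using s f \<phi> by (simp add: BX.m_assoc)
  also have "\<dots> = (f \<odot> binv (shift_map k)) \<odot> \<phi> \<odot> (shift_map k \<odot> binv f)" unfolding 1 2 ..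
  also have "\<dots> = f \<odot> (binv (shift_map k) \<odot> \<phi> \<odot> shift_map k) \<odot> binv f" using s f \<phi> by (simp add: BX.m_assoc)
  also have "\<dots> = f \<odot> cg \<phi> k \<odot> binv f" using cg_eq[OF \<phi> k(1)] by simp
  finally show ?thesis .
qed

lemma gp_conj:
  assumes f: "f \<in> Homeo G \<Sigma> X" "spreads f" and K: "K \<subseteq> carrier G" "\<And>k. k \<in> K \<Longrightarrow> shift_map k \<odot> f = f \<odot> shift_map k"
    and \<phi>: "\<phi> \<in> gates G \<Sigma> X" and c: "commutes_on G X \<phi> K"
  shows "commutes_on G X (f \<odot> \<phi> \<odot> binv f) K"
    and "gp (f \<odot> \<phi> \<odot> binv f) K = f \<odot> gp \<phi> K \<odot> binv f"
proof -
  have B: "f \<in> Bij X" "\<phi> \<in> Bij X" using f \<phi> Homeo_Bij gates_Bij by auto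
  let ?\<psi> = "f \<odot> \<phi> \<odot> binv f"
  have \<psi>: "?\<psi> \<in> gates G \<Sigma> X" by (rule gates_conj[OF f \<phi>])
  have eq: "cg ?\<psi> k = f \<odot> cg \<phi> k \<odot> binv f" if "k \<in> K" for k
    by (rule cg_conj_commute[OF B(1) subsetD[OF K(1) that] K(2)[OF that] B(2)])
  note lf = locally_finite_cg[OF \<phi> K(1) c]
  have "commuting (conj_gate G X ?\<psi>) K"
    using commuting_conj[OF locally_finiteD(3)[OF lf] B(1)]
      commuting_cong[of K "conj_gate G X ?\<psi>" "\<lambda>k. f \<odot> cg \<phi> k \<odot> binv f"] eq by blast
  then show c': "commutes_on G X ?\<psi> K" unfolding commuting_def commutes_on_def by blast
  note lf' = locally_finite_cg[OF \<psi> K(1) c']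
  note cg = lim_prod_cong[OF lf' eq]
  have "f \<odot> lim_prod (conj_gate G X \<phi>) K \<odot> binv f = lim_prod (\<lambda>k. f \<odot> cg \<phi> k \<odot> binv f) K"
    by (rule lim_prod_conj[OF lf f(1) cg(1)])
  then show "gp ?\<psi> K = f \<odot> gp \<phi> K \<odot> binv f" unfolding gate_power_eq using cg(2) by simp
qed

text \<open>Conjugation by the shift by \<open>k \<in> K\<close> permutes the translates of the gate by the elements of \<open>K\<close>.\<close>

lemma gp_SAut:
  assumes K: "finite_index_normal G K" and \<phi>: "\<phi> \<in> gates G \<Sigma> X" and c: "commutes_on G X \<phi> K"
  shows "gp \<phi> K \<in> SAut G \<Sigma> X"
proof -
  note Kn = finite_index_normalD[OF K]
  note lf = locally_finite_cg[OF \<phi> Kn(3) c]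
  have B: "\<phi> \<in> Bij X" "gp \<phi> K \<in> Bij X" using gates_Bij[OF \<phi>] lim_prod_Bij[OF lf] by (auto simp: gate_power_eq)
  have "shift_map k \<odot> gp \<phi> K = gp \<phi> K \<odot> shift_map k" if k: "k \<in> K" for k
  proof -
    have kG: "k \<in> carrier G" and s: "shift_map k \<in> Bij X" "shift_map k \<in> Homeo G \<Sigma> X" using k Kn(3) shift_map_Bij shift_map_Homeo by auto
    have im: "(\<lambda>i. i \<otimes> inv k) ` K = K"
    proof
      show "(\<lambda>i. i \<otimes> inv k) ` K \<subseteq> K"
        using subgroup.m_closed[OF Kn(2)] subgroup.m_inv_closed[OF Kn(2) k] by blast
      show "K \<subseteq> (\<lambda>i. i \<otimes> inv k) ` K"
      proof
        fix i assume i: "i \<in> K"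
        have "i = (i \<otimes> k) \<otimes> inv k" using i k Kn(3) by (auto simp: m_assoc subset_iff)
        then show "i \<in> (\<lambda>i. i \<otimes> inv k) ` K" using subgroup.m_closed[OF Kn(2) i k] by blast
      qed
    qed
    have inj: "inj_on (\<lambda>i. i \<otimes> inv k) K" using kG Kn(3) by (intro inj_onI) (auto simp: subset_iff)
    have lf': "locally_finite (conj_gate G X \<phi>) ((\<lambda>i. i \<otimes> inv k) ` K)" using lf unfolding im .
    note r = lim_prod_reindex[OF lf' inj]
    have eq: "cg \<phi> (i \<otimes> inv k) = shift_map k \<odot> cg \<phi> i \<odot> binv (shift_map k)" if "i \<in> K" for i
    proof -
      have iG: "i \<in> carrier G" using that Kn(3) by blast
      have "cg \<phi> (i \<otimes> inv k) = cg (cg \<phi> i) (inv k)" using cg_cg[OF B(1) iG] kG by simp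
      also have "\<dots> = shift_map k \<odot> cg \<phi> i \<odot> binv (shift_map k)" using cg_eq_conj[OF cg_Bij[OF B(1) iG]] kG by simp
      finally show ?thesis .
    qed
    note cg = lim_prod_cong[OF r(1) eq]
    have "shift_map k \<odot> lim_prod (conj_gate G X \<phi>) K \<odot> binv (shift_map k) = lim_prod (\<lambda>i. shift_map k \<odot> cg \<phi> i \<odot> binv (shift_map k)) K"
      by (rule lim_prod_conj[OF lf s(2) cg(1)])
    also have "\<dots> = lim_prod (conj_gate G X \<phi>) K" using cg(2) r(2) im by simp
    finally have e: "shift_map k \<odot> gp \<phi> K \<odot> binv (shift_map k) = gp \<phi> K" unfolding gate_power_eq .
    have "shift_map k \<odot> gp \<phi> K = (shift_map k \<odot> gp \<phi> K \<odot> binv (shift_map k)) \<odot> shift_map k" using s B by (simp add: BX.m_assoc)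
    then show ?thesis unfolding e .
  qed
  then show ?thesis unfolding SAut_iff using lim_prod_Homeo[OF lf] K by (auto simp: gate_power_eq)
qed

end

lemma (in group) normal_in_subgroup_iff:
  assumes M: "subgroup M G"
  shows "N \<lhd> G\<lparr>carrier := M\<rparr> \<longleftrightarrow> subgroup N G \<and> N \<subseteq> M \<and> (\<forall>m\<in>M. \<forall>n\<in>N. m \<otimes> n \<otimes> inv m \<in> N)"
proof -
  interpret M: group "G\<lparr>carrier := M\<rparr>" by (rule subgroup_imp_group[OF M])
  have "subgroup N (G\<lparr>carrier := M\<rparr>) \<longleftrightarrow> subgroup N G \<and> N \<subseteq> M"
    using incl_subgroup[OF M] subgroup_incl[OF _ M] subgroup.subset[of N "G\<lparr>carrier := M\<rparr>"] by auto
  then show ?thesis unfolding M.normal_inv_iff using m_inv_consistent[OF M] by auto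
qed

lemma (in group) inv_commutator:
  assumes "x \<in> carrier G" "y \<in> carrier G"
  shows "inv (x \<otimes> y \<otimes> inv x \<otimes> inv y) = y \<otimes> x \<otimes> inv y \<otimes> inv x"
  using assms by (simp add: inv_mult_group m_assoc)

section \<open>The groups generated by gate lattices\<close>

locale residually_finite_subshift = subshift_space G \<Sigma> X
  for G :: "('g, 'm) monoid_scheme" (structure) and \<Sigma> :: "'s set" and X :: "('g \<Rightarrow> 's) set" +
  assumes rf: "residually_finite G"
begin

lemma lattices_mem:
  assumes "\<psi> \<in> \<Gamma>" "finite_index_normal G K" "commutes_on G X \<psi> K"
  shows "gp \<psi> K \<in> lattices_of G \<Sigma> X \<Gamma>"
proof -
  have "K #> \<one> = K" using finite_index_normalD(3)[OF assms(2)] by (rule coset_mult_one)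
  then show ?thesis
    unfolding lattices_of_def using assms finite_index_normalD(5)[OF assms(2)]
    by (intro CollectI exI[of _ \<psi>] exI[of _ K] exI[of _ \<one>]) simp
qed

text \<open>Only lattices over deep normal subgroups need to be checked.\<close>

lemma lattices_subset_subgroup:
  assumes "\<Gamma> \<subseteq> gates G \<Sigma> X" "subgroup M BX"
    and deep: "\<And>\<phi>. \<phi> \<in> \<Gamma> \<Longrightarrow>
      for_deep G (\<lambda>K. \<forall>r\<in>carrier G. commutes_on G X (cg \<phi> r) K \<longrightarrow> gp (cg \<phi> r) K \<in> M)"
  shows "lattices_of G \<Sigma> X \<Gamma> \<subseteq> M"
proof
  fix l assume "l \<in> lattices_of G \<Sigma> X \<Gamma>"
  then obtain \<phi> H g where l: "l = gp \<phi> (H #> g)" and \<phi>: "\<phi> \<in> \<Gamma>" and H: "finite_index G H"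
    and g: "g \<in> carrier G" and c: "commutes_on G X \<phi> (H #> g)"
    unfolding lattices_of_def by blast
  have sH: "subgroup H G" using H by (simp add: finite_index_def)
  have "for_deep G (\<lambda>K. K \<subseteq> H \<and>
      (\<forall>r\<in>carrier G. commutes_on G X (cg \<phi> r) K \<longrightarrow> gp (cg \<phi> r) K \<in> M))"
    by (rule for_deep_conj[OF for_deep_subset[OF H] deep[OF \<phi>]])
  then obtain K where K: "finite_index_normal G K" "K \<subseteq> H"
    "\<And>r. r \<in> carrier G \<Longrightarrow> commutes_on G X (cg \<phi> r) K \<Longrightarrow> gp (cg \<phi> r) K \<in> M"
    by (rule for_deep_obtain) blast
  have HgG: "H #> g \<subseteq> carrier G" by (rule r_coset_subset_G[OF subgroup.subset[OF sH] g])
  have \<phi>g: "\<phi> \<in> gates G \<Sigma> X" using \<phi> assms(1) by blast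
  show "l \<in> M"
    unfolding l by (rule gp_coset_decomposition[OF sH g \<phi>g c K(1,2) assms(2)]) (use K(3) HgG in blast)
qed

lemma gate_lattices_SAut: "gate_lattices G \<Sigma> X \<subseteq> SAut G \<Sigma> X"
  unfolding gate_lattices_def
proof (rule lattices_subset_subgroup[OF order_refl subgroup_SAut])
  fix \<phi> assume "\<phi> \<in> gates G \<Sigma> X"
  then show "for_deep G (\<lambda>K. \<forall>r\<in>carrier G. commutes_on G X (cg \<phi> r) K \<longrightarrow> gp (cg \<phi> r) K \<in> SAut G \<Sigma> X)"
    by (intro for_deep_True ballI impI gp_SAut cg_gates)
qed

lemma even_gate_lattices_subset: "even_gate_lattices G \<Sigma> X \<subseteq> gate_lattices G \<Sigma> X"
  unfolding even_gate_lattices_def gate_lattices_def lattices_of_def using even_gates_subset by blast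

lemma SAut_Bij: "f \<in> SAut G \<Sigma> X \<Longrightarrow> f \<in> Bij X"
  using SAut_Homeo Homeo_Bij by blast

lemma gate_lattices_Bij: "gate_lattices G \<Sigma> X \<subseteq> Bij X"
  using gate_lattices_SAut SAut_Bij by blast

lemma even_gate_lattices_Bij: "even_gate_lattices G \<Sigma> X \<subseteq> Bij X"
  using even_gate_lattices_subset gate_lattices_Bij by blast

lemma subgroup_L: "subgroup (L G \<Sigma> X) BX"
  unfolding L_def by (rule BX.generate_is_subgroup[OF gate_lattices_Bij])

lemma subgroup_L_even: "subgroup (L_even G \<Sigma> X) BX"
  unfolding L_even_def by (rule BX.generate_is_subgroup[OF even_gate_lattices_Bij])

lemma L_SAut: "L G \<Sigma> X \<subseteq> SAut G \<Sigma> X"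
  unfolding L_def by (rule BX.generate_subgroup_incl[OF gate_lattices_SAut subgroup_SAut])

lemma L_even_subset_L: "L_even G \<Sigma> X \<subseteq> L G \<Sigma> X"
  unfolding L_def L_even_def by (rule BX.mono_generate[OF even_gate_lattices_subset])

lemma L_Bij: "L G \<Sigma> X \<subseteq> Bij X"
  using L_SAut SAut_Bij by blast

lemma gp_in_L:
  assumes "\<psi> \<in> gates G \<Sigma> X" "finite_index_normal G K" "commutes_on G X \<psi> K"
  shows "gp \<psi> K \<in> L G \<Sigma> X"
  using lattices_mem[OF assms] unfolding L_def gate_lattices_def by (rule generate.incl)

lemma gp_in_L_even:
  assumes "\<psi> \<in> even_gates G \<Sigma> X" "finite_index_normal G K" "commutes_on G X \<psi> K"
  shows "gp \<psi> K \<in> L_even G \<Sigma> X"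
  using lattices_mem[OF assms] unfolding L_even_def even_gate_lattices_def by (rule generate.incl)

section \<open>Normality in the stabilized automorphism group\<close>

text \<open>The conjugate of \<open>(\<phi>\<^sup>r)\<^sup>K\<close> by \<open>f\<close> is the lattice over \<open>K\<close> of the conjugate of \<open>\<phi>\<^sup>r\<close>, once \<open>f\<close> commutes with the shifts in \<open>K\<close>. Stated for a class \<open>\<Gamma>\<close> of gates in order to cover gates and even gates at once.\<close>

lemma lattices_normalized:
  assumes \<Gamma>: "\<Gamma> \<subseteq> gates G \<Sigma> X" "\<And>\<phi> g. \<phi> \<in> \<Gamma> \<Longrightarrow> g \<in> carrier G \<Longrightarrow> cg \<phi> g \<in> \<Gamma>"
    "\<And>\<phi> f. \<phi> \<in> \<Gamma> \<Longrightarrow> f \<in> SAut G \<Sigma> X \<Longrightarrow> f \<odot> \<phi> \<odot> binv f \<in> \<Gamma>"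
    and f: "f \<in> SAut G \<Sigma> X" and x: "x \<in> generate BX (lattices_of G \<Sigma> X \<Gamma>)"
  shows "f \<odot> x \<odot> binv f \<in> generate BX (lattices_of G \<Sigma> X \<Gamma>)"
proof -
  let ?M = "generate BX (lattices_of G \<Sigma> X \<Gamma>)"
  have sub: "lattices_of G \<Sigma> X \<Gamma> \<subseteq> Bij X"
    using gate_lattices_Bij \<Gamma>(1) unfolding gate_lattices_def lattices_of_def by blast
  have fB: "f \<in> Bij X" "f \<in> Homeo G \<Sigma> X" "spreads f" using f SAut_Bij SAut_Homeo SAut_spreads by auto
  obtain K0 where K0: "finite_index_normal G K0" "\<And>k. k \<in> K0 \<Longrightarrow> shift_map k \<odot> f = f \<odot> shift_map k"
    using f unfolding SAut_iff by blast
  let ?N = "{x \<in> Bij X. f \<odot> x \<odot> binv f \<in> ?M}"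
  have sN: "subgroup ?N BX" by (rule BX.conj_closed_subgroup[OF BX.generate_is_subgroup[OF sub] fB(1)])
  have "lattices_of G \<Sigma> X \<Gamma> \<subseteq> ?N"
  proof (rule lattices_subset_subgroup[OF \<Gamma>(1) sN])
    fix \<phi> assume \<phi>: "\<phi> \<in> \<Gamma>"
    have "gp (cg \<phi> r) K \<in> ?N"
      if K: "finite_index_normal G K" "K \<subseteq> K0" and r: "r \<in> carrier G" and c: "commutes_on G X (cg \<phi> r) K" for K r
    proof -
      have \<psi>: "cg \<phi> r \<in> \<Gamma>" "cg \<phi> r \<in> gates G \<Sigma> X" using \<Gamma>(1,2) \<phi> r by auto
      note KG = finite_index_normalD(3)[OF K(1)]
      have K0': "shift_map k \<odot> f = f \<odot> shift_map k" if "k \<in> K" for k using K0(2) K(2) that by blast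
      note gc = gp_conj[OF fB(2,3) KG K0' \<psi>(2) c]
      have "gp (f \<odot> cg \<phi> r \<odot> binv f) K \<in> ?M"
        by (rule generate.incl[OF lattices_mem[OF \<Gamma>(3)[OF \<psi>(1) f] K(1) gc(1)]])
      then have "f \<odot> gp (cg \<phi> r) K \<odot> binv f \<in> ?M" by (simp only: gc(2))
      moreover have "gp (cg \<phi> r) K \<in> Bij X" using gp_Homeo[OF \<psi>(2) KG c] Homeo_Bij by blast
      ultimately show ?thesis by simp
    qed
    then show "for_deep G (\<lambda>K. \<forall>r\<in>carrier G. commutes_on G X (cg \<phi> r) K \<longrightarrow> gp (cg \<phi> r) K \<in> ?N)"
      unfolding for_deep_def using K0(1) by blast
  qed
  then have "x \<in> ?N" by (rule BX.generate_induct_subgroup[OF sN _ x])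
  then show ?thesis by simp
qed

lemma L_normalized: "f \<in> SAut G \<Sigma> X \<Longrightarrow> x \<in> L G \<Sigma> X \<Longrightarrow> f \<odot> x \<odot> binv f \<in> L G \<Sigma> X"
  unfolding L_def gate_lattices_def
  by (rule lattices_normalized[OF order_refl cg_gates gates_conj[OF SAut_Homeo SAut_spreads]])

lemma L_even_normalized: "f \<in> SAut G \<Sigma> X \<Longrightarrow> x \<in> L_even G \<Sigma> X \<Longrightarrow> f \<odot> x \<odot> binv f \<in> L_even G \<Sigma> X"
  unfolding L_even_def even_gate_lattices_def
  by (rule lattices_normalized[OF even_gates_subset cg_even even_gates_conj[OF SAut_Homeo SAut_spreads]])

section \<open>Gates whose deep lattices lie in a subgroup\<close>

text \<open>The bound on the depth of \<open>K\<close> must be uniform in \<open>k \<in> K0\<close>: a lattice over \<open>H g\<close> splits into lattices over \<open>K\<close> of more and more translates as \<open>K\<close> gets deeper. Finitely many translates outside \<open>K0\<close> are harmless.\<close>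

definition deep_gates where
  "deep_gates M K0 = {\<phi> \<in> gates G \<Sigma> X. for_deep G (\<lambda>K. \<forall>k\<in>K0. gp (cg \<phi> k) K \<in> M)}"

lemma deep_gatesI:
  assumes \<phi>: "\<phi> \<in> gates G \<Sigma> X" and P: "for_deep G P" and \<Phi>: "finite \<Phi>" "\<Phi> \<subseteq> gates G \<Sigma> X"
    and mem: "\<And>K k. finite_index_normal G K \<Longrightarrow> P K \<Longrightarrow> k \<in> K0 \<Longrightarrow> sparse K ((\<lambda>\<phi>. cg \<phi> k) ` \<Phi>) \<Longrightarrow> gp (cg \<phi> k) K \<in> M"
    and K0: "K0 \<subseteq> carrier G"
  shows "\<phi> \<in> deep_gates M K0"
proof -
  have "for_deep G (\<lambda>K. P K \<and> sparse K \<Phi>)" by (rule for_deep_conj[OF P for_deep_sparse[OF rf \<Phi>]])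
  then have "for_deep G (\<lambda>K. \<forall>k\<in>K0. gp (cg \<phi> k) K \<in> M)"
    by (rule for_deep_mono) (use mem sparse_translate K0 in blast)
  then show ?thesis using \<phi> by (simp add: deep_gates_def)
qed

lemma deep_gates_mult:
  assumes M: "subgroup M BX" and K0: "K0 \<subseteq> carrier G"
    and a: "\<phi> \<in> deep_gates M K0" and b: "\<psi> \<in> deep_gates M K0"
  shows "\<phi> \<odot> \<psi> \<in> deep_gates M K0"
proof -
  have g: "\<phi> \<in> gates G \<Sigma> X" "\<psi> \<in> gates G \<Sigma> X" using a b by (auto simp: deep_gates_def)
  have P: "for_deep G (\<lambda>K. (\<forall>k\<in>K0. gp (cg \<phi> k) K \<in> M) \<and> (\<forall>k\<in>K0. gp (cg \<psi> k) K \<in> M))"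
    by (rule for_deep_conj) (use a b in \<open>auto simp: deep_gates_def\<close>)
  show ?thesis
  proof (rule deep_gatesI[OF gates_mult[OF g] P, of "{\<phi>, \<psi>}"])
    fix K k assume H: "(\<forall>k\<in>K0. gp (cg \<phi> k) K \<in> M) \<and> (\<forall>k\<in>K0. gp (cg \<psi> k) K \<in> M)" and k: "k \<in> K0"
      and s: "sparse K ((\<lambda>\<phi>. cg \<phi> k) ` {\<phi>, \<psi>})"
    have "gp (cg \<phi> k \<odot> cg \<psi> k) K = gp (cg \<phi> k) K \<odot> gp (cg \<psi> k) K" by (rule sparse_gp_mult[OF s]) auto
    moreover have "cg (\<phi> \<odot> \<psi>) k = cg \<phi> k \<odot> cg \<psi> k" using cg_mult gates_Bij g k K0 by blast
    ultimately show "gp (cg (\<phi> \<odot> \<psi>) k) K \<in> M" using H k subgroup.m_closed[OF M] by simp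
  qed (use g K0 in auto)
qed

lemma deep_gates_inv:
  assumes M: "subgroup M BX" and K0: "K0 \<subseteq> carrier G" and a: "\<phi> \<in> deep_gates M K0"
  shows "binv \<phi> \<in> deep_gates M K0"
proof -
  have g: "\<phi> \<in> gates G \<Sigma> X" using a by (auto simp: deep_gates_def)
  have P: "for_deep G (\<lambda>K. \<forall>k\<in>K0. gp (cg \<phi> k) K \<in> M)" using a by (auto simp: deep_gates_def)
  show ?thesis
  proof (rule deep_gatesI[OF gates_inv[OF g] P, of "{\<phi>}"])
    fix K k assume H: "\<forall>k\<in>K0. gp (cg \<phi> k) K \<in> M" and k: "k \<in> K0" and s: "sparse K ((\<lambda>\<phi>. cg \<phi> k) ` {\<phi>})"
    have "gp (binv (cg \<phi> k)) K = binv (gp (cg \<phi> k) K)" by (rule sparse_gp_inv[OF s]) auto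
    moreover have "cg (binv \<phi>) k = binv (cg \<phi> k)" using cg_inv gates_Bij g k K0 by blast
    ultimately show "gp (cg (binv \<phi>) k) K \<in> M" using H k subgroup.m_inv_closed[OF M] by simp
  qed (use g K0 in auto)
qed

lemma deep_gates_conj:
  assumes M: "subgroup M BX" and K0: "K0 \<subseteq> carrier G"
    and norm: "\<And>x n. x \<in> L_even G \<Sigma> X \<Longrightarrow> n \<in> M \<Longrightarrow> x \<odot> n \<odot> binv x \<in> M"
    and a: "\<phi> \<in> deep_gates M K0" and \<psi>: "\<psi> \<in> even_gates G \<Sigma> X"
  shows "\<psi> \<odot> \<phi> \<odot> binv \<psi> \<in> deep_gates M K0"
proof -
  have g: "\<phi> \<in> gates G \<Sigma> X" "\<psi> \<in> gates G \<Sigma> X" "binv \<psi> \<in> gates G \<Sigma> X"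
    using a \<psi> even_gates_subset gates_inv by (auto simp: deep_gates_def)
  have P: "for_deep G (\<lambda>K. \<forall>k\<in>K0. gp (cg \<phi> k) K \<in> M)" using a by (auto simp: deep_gates_def)
  show ?thesis
  proof (rule deep_gatesI[OF gates_mult[OF gates_mult[OF g(2,1)] g(3)] P, of "{\<phi>, \<psi>, binv \<psi>}"])
    fix K k assume H: "\<forall>k\<in>K0. gp (cg \<phi> k) K \<in> M" and k: "k \<in> K0" and K: "finite_index_normal G K"
      and s: "sparse K ((\<lambda>\<phi>. cg \<phi> k) ` {\<phi>, \<psi>, binv \<psi>})"
    let ?S = "(\<lambda>\<phi>. cg \<phi> k) ` {\<phi>, \<psi>, binv \<psi>}"
    have kG: "k \<in> carrier G" using k K0 by blast
    have m: "cg \<phi> k \<in> ?S" "cg \<psi> k \<in> ?S" "cg (binv \<psi>) k \<in> ?S" by auto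
    have e1: "cg (\<psi> \<odot> \<phi> \<odot> binv \<psi>) k = cg \<psi> k \<odot> cg \<phi> k \<odot> cg (binv \<psi>) k"
      using cg_mult[OF _ _ kG] gates_Bij[OF g(1)] gates_Bij[OF g(2)] by simp
    have e2: "gp (cg \<psi> k \<odot> cg \<phi> k \<odot> cg (binv \<psi>) k) K =
        gp (cg \<psi> k) K \<odot> gp (cg \<phi> k) K \<odot> gp (cg (binv \<psi>) k) K"
      using sparse_gp_mult[OF sparse_insert_mult[OF s m(2,1)] insertI1 insertI2[OF m(3)]]
        sparse_gp_mult[OF s m(2,1)] by simp
    have e3: "gp (cg (binv \<psi>) k) K = binv (gp (cg \<psi> k) K)"
      using sparse_gp_inv[OF s m(2)] cg_inv[OF gates_Bij[OF g(2)] kG] by simp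
    have "gp (cg (\<psi> \<odot> \<phi> \<odot> binv \<psi>) k) K = gp (cg \<psi> k) K \<odot> gp (cg \<phi> k) K \<odot> binv (gp (cg \<psi> k) K)"
      by (simp only: e1 e2 e3)
    moreover have "gp (cg \<psi> k) K \<in> L_even G \<Sigma> X"
      by (rule gp_in_L_even[OF cg_even[OF \<psi> kG] K sparse_commutes[OF s m(2)]])
    ultimately show "gp (cg (\<psi> \<odot> \<phi> \<odot> binv \<psi>) k) K \<in> M" using norm H k by simp
  qed (use g K0 in auto)
qed

text \<open>Every translate of \<open>\<phi>\<close> is a translate by an element of \<open>K0\<close> of one of finitely many fixed translates of \<open>\<phi>\<close>, so one bound on the depth of \<open>K\<close> serves them all.\<close>

lemma L_even_subset_if_deep:
  assumes M: "subgroup M BX" and K0: "finite_index_normal G K0"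
    and all: "even_gates G \<Sigma> X \<subseteq> deep_gates M K0"
  shows "L_even G \<Sigma> X \<subseteq> M"
proof -
  have "even_gate_lattices G \<Sigma> X \<subseteq> M"
    unfolding even_gate_lattices_def
  proof (rule lattices_subset_subgroup[OF even_gates_subset M])
    fix \<phi> assume \<phi>: "\<phi> \<in> even_gates G \<Sigma> X"
    then have \<phi>B: "\<phi> \<in> Bij X" using even_gates_subset gates_Bij by blast
    obtain R where R: "finite R" "R \<subseteq> carrier G" "\<And>g. g \<in> carrier G \<Longrightarrow> \<exists>r\<in>R. \<exists>k\<in>K0. g = r \<otimes> k"
      using coset_representatives[OF K0] by metis
    have "for_deep G (\<lambda>K. \<forall>r\<in>R. \<forall>k\<in>K0. gp (cg (cg \<phi> r) k) K \<in> M)"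
    proof (rule for_deep_ball[OF R(1)])
      fix r assume "r \<in> R"
      then have "cg \<phi> r \<in> deep_gates M K0" using cg_even[OF \<phi>] R(2) all by blast
      then show "for_deep G (\<lambda>K. \<forall>k\<in>K0. gp (cg (cg \<phi> r) k) K \<in> M)" by (simp add: deep_gates_def)
    qed
    then show "for_deep G (\<lambda>K. \<forall>r\<in>carrier G. commutes_on G X (cg \<phi> r) K \<longrightarrow> gp (cg \<phi> r) K \<in> M)"
    proof (rule for_deep_mono, intro ballI impI)
      fix K g assume H: "\<forall>r\<in>R. \<forall>k\<in>K0. gp (cg (cg \<phi> r) k) K \<in> M" and g: "g \<in> carrier G"
      obtain r k where r: "r \<in> R" "k \<in> K0" "g = r \<otimes> k" using R(3)[OF g] by blast
      have "cg (cg \<phi> r) k = cg \<phi> g"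
        using cg_cg[OF \<phi>B, of r k] r R(2) finite_index_normalD(3)[OF K0] by blast
      then show "gp (cg \<phi> g) K \<in> M" using H r by metis
    qed
  qed
  then show ?thesis unfolding L_even_def by (rule BX.generate_subgroup_incl[OF _ M])
qed

text \<open>For deep \<open>K\<close> the lattice of a commutator of gates is the commutator of their lattices.\<close>

lemma commutator_deep_derived:
  assumes g: "\<phi> \<in> gates G \<Sigma> X" "\<psi> \<in> gates G \<Sigma> X"
  shows "\<phi> \<odot> \<psi> \<odot> binv \<phi> \<odot> binv \<psi> \<in> deep_gates (derived BX (L G \<Sigma> X)) (carrier G)"
proof -
  have gi: "binv \<phi> \<in> gates G \<Sigma> X" "binv \<psi> \<in> gates G \<Sigma> X" using g gates_inv by auto
  note gB = gates_Bij[OF g(1)] gates_Bij[OF g(2)]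
  show ?thesis
  proof (rule deep_gatesI[OF gates_mult[OF gates_mult[OF gates_mult[OF g] gi(1)] gi(2)] for_deep_True[of "\<lambda>_. True"],
        of "{\<phi>, \<psi>, binv \<phi>, binv \<psi>}"])
    fix K k assume K: "finite_index_normal G K" and k: "k \<in> carrier G"
      and s: "sparse K ((\<lambda>\<phi>. cg \<phi> k) ` {\<phi>, \<psi>, binv \<phi>, binv \<psi>})"
    let ?S = "(\<lambda>\<phi>. cg \<phi> k) ` {\<phi>, \<psi>, binv \<phi>, binv \<psi>}"
    let ?a = "cg \<phi> k" and ?b = "cg \<psi> k"
    have inv: "cg (binv \<phi>) k = binv ?a" "cg (binv \<psi>) k = binv ?b" using cg_inv gB k by auto
    have S: "{?a, ?b, binv ?a, binv ?b} \<subseteq> ?S" unfolding inv[symmetric] by auto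
    have "cg (\<phi> \<odot> \<psi> \<odot> binv \<phi> \<odot> binv \<psi>) k = ?a \<odot> ?b \<odot> binv ?a \<odot> binv ?b"
      using cg_mult[OF _ _ k] gB by (simp add: inv)
    then have e: "gp (cg (\<phi> \<odot> \<psi> \<odot> binv \<phi> \<odot> binv \<psi>) k) K = gp ?a K \<odot> gp ?b K \<odot> binv (gp ?a K) \<odot> binv (gp ?b K)"
      using sparse_gp_commutator(1)[OF s S] by simp
    have mem: "gp ?a K \<in> L G \<Sigma> X" "gp ?b K \<in> L G \<Sigma> X"
      using gp_in_L[OF cg_gates[OF g(1) k] K sparse_commutes[OF s]] gp_in_L[OF cg_gates[OF g(2) k] K sparse_commutes[OF s]]
      by auto
    show "gp (cg (\<phi> \<odot> \<psi> \<odot> binv \<phi> \<odot> binv \<psi>) k) K \<in> derived BX (L G \<Sigma> X)"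
      unfolding e derived_def by (rule generate.incl) (use mem in blast)
  qed (use g gi in auto)
qed

text \<open>Here \<open>[f, \<phi>]\<^sup>K = [f, \<phi>\<^sup>K]\<close>, and the right-hand side lies in \<open>M\<close>. This also holds for the translates by \<open>k \<in> K0\<close>, because \<open>f\<close> commutes with the shift by \<open>k\<close>.\<close>

lemma commutator_with_element_deep:
  assumes M: "subgroup M BX"
    and norm: "\<And>x n. x \<in> L_even G \<Sigma> X \<Longrightarrow> n \<in> M \<Longrightarrow> x \<odot> n \<odot> binv x \<in> M"
    and f: "f \<in> M" "f \<in> SAut G \<Sigma> X" and K0: "finite_index_normal G K0" "\<And>k. k \<in> K0 \<Longrightarrow> shift_map k \<odot> f = f \<odot> shift_map k"
    and \<phi>: "\<phi> \<in> even_gates G \<Sigma> X"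
  shows "f \<odot> \<phi> \<odot> binv f \<odot> binv \<phi> \<in> deep_gates M K0"
proof -
  have fB: "f \<in> Bij X" "f \<in> Homeo G \<Sigma> X" "spreads f" using f SAut_Bij SAut_Homeo SAut_spreads by auto
  have g: "\<phi> \<in> gates G \<Sigma> X" using \<phi> even_gates_subset by blast
  have g': "f \<odot> \<phi> \<odot> binv f \<in> gates G \<Sigma> X" "binv \<phi> \<in> gates G \<Sigma> X" using gates_conj[OF fB(2,3) g] gates_inv[OF g] .
  note gB = gates_Bij[OF g]
  have P: "for_deep G (\<lambda>K. K \<subseteq> K0)" using K0(1) unfolding for_deep_def by blast
  show ?thesis
  proof (rule deep_gatesI[OF gates_mult[OF g'] P, of "{\<phi>, f \<odot> \<phi> \<odot> binv f, binv \<phi>}"])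
    fix K k assume K: "finite_index_normal G K" "K \<subseteq> K0" and k: "k \<in> K0"
      and s: "sparse K ((\<lambda>\<phi>. cg \<phi> k) ` {\<phi>, f \<odot> \<phi> \<odot> binv f, binv \<phi>})"
    let ?S = "(\<lambda>\<phi>. cg \<phi> k) ` {\<phi>, f \<odot> \<phi> \<odot> binv f, binv \<phi>}"
    have kG: "k \<in> carrier G" using k finite_index_normalD(3)[OF K0(1)] by blast
    have m: "cg \<phi> k \<in> ?S" "cg (f \<odot> \<phi> \<odot> binv f) k \<in> ?S" "cg (binv \<phi>) k \<in> ?S" by auto
    let ?l = "gp (cg \<phi> k) K"
    have c: "commutes_on G X (cg \<phi> k) K" by (rule sparse_commutes[OF s m(1)])
    have l: "?l \<in> L_even G \<Sigma> X" by (rule gp_in_L_even[OF cg_even[OF \<phi> kG] K(1) c])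
    have lB: "?l \<in> Bij X" using l L_even_subset_L L_Bij by blast
    have K0': "shift_map k \<odot> f = f \<odot> shift_map k" if "k \<in> K" for k using K0(2) K(2) that by blast
    have "gp (cg (f \<odot> \<phi> \<odot> binv f) k) K = gp (f \<odot> cg \<phi> k \<odot> binv f) K"
      using cg_conj_commute[OF fB(1) kG K0(2)[OF k] gB] by simp
    also have "\<dots> = f \<odot> ?l \<odot> binv f"
      by (rule gp_conj(2)[OF fB(2,3) finite_index_normalD(3)[OF K(1)] K0' cg_gates[OF g kG] c])
    finally have e1: "gp (cg (f \<odot> \<phi> \<odot> binv f) k) K = f \<odot> ?l \<odot> binv f" .
    have e2: "gp (cg (binv \<phi>) k) K = binv ?l" using sparse_gp_inv[OF s m(1)] cg_inv[OF gB kG] by simp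
    have "cg (f \<odot> \<phi> \<odot> binv f \<odot> binv \<phi>) k = cg (f \<odot> \<phi> \<odot> binv f) k \<odot> cg (binv \<phi>) k"
      using cg_mult[OF gates_Bij[OF g'(1)] gates_Bij[OF g'(2)] kG] by simp
    then have "gp (cg (f \<odot> \<phi> \<odot> binv f \<odot> binv \<phi>) k) K = (f \<odot> ?l \<odot> binv f) \<odot> binv ?l"
      using sparse_gp_mult[OF s m(2,3)] e1 e2 by simp
    also have "\<dots> = f \<odot> (?l \<odot> binv f \<odot> binv ?l)" using fB lB by (simp add: BX.m_assoc)
    finally show "gp (cg (f \<odot> \<phi> \<odot> binv f \<odot> binv \<phi>) k) K \<in> M"
      using subgroup.m_closed[OF M f(1) norm[OF l subgroup.m_inv_closed[OF M f(1)]]] by simp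
  qed (use g g' finite_index_normalD(3)[OF K0(1)] in auto)
qed

section \<open>Commutators of gate lattices\<close>

lemma gp_translate_invariant:
  assumes K: "finite_index_normal G K" and k: "k \<in> K" and \<phi>: "\<phi> \<in> gates G \<Sigma> X" and c: "commutes_on G X \<phi> K"
  shows "gp (cg \<phi> k) K = gp \<phi> K"
proof -
  note Kn = finite_index_normalD[OF K]
  have kG: "k \<in> carrier G" using k Kn(3) by blast
  have e: "K #> k = K" by (rule coset_join2[OF kG Kn(2) k])
  show ?thesis using gp_coset(2)[OF Kn(1) kG \<phi>] c unfolding e by blast
qed

text \<open>Suppose that \<open>K\<close> separates \<open>D \<union> D D\<^sup>-\<^sup>1 D\<close>, where \<open>D\<close> supports both gates. If no translate of \<open>\<phi>\<^sup>r\<close> by \<open>K\<close> overlaps one of \<open>\<psi>\<^sup>r\<^sup>'\<close>, then the two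
lattices commute. Otherwise replace \<open>r'\<close> by another point \<open>r1\<close> of its coset such that \<open>D r\<close> and \<open>D r1\<close> meet; then \<open>r1 \<in> D\<^sup>-\<^sup>1 D r\<close>, so both gates are
supported in a translate of \<open>D \<union> D D\<^sup>-\<^sup>1 D\<close>, and the commutator of the lattices is the lattice of the commutator.\<close>

lemma commutator_of_lattices_even:
  assumes g: "\<phi> \<in> gates G \<Sigma> X" "\<psi> \<in> gates G \<Sigma> X"
  shows "for_deep G (\<lambda>K. \<forall>r\<in>carrier G. \<forall>r'\<in>carrier G.
    gp (cg \<phi> r) K \<odot> gp (cg \<psi> r') K \<odot> binv (gp (cg \<phi> r) K) \<odot> binv (gp (cg \<psi> r') K) \<in> L_even G \<Sigma> X)"
proof -
  have gi: "binv \<phi> \<in> gates G \<Sigma> X" "binv \<psi> \<in> gates G \<Sigma> X" using g gates_inv by auto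
  note gB = gates_Bij[OF g(1)] gates_Bij[OF g(2)]
  let ?\<Phi> = "{\<phi>, \<psi>, binv \<phi>, binv \<psi>}"
  obtain D where D: "finite D" "D \<subseteq> carrier G" "\<And>\<xi>. \<xi> \<in> ?\<Phi> \<Longrightarrow> supported_in D \<xi>"
    by (rule gates_common_support[of ?\<Phi>]) (use g gi in auto)
  \<comment> \<open>The set \<open>D \<union> D D\<^sup>-\<^sup>1 D\<close>.\<close>
  define E where "E = D \<union> (\<lambda>(d, d', d''). d \<otimes> (inv d' \<otimes> d'')) ` (D \<times> D \<times> D)"
  have E: "finite E" "E \<subseteq> carrier G" "D \<subseteq> E"
    using D(1,2) by (auto simp: E_def subset_iff)
  show ?thesis
  proof (rule for_deep_mono[OF for_deep_separates[OF rf E(1,2)]], intro ballI)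
    fix K r r' assume K: "finite_index_normal G K" and sep: "separates G K E"
      and r: "r \<in> carrier G" and r': "r' \<in> carrier G"
    note Kn = finite_index_normalD[OF K]
    have s0: "sparse K ?\<Phi>"
      unfolding sparse_def using K D separates_mono[OF sep E(3)] by blast
    let ?A = "gp (cg \<phi> r) K" and ?B = "gp (cg \<psi> r') K"
    have sr: "sparse K ((\<lambda>\<xi>. cg \<xi> r) ` ?\<Phi>)" "sparse K ((\<lambda>\<xi>. cg \<xi> r') ` ?\<Phi>)"
      using sparse_translate[OF s0] r r' by auto
    have lf: "locally_finite (conj_gate G X (cg \<phi> r)) K" "locally_finite (conj_gate G X (cg \<psi> r')) K"
      using sparse_locally_finite[OF sr(1), of "cg \<phi> r"] sparse_locally_finite[OF sr(2), of "cg \<psi> r'"] by auto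
    show "?A \<odot> ?B \<odot> binv ?A \<odot> binv ?B \<in> L_even G \<Sigma> X"
    proof (cases "\<exists>k\<in>K. (D #> r) \<inter> (D #> (r' \<otimes> k)) \<noteq> {}")
      case True
      then obtain k d1 d2 where k: "k \<in> K" and d: "d1 \<in> D" "d2 \<in> D" "d1 \<otimes> r = d2 \<otimes> (r' \<otimes> k)"
        by (auto simp: r_coset_def)
      define r1 where "r1 = r' \<otimes> k"
      have kG: "k \<in> carrier G" using k Kn(3) by blast
      have dG: "d1 \<in> carrier G" "d2 \<in> carrier G" using d D(2) by auto
      have r1: "r1 \<in> carrier G" using r' kG by (simp add: r1_def)
      have "r1 = inv d2 \<otimes> (d2 \<otimes> r1)" using dG r1 by (simp add: inv_cancel)
      then have r1eq: "r1 = inv d2 \<otimes> (d1 \<otimes> r)" using d(3) by (simp add: r1_def)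
      have ErG: "finite (E #> r)" "E #> r \<subseteq> carrier G"
        using E r_coset_subset_G[OF E(2) r] by (auto simp: r_coset_def)
      have Dr: "D #> r \<subseteq> E #> r" using E(3) by (auto simp: r_coset_def)
      have Dr1: "D #> r1 \<subseteq> E #> r"
      proof
        fix u assume "u \<in> D #> r1"
        then obtain d0 where d0: "d0 \<in> D" "u = d0 \<otimes> r1" by (auto simp: r_coset_def)
        have "d0 \<in> carrier G" using d0 D(2) by blast
        then have "u = (d0 \<otimes> (inv d2 \<otimes> d1)) \<otimes> r" using d0(2) r1eq dG r by (simp add: m_assoc)
        moreover have "d0 \<otimes> (inv d2 \<otimes> d1) \<in> E"
          unfolding E_def by (rule UnI2, rule image_eqI[of _ _ "(d0, d2, d1)"]) (use d0 d in auto)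
        ultimately show "u \<in> E #> r" by (auto simp: r_coset_def)
      qed
      have sepEr: "separates G K (E #> r)" by (rule separates_translate[OF Kn(1) sep E(2) r])
      let ?a = "cg \<phi> r" and ?b = "cg \<psi> r1"
      have inv: "binv ?a = cg (binv \<phi>) r" "binv ?b = cg (binv \<psi>) r1" using cg_inv gB r r1 by auto
      have supp: "supported_in (E #> r) (cg \<xi> r)" "supported_in (E #> r) (cg \<xi> r1)" if "\<xi> \<in> ?\<Phi>" for \<xi>
        using supported_in_mono[OF supported_in_cg[OF D(3)[OF that] r] Dr ErG]
          supported_in_mono[OF supported_in_cg[OF D(3)[OF that] r1] Dr1 ErG] .
      have s: "sparse K {?a, ?b, binv ?a, binv ?b}"
        unfolding sparse_def using K ErG sepEr supp unfolding inv by blast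
      have cb: "commutes_on G X (cg \<psi> r') K" by (rule sparse_commutes[OF sr(2)]) simp
      have "?B = gp (cg (cg \<psi> r') k) K" by (rule gp_translate_invariant[OF K k cg_gates[OF g(2) r'] cb, symmetric])
      then have B: "?B = gp ?b K" using cg_cg[OF gB(2) r' kG] by (simp add: r1_def)
      note sc = sparse_gp_commutator[OF s order_refl]
      have "gp (?a \<odot> ?b \<odot> binv ?a \<odot> binv ?b) K \<in> L_even G \<Sigma> X"
        by (rule gp_in_L_even[OF even_commutator[OF cg_gates[OF g(1) r] cg_gates[OF g(2) r1]] K sc(2)])
      then show ?thesis unfolding sc(1) B .
    next
      case False
      have comm: "cg (cg \<phi> r) k \<odot> cg (cg \<psi> r') k' = cg (cg \<psi> r') k' \<odot> cg (cg \<phi> r) k" if k: "k \<in> K" "k' \<in> K" for k k'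
      proof -
        have kG: "k \<in> carrier G" "k' \<in> carrier G" using k Kn(3) by auto
        have "(D #> (r \<otimes> k)) \<inter> (D #> (r' \<otimes> k')) = {}"
        proof (rule ccontr)
          assume "(D #> (r \<otimes> k)) \<inter> (D #> (r' \<otimes> k')) \<noteq> {}"
          then obtain d1 d2 where d: "d1 \<in> D" "d2 \<in> D" "d1 \<otimes> (r \<otimes> k) = d2 \<otimes> (r' \<otimes> k')" by (auto simp: r_coset_def)
          have dG: "d1 \<in> carrier G" "d2 \<in> carrier G" using d D(2) by auto
          have "d1 \<otimes> r = (d1 \<otimes> (r \<otimes> k)) \<otimes> inv k" using dG kG r by (simp add: m_assoc)
          also have "\<dots> = d2 \<otimes> (r' \<otimes> (k' \<otimes> inv k))" unfolding d(3) using dG kG r' by (simp add: m_assoc)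
          finally have eq: "d1 \<otimes> r = d2 \<otimes> (r' \<otimes> (k' \<otimes> inv k))" .
          have "d1 \<otimes> r \<in> D #> r" using d(1) by (auto simp: r_coset_def)
          moreover have "d1 \<otimes> r \<in> D #> (r' \<otimes> (k' \<otimes> inv k))"
            unfolding eq using d(2) by (auto simp: r_coset_def)
          ultimately have "d1 \<otimes> r \<in> (D #> r) \<inter> (D #> (r' \<otimes> (k' \<otimes> inv k)))" by blast
          moreover have "k' \<otimes> inv k \<in> K"
            using k subgroup.m_closed[OF Kn(2)] subgroup.m_inv_closed[OF Kn(2)] by blast
          ultimately show False using False by blast
        qed
        moreover have "supported_in (D #> (r \<otimes> k)) (cg \<phi> (r \<otimes> k))" "supported_in (D #> (r' \<otimes> k')) (cg \<psi> (r' \<otimes> k'))"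
          using supported_in_cg[OF D(3)] r r' kG by auto
        ultimately have "cg \<phi> (r \<otimes> k) \<odot> cg \<psi> (r' \<otimes> k') = cg \<psi> (r' \<otimes> k') \<odot> cg \<phi> (r \<otimes> k)"
          using disjoint_support_commute by blast
        then show ?thesis using cg_cg[OF gB(1) r kG(1)] cg_cg[OF gB(2) r' kG(2)] by simp
      qed
      have AB: "?A \<in> Bij X" "?B \<in> Bij X" using lim_prod_Bij[OF lf(1)] lim_prod_Bij[OF lf(2)] by (simp_all add: gate_power_eq)
      have "?A \<odot> ?B = ?B \<odot> ?A" unfolding gate_power_eq by (rule lim_prod_commute[OF lf comm])
      then have "?A \<odot> ?B \<odot> binv ?A \<odot> binv ?B = bone" using AB by (simp add: BX.m_assoc)
      then show ?thesis using subgroup.one_closed[OF subgroup_L_even] by simp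
    qed
  qed
qed

text \<open>Modulo the normal subgroup of even lattices all generators commute. For two given lattices this is checked on the factors over a common deep \<open>K\<close>.\<close>

lemma derived_L_subset: "derived BX (L G \<Sigma> X) \<subseteq> L_even G \<Sigma> X"
proof -
  let ?L = "L G \<Sigma> X" and ?E = "L_even G \<Sigma> X"
  let ?c = "\<lambda>x y. x \<odot> y \<odot> binv x \<odot> binv y"
  have norm: "h \<odot> n \<odot> binv h \<in> ?E" if "h \<in> ?L" "n \<in> ?E" for h n
    using L_even_normalized that L_SAut by blast
  have sg: "subgroup {x \<in> ?L. ?c x y \<in> ?E} BX" if "y \<in> ?L" for y
    by (rule BX.centralizing_mod_subgroup[OF subgroup_L_even L_Bij subgroup_L _ norm]) (use that L_Bij in auto)
  have swap: "?c y x \<in> ?E" if "?c x y \<in> ?E" "x \<in> ?L" "y \<in> ?L" for x y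
  proof -
    have "binv (?c x y) \<in> ?E" using subgroup.m_inv_closed[OF subgroup_L_even that(1)] .
    moreover have "x \<in> Bij X" "y \<in> Bij X" using that L_Bij by auto
    ultimately show ?thesis by (simp only: BX.inv_commutator)
  qed
  have lattices: "?c a b \<in> ?E" if ab: "a \<in> gate_lattices G \<Sigma> X" "b \<in> gate_lattices G \<Sigma> X" for a b
  proof -
    obtain \<phi> H g where a: "a = gp \<phi> (H #> g)" and \<phi>: "\<phi> \<in> gates G \<Sigma> X" and H: "finite_index G H"
      and g: "g \<in> carrier G" and ca: "commutes_on G X \<phi> (H #> g)"
      using ab(1) unfolding gate_lattices_def lattices_of_def by blast
    obtain \<psi> H' g' where b: "b = gp \<psi> (H' #> g')" and \<psi>: "\<psi> \<in> gates G \<Sigma> X" and H': "finite_index G H'"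
      and g': "g' \<in> carrier G" and cb: "commutes_on G X \<psi> (H' #> g')"
      using ab(2) unfolding gate_lattices_def lattices_of_def by blast
    have sH: "subgroup H G" "subgroup H' G" using H H' by (auto simp: finite_index_def)
    have HG: "H #> g \<subseteq> carrier G" "H' #> g' \<subseteq> carrier G"
      using r_coset_subset_G[OF subgroup.subset[OF sH(1)] g] r_coset_subset_G[OF subgroup.subset[OF sH(2)] g'] .
    have aL: "a \<in> ?L" unfolding L_def by (rule generate.incl[OF ab(1)])
    have "for_deep G (\<lambda>K. (K \<subseteq> H \<and> K \<subseteq> H') \<and> (\<forall>r\<in>carrier G. \<forall>r'\<in>carrier G. ?c (gp (cg \<phi> r) K) (gp (cg \<psi> r') K) \<in> ?E))"
      by (rule for_deep_conj[OF for_deep_conj[OF for_deep_subset[OF H] for_deep_subset[OF H']] commutator_of_lattices_even[OF \<phi> \<psi>]])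
    then obtain K where K: "finite_index_normal G K" "K \<subseteq> H" "K \<subseteq> H'"
      "\<And>r r'. r \<in> carrier G \<Longrightarrow> r' \<in> carrier G \<Longrightarrow> ?c (gp (cg \<phi> r) K) (gp (cg \<psi> r') K) \<in> ?E"
      by (rule for_deep_obtain) blast
    have "b \<in> {y \<in> ?L. ?c y a \<in> ?E}"
      unfolding b
    proof (rule gp_coset_decomposition[OF sH(2) g' \<psi> cb K(1,3) sg[OF aL]])
      fix r' assume r': "r' \<in> H' #> g'" and c': "commutes_on G X (cg \<psi> r') K"
      have r'G: "r' \<in> carrier G" using r' HG by blast
      have yL: "gp (cg \<psi> r') K \<in> ?L" by (rule gp_in_L[OF cg_gates[OF \<psi> r'G] K(1) c'])
      have "a \<in> {x \<in> ?L. ?c x (gp (cg \<psi> r') K) \<in> ?E}"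
        unfolding a
      proof (rule gp_coset_decomposition[OF sH(1) g \<phi> ca K(1,2) sg[OF yL]])
        fix r assume r: "r \<in> H #> g" and c: "commutes_on G X (cg \<phi> r) K"
        have rG: "r \<in> carrier G" using r HG by blast
        show "gp (cg \<phi> r) K \<in> {x \<in> ?L. ?c x (gp (cg \<psi> r') K) \<in> ?E}"
          using gp_in_L[OF cg_gates[OF \<phi> rG] K(1) c] K(4)[OF rG r'G] by blast
      qed
      then show "gp (cg \<psi> r') K \<in> {y \<in> ?L. ?c y a \<in> ?E}" using swap yL aL by blast
    qed
    then show ?thesis using swap aL by blast
  qed
  have gen: "gate_lattices G \<Sigma> X \<subseteq> ?L" unfolding L_def by (rule subsetI, rule generate.incl)
  have 1: "?c x b \<in> ?E" if x: "x \<in> ?L" and b: "b \<in> gate_lattices G \<Sigma> X" for x b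
  proof -
    have bL: "b \<in> ?L" using gen b by blast
    have "gate_lattices G \<Sigma> X \<subseteq> {x \<in> ?L. ?c x b \<in> ?E}" using gen lattices b by blast
    then have "x \<in> {x \<in> ?L. ?c x b \<in> ?E}"
      by (rule BX.generate_induct_subgroup[OF sg[OF bL] _ x[unfolded L_def]])
    then show ?thesis by simp
  qed
  have 2: "?c y x \<in> ?E" if x: "x \<in> ?L" and y: "y \<in> ?L" for x y
  proof -
    have "gate_lattices G \<Sigma> X \<subseteq> {y \<in> ?L. ?c y x \<in> ?E}" using gen swap[OF 1[OF x]] x by blast
    then have "y \<in> {y \<in> ?L. ?c y x \<in> ?E}"
      by (rule BX.generate_induct_subgroup[OF sg[OF x] _ y[unfolded L_def]])
    then show ?thesis by simp
  qed
  show ?thesis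
    unfolding derived_def by (rule BX.generate_subgroup_incl[OF _ subgroup_L_even]) (use 2 in blast)
qed

end

section \<open>Local permutations of an SFT\<close>

locale sft_space = residually_finite_subshift G \<Sigma> X
  for G :: "('g, 'm) monoid_scheme" (structure) and \<Sigma> :: "'s set" and X :: "('g \<Rightarrow> 's) set" +
  assumes sft: "SFT G \<Sigma> X"
begin

lemma shift_one_extensional: "c \<in> carrier G \<rightarrow>\<^sub>E \<Sigma> \<Longrightarrow> shift G \<one> c = c"
  by (auto simp: shift_def fun_eq_iff PiE_iff extensional_def)

text \<open>A configuration is in \<open>X\<close> as soon as each of its windows occurs in \<open>X\<close> at the same position.\<close>

lemma SFT_window:
  obtains W where "finite W" "W \<subseteq> carrier G"
    "\<And>z. z \<in> carrier G \<rightarrow>\<^sub>E \<Sigma> \<Longrightarrow> (\<And>g. g \<in> carrier G \<Longrightarrow> \<exists>x\<in>X. \<forall>w\<in>W. z (w \<otimes> g) = x (w \<otimes> g)) \<Longrightarrow> z \<in> X"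
proof -
  let ?T = "full_shift G \<Sigma>"
  obtain C where C: "openin ?T C" "closedin ?T C" and X: "X = (\<Inter>g\<in>carrier G. shift G g ` C)"
    using sft unfolding SFT_def by blast
  have top: "topspace ?T = carrier G \<rightarrow>\<^sub>E \<Sigma>" by (rule topspace_full_shift)
  have CT: "C \<subseteq> carrier G \<rightarrow>\<^sub>E \<Sigma>" using closedin_subset[OF C(2)] top by simp
  have cl: "closedin ?T (carrier G \<rightarrow>\<^sub>E \<Sigma>)" unfolding top[symmetric] by (rule closedin_topspace)
  have op: "openin ?T ((carrier G \<rightarrow>\<^sub>E \<Sigma>) - C)"
    using openin_diff[OF openin_topspace C(2)] unfolding top .
  have "openin (subtopology ?T (carrier G \<rightarrow>\<^sub>E \<Sigma>)) C" "openin (subtopology ?T (carrier G \<rightarrow>\<^sub>E \<Sigma>)) ((carrier G \<rightarrow>\<^sub>E \<Sigma>) - C)"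
    unfolding openin_subtopology using C(1) op CT by blast+
  then obtain W where W: "finite W" "W \<subseteq> carrier G"
    "\<And>x y. x \<in> carrier G \<rightarrow>\<^sub>E \<Sigma> \<Longrightarrow> y \<in> carrier G \<rightarrow>\<^sub>E \<Sigma> \<Longrightarrow> agree W x y \<Longrightarrow> x \<in> C \<longleftrightarrow> y \<in> C"
    using clopen_finite_window[OF finite_alphabet cl] by metis
  have shPi: "shift G g z \<in> carrier G \<rightarrow>\<^sub>E \<Sigma>" if "g \<in> carrier G" "z \<in> carrier G \<rightarrow>\<^sub>E \<Sigma>" for g z
    using that by (auto simp: shift_def PiE_iff)
  show thesis
  proof (rule that[OF W(1,2)])
    fix z assume z: "z \<in> carrier G \<rightarrow>\<^sub>E \<Sigma>"
      and H: "\<And>g. g \<in> carrier G \<Longrightarrow> \<exists>x\<in>X. \<forall>w\<in>W. z (w \<otimes> g) = x (w \<otimes> g)"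
    have "z \<in> shift G g ` C" if g: "g \<in> carrier G" for g
    proof -
      have gi: "inv g \<in> carrier G" using g by simp
      obtain x where x: "x \<in> X" "\<And>w. w \<in> W \<Longrightarrow> z (w \<otimes> inv g) = x (w \<otimes> inv g)" using H[OF gi] by blast
      have "x \<in> shift G g ` C" using x(1) X g by blast
      then obtain c where c: "c \<in> C" "x = shift G g c" by blast
      have "shift G (inv g) x = c"
        using c CT g by (auto simp: shift_shift shift_one_extensional)
      moreover have "agree W (shift G (inv g) x) (shift G (inv g) z)"
        using x(2) W(2) by (auto simp: agree_def shift_apply)
      ultimately have "shift G (inv g) z \<in> C"
        using W(3)[OF shPi[OF gi X_config[OF x(1)]] shPi[OF gi z]] c(1) by simp
      moreover have "z = shift G g (shift G (inv g) z)"
        using g z by (simp add: shift_shift shift_one_extensional)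
      ultimately show ?thesis by blast
    qed
    then show "z \<in> X" unfolding X by blast
  qed
qed

text \<open>The frame \<open>M - N\<close> is thick enough for the contents of \<open>N\<close> to be exchanged between configurations that agree on it.\<close>

definition exchangeable :: "'g set \<Rightarrow> 'g set \<Rightarrow> bool" where
  "exchangeable N M \<longleftrightarrow> finite M \<and> N \<subseteq> M \<and> M \<subseteq> carrier G \<and>
     (\<forall>x\<in>X. \<forall>y\<in>X. agree (M - N) x y \<longrightarrow> (\<lambda>g. if g \<in> N then x g else y g) \<in> X)"

text \<open>Let \<open>M\<close> contain every translate of the window that meets \<open>N\<close>. Each window of the exchanged configuration is then a window of \<open>x\<close> if it meets \<open>N\<close>, and a window of \<open>y\<close> otherwise.\<close>

lemma exchangeable_exists:
  assumes N: "finite N" "N \<subseteq> carrier G"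
  obtains M where "exchangeable N M"
proof -
  obtain W where W: "finite W" "W \<subseteq> carrier G"
    "\<And>z. z \<in> carrier G \<rightarrow>\<^sub>E \<Sigma> \<Longrightarrow> (\<And>g. g \<in> carrier G \<Longrightarrow> \<exists>x\<in>X. \<forall>w\<in>W. z (w \<otimes> g) = x (w \<otimes> g)) \<Longrightarrow> z \<in> X"
    using SFT_window by metis
  \<comment> \<open>If \<open>w' \<otimes> g = n \<in> N\<close>, then \<open>w \<otimes> g = w \<otimes> (inv w' \<otimes> n)\<close>.\<close>
  define M where "M = N \<union> (\<lambda>(w, w', n). w \<otimes> (inv w' \<otimes> n)) ` (W \<times> W \<times> N)"
  have M: "finite M" "N \<subseteq> M" "M \<subseteq> carrier G"
    using N W(1,2) by (auto simp: M_def subset_iff)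
  have "(\<lambda>g. if g \<in> N then x g else y g) \<in> X" if xy: "x \<in> X" "y \<in> X" "agree (M - N) x y" for x y
  proof (rule W(3))
    let ?z = "\<lambda>g. if g \<in> N then x g else y g"
    show "?z \<in> carrier G \<rightarrow>\<^sub>E \<Sigma>"
      using X_config[OF xy(1)] X_config[OF xy(2)] N(2) by (auto simp: PiE_iff extensional_def)
    fix g assume g: "g \<in> carrier G"
    show "\<exists>u\<in>X. \<forall>w\<in>W. ?z (w \<otimes> g) = u (w \<otimes> g)"
    proof (cases "\<exists>w'\<in>W. w' \<otimes> g \<in> N")
      case True
      then obtain w' where w': "w' \<in> W" "w' \<otimes> g \<in> N" by blast
      have "?z (w \<otimes> g) = x (w \<otimes> g)" if w: "w \<in> W" for w
      proof -
        have wG: "w \<in> carrier G" "w' \<in> carrier G" using w w' W(2) by auto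
        have "w \<otimes> g = w \<otimes> (inv w' \<otimes> (w' \<otimes> g))" using wG g by (simp add: inv_cancel)
        moreover have "w \<otimes> (inv w' \<otimes> (w' \<otimes> g)) \<in> M"
          unfolding M_def by (rule UnI2, rule image_eqI[of _ _ "(w, w', w' \<otimes> g)"]) (use w w' in auto)
        ultimately have "w \<otimes> g \<in> M" by simp
        then show ?thesis using xy(3) by (auto simp: agree_def)
      qed
      then show ?thesis using xy(1) by blast
    next
      case False then show ?thesis using xy(2) by auto
    qed
  qed
  then have "exchangeable N M" unfolding exchangeable_def using M by blast
  then show thesis by (rule that)
qed

abbreviation patterns :: "'g set \<Rightarrow> ('g \<Rightarrow> 's) set" where
  "patterns M \<equiv> restrictions X M"

abbreviation frame :: "'g set \<Rightarrow> 'g set \<Rightarrow> ('g \<Rightarrow> 's) \<Rightarrow> 'g \<Rightarrow> 's" where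
  "frame N M p \<equiv> restrict p (M - N)"

text \<open>The gate that applies the permutation \<open>p\<close> to the pattern on \<open>M\<close>.\<close>

definition lift :: "'g set \<Rightarrow> (('g \<Rightarrow> 's) \<Rightarrow> 'g \<Rightarrow> 's) \<Rightarrow> ('g \<Rightarrow> 's) \<Rightarrow> 'g \<Rightarrow> 's" where
  "lift M p = (\<lambda>x\<in>X. \<lambda>g. if g \<in> M then p (restrict x M) g else x g)"

lemma restrict_eq_iff_agree: "restrict x D = restrict y D \<longleftrightarrow> agree D x y"
  by (auto simp: agree_def restrict_def fun_eq_iff)

lemma finite_patterns:
  assumes "finite M" "M \<subseteq> carrier G" shows "finite (patterns M)"
proof -
  have "patterns M \<subseteq> M \<rightarrow>\<^sub>E \<Sigma>"
    unfolding restrictions_def using X_config assms(2) by (fastforce simp: PiE_iff subset_iff)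
  then show ?thesis using finite_PiE[OF assms(1), of "\<lambda>_. \<Sigma>"] finite_alphabet finite_subset by blast
qed

lemma pattern_mem: "x \<in> X \<Longrightarrow> restrict x M \<in> patterns M"
  by (simp add: restrictions_def)

lemma exchangeableD:
  assumes "exchangeable N M"
  shows "finite M" "N \<subseteq> M" "M \<subseteq> carrier G" "finite N" "N \<subseteq> carrier G"
    "x \<in> X \<Longrightarrow> y \<in> X \<Longrightarrow> agree (M - N) x y \<Longrightarrow> (\<lambda>g. if g \<in> N then x g else y g) \<in> X"
  using assms finite_subset unfolding exchangeable_def by auto

lemma lift_restrict:
  assumes E: "exchangeable N M" and p: "p \<in> fiber_perms (frame N M) (patterns M)" and x: "x \<in> X"
  shows "lift M p x \<in> X" "restrict (lift M p x) M = p (restrict x M)" "lift M p x \<in> tail_class N x"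
proof -
  have "p (restrict x M) \<in> patterns M"
    using p pattern_mem[OF x] by (auto simp: fiber_perms_def permutes_in_image)
  then obtain z where z: "z \<in> X" "p (restrict x M) = restrict z M" by (auto simp: restrictions_def)
  have "frame N M (p (restrict x M)) = frame N M (restrict x M)"
    using p pattern_mem[OF x] by (auto simp: fiber_perms_def)
  then have "agree (M - N) z x"
    unfolding z(2) by (auto simp: agree_def restrict_def fun_eq_iff split: if_splits)
  note ag = this
  have eq: "lift M p x = (\<lambda>g. if g \<in> N then z g else x g)"
  proof
    fix g
    show "lift M p x g = (if g \<in> N then z g else x g)"
      using x z(2) ag exchangeableD(2)[OF E] by (auto simp: lift_def agree_def)
  qed
  show X: "lift M p x \<in> X" unfolding eq by (rule exchangeableD(6)[OF E z(1) x ag])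
  show "restrict (lift M p x) M = p (restrict x M)"
    unfolding z(2) restrict_eq_iff_agree eq using ag by (auto simp: agree_def)
  show "lift M p x \<in> tail_class N x" unfolding tail_class_def using X by (simp add: eq agree_def)
qed

lemma lift_apply: "x \<in> X \<Longrightarrow> lift M p x g = (if g \<in> M then p (restrict x M) g else x g)"
  by (simp add: lift_def)

lemma lift_comp_apply:
  assumes E: "exchangeable N M" and p: "p \<in> fiber_perms (frame N M) (patterns M)"
    and q: "q \<in> fiber_perms (frame N M) (patterns M)" and x: "x \<in> X"
  shows "lift M (p \<circ> q) x = lift M p (lift M q x)"
proof -
  note l = lift_restrict[OF E q x]
  show ?thesis
    by (rule ext) (simp add: lift_apply[OF x] lift_apply[OF l(1)] l(2))
qed

lemma lift_id: "x \<in> X \<Longrightarrow> lift M id x = x"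
  by (auto simp: lift_def fun_eq_iff)

lemma lift_Bij:
  assumes E: "exchangeable N M" and p: "p \<in> fiber_perms (frame N M) (patterns M)"
  shows "lift M p \<in> Bij X"
proof -
  note fin = finite_patterns[OF exchangeableD(1,3)[OF E]]
  have pp: "p permutes patterns M" using p by (simp add: fiber_perms_def)
  note pi = fiber_perms_inv[OF fin p]
  have "lift M (pinv p) (lift M p x) = x" "lift M p (lift M (pinv p) x) = x" if x: "x \<in> X" for x
    using lift_comp_apply[OF E pi p x] lift_comp_apply[OF E p pi x] lift_id[OF x]
      permutes_inv_o[OF pp] by auto
  then have "bij_betw (lift M p) X X"
    by (intro bij_betw_byWitness[where f' = "lift M (pinv p)"])
      (use lift_restrict(1)[OF E p] lift_restrict(1)[OF E pi] in auto)
  then show ?thesis by (simp add: Bij_def lift_def)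
qed

lemma lift_comp:
  assumes E: "exchangeable N M" and p: "p \<in> fiber_perms (frame N M) (patterns M)"
    and q: "q \<in> fiber_perms (frame N M) (patterns M)"
  shows "lift M (p \<circ> q) = lift M p \<odot> lift M q"
proof (rule Bij_eqI)
  note fin = finite_patterns[OF exchangeableD(1,3)[OF E]]
  note B = lift_Bij[OF E p] lift_Bij[OF E q]
  show "lift M (p \<circ> q) \<in> Bij X" by (rule lift_Bij[OF E fiber_perms_comp[OF fin p q]])
  show "lift M p \<odot> lift M q \<in> Bij X" using B by simp
  fix x assume "x \<in> X"
  then show "lift M (p \<circ> q) x = (lift M p \<odot> lift M q) x"
    using B lift_comp_apply[OF E p q] by (simp add: bmult_apply)
qed

lemma fiber_perms_id: "id \<in> fiber_perms \<beta> A"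
  by (simp add: fiber_perms_def permutes_id)

lemma lift_id_eq:
  assumes E: "exchangeable N M" shows "lift M id = bone"
  by (rule Bij_eqI) (use lift_Bij[OF E fiber_perms_id] lift_id in \<open>auto simp: bone_apply\<close>)

lemma lift_inv:
  assumes E: "exchangeable N M" and p: "p \<in> fiber_perms (frame N M) (patterns M)"
  shows "lift M (pinv p) = binv (lift M p)"
proof -
  note fin = finite_patterns[OF exchangeableD(1,3)[OF E]]
  note pi = fiber_perms_inv[OF fin p]
  have "pinv p \<circ> p = id" using p permutes_inv_o(2) by (auto simp: fiber_perms_def)
  then have "lift M (pinv p) \<odot> lift M p = bone"
    using lift_comp[OF E pi p] lift_id_eq[OF E] by simp
  then show ?thesis using BX.inv_equality lift_Bij[OF E p] lift_Bij[OF E pi] by simp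
qed

lemma lift_gate:
  assumes E: "exchangeable N M" and p: "p \<in> fiber_perms (frame N M) (patterns M)"
  shows "lift M p \<in> gates G \<Sigma> X" "acts_within G X N (lift M p)" "lift M p \<in> Homeo G \<Sigma> X"
proof -
  note M = exchangeableD[OF E]
  have "local_map (lift M p)"
    unfolding local_map_def
  proof
    fix g assume g: "g \<in> carrier G"
    have "lift M p x g = lift M p y g" if xy: "x \<in> X" "y \<in> X" "agree (insert g M) x y" for x y
    proof -
      have "restrict x M = restrict y M" unfolding restrict_eq_iff_agree using xy(3) by (auto simp: agree_def)
      then show ?thesis using xy by (simp add: lift_def agree_def)
    qed
    then show "\<exists>D. finite D \<and> D \<subseteq> carrier G \<and> (\<forall>x\<in>X. \<forall>y\<in>X. agree D x y \<longrightarrow> lift M p x g = lift M p y g)"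
      using M(1,3) g by (intro exI[of _ "insert g M"]) simp
  qed
  then show H: "lift M p \<in> Homeo G \<Sigma> X" using lift_Bij[OF E p] Homeo_iff by blast
  show A: "acts_within G X N (lift M p)"
    unfolding acts_within_def using M(4,5) lift_restrict(3)[OF E p] by (auto simp: tail_class_def agree_def)
  show "lift M p \<in> gates G \<Sigma> X" unfolding gates_def using H A by blast
qed

lemma fiber_eq_tail_class:
  assumes E: "exchangeable N M" and x: "x \<in> X"
  shows "{q \<in> patterns M. frame N M q = frame N M (restrict x M)} = (\<lambda>z. restrict z M) ` tail_class N x"
proof (intro equalityI subsetI)
  note M = exchangeableD[OF E]
  have fr: "frame N M (restrict z M) = frame N M (restrict x M) \<longleftrightarrow> agree (M - N) z x" for z
    by (auto simp: agree_def restrict_def fun_eq_iff split: if_splits)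
  {
    fix q assume "q \<in> {q \<in> patterns M. frame N M q = frame N M (restrict x M)}"
    then obtain z where z: "z \<in> X" "q = restrict z M" "agree (M - N) z x"
      using fr by (auto simp: restrictions_def)
    let ?w = "\<lambda>g. if g \<in> N then z g else x g"
    have "?w \<in> tail_class N x" unfolding tail_class_def using M(6)[OF z(1) x z(3)] by (simp add: agree_def)
    moreover have "q = restrict ?w M"
      unfolding z(2) restrict_eq_iff_agree using z(3) by (auto simp: agree_def)
    ultimately show "q \<in> (\<lambda>z. restrict z M) ` tail_class N x" by blast
  next
    fix q assume "q \<in> (\<lambda>z. restrict z M) ` tail_class N x"
    then obtain z where z: "z \<in> X" "agree (carrier G - N) z x" "q = restrict z M" by (auto simp: tail_class_def)
    have "agree (M - N) z x" by (rule agree_mono[OF z(2)]) (use M(3) in auto)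
    then show "q \<in> {q \<in> patterns M. frame N M q = frame N M (restrict x M)}"
      using z pattern_mem fr by auto
  }
qed

lemma inj_on_tail_class_restrict:
  assumes "exchangeable N M" shows "inj_on (\<lambda>z. restrict z M) (tail_class N x)"
proof -
  have "tail_class N x \<subseteq> tail_class M x" using exchangeableD(2)[OF assms] by (auto simp: tail_class_def agree_def)
  then show ?thesis by (rule inj_on_subset[OF inj_on_tail_class])
qed

lemma parity_transfer:
  assumes E: "exchangeable N M" and x: "x \<in> X" and \<phi>: "\<phi> \<in> Bij X" "acts_within G X N \<phi>"
    and p: "\<And>z. z \<in> X \<Longrightarrow> p (restrict z M) = restrict (\<phi> z) M"
  shows "evenperm (restrict_id p {q \<in> patterns M. frame N M q = frame N M (restrict x M)}) \<longleftrightarrow>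
    evenperm (restrict_id \<phi> (tail_class N x))"
  unfolding fiber_eq_tail_class[OF E x]
  by (rule restrict_id_transport(2)[OF inj_on_tail_class_restrict[OF E] bij_betw_tail_class[OF \<phi>] _ finite_tail_class[OF exchangeableD(4,5)[OF E]]])
    (simp add: tail_class_def p)

lemma lift_even:
  assumes E: "exchangeable N M" and p: "p \<in> fiber_alt (frame N M) (patterns M)"
  shows "lift M p \<in> even_gates G \<Sigma> X"
proof -
  have pf: "p \<in> fiber_perms (frame N M) (patterns M)" using p by (simp add: fiber_alt_def)
  note g = lift_gate[OF E pf]
  have "evenperm (restrict_id (lift M p) (tail_class N x))" if x: "x \<in> X" for x
  proof -
    have "evenperm (restrict_id p {q \<in> patterns M. frame N M q = frame N M (restrict x M)})"
      using p pattern_mem[OF x] unfolding fiber_alt_def by blast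
    then show ?thesis
      using parity_transfer[OF E x lift_Bij[OF E pf] g(2) lift_restrict(2)[OF E pf, symmetric]] by blast
  qed
  then have "even_on N (lift M p)" using g unfolding even_on_def by blast
  then show ?thesis using even_gates_iff by blast
qed

text \<open>The map induced on patterns is surjective because \<open>\<phi>\<close> is, hence a permutation by finiteness. It preserves the frame because \<open>\<phi>\<close> acts within \<open>N\<close>.\<close>

lemma gate_is_lift:
  assumes E: "exchangeable N M" and s: "supported_in M \<phi>" and act: "acts_within G X N \<phi>"
  obtains p where "p \<in> fiber_perms (frame N M) (patterns M)" "lift M p = \<phi>"
    "\<And>x. x \<in> X \<Longrightarrow> p (restrict x M) = restrict (\<phi> x) M"
proof -
  note M = exchangeableD[OF E] and sD = supported_inD[OF s]
  note fin = finite_patterns[OF M(1,3)]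
  define p where "p q = (if q \<in> patterns M then restrict (\<phi> (SOME x. x \<in> X \<and> restrict x M = q)) M else q)" for q
  have p: "p (restrict x M) = restrict (\<phi> x) M" if x: "x \<in> X" for x
  proof -
    obtain y where y: "y = (SOME y. y \<in> X \<and> restrict y M = restrict x M)" by blast
    have yX: "y \<in> X \<and> restrict y M = restrict x M" unfolding y by (rule someI[of _ x]) (use x in simp)
    then have "agree M y x" using restrict_eq_iff_agree by blast
    then have "agree M (\<phi> y) (\<phi> x)" using sD(6) x yX by blast
    then have "restrict (\<phi> y) M = restrict (\<phi> x) M" using restrict_eq_iff_agree by blast
    then show ?thesis unfolding p_def y using pattern_mem[OF x] by simp
  qed
  have img: "p ` patterns M = patterns M"
  proof
    show "p ` patterns M \<subseteq> patterns M"
      using p Bij_mem[OF sD(2)] by (auto simp: restrictions_def)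
    show "patterns M \<subseteq> p ` patterns M"
    proof
      fix q assume "q \<in> patterns M"
      then obtain z where z: "z \<in> X" "q = restrict z M" by (auto simp: restrictions_def)
      have zi: "binv \<phi> z \<in> X" by (rule Bij_mem[OF BX.inv_closed[OF sD(2)] z(1)])
      have "p (restrict (binv \<phi> z) M) = q" using p[OF zi] binv_apply[OF sD(2) z(1)] z(2) by simp
      then show "q \<in> p ` patterns M" using pattern_mem[OF zi] by blast
    qed
  qed
  have "bij_betw p (patterns M) (patterns M)"
    using img fin by (simp add: bij_betw_def eq_card_imp_inj_on)
  then have perm: "p permutes patterns M"
    by (rule bij_imp_permutes) (simp add: p_def)
  have "frame N M (p q) = frame N M q" if q: "q \<in> patterns M" for q
  proof -
    obtain x where x: "x \<in> X" "q = restrict x M" using q by (auto simp: restrictions_def)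
    have "\<phi> x g = x g" if "g \<in> M - N" for g
      using act x(1) that M(3) unfolding acts_within_def by blast
    then show ?thesis unfolding x(2) p[OF x(1)] by (auto simp: restrict_def fun_eq_iff)
  qed
  then have pf: "p \<in> fiber_perms (frame N M) (patterns M)" using perm by (simp add: fiber_perms_def)
  have "lift M p = \<phi>"
  proof (rule Bij_eqI[OF lift_Bij[OF E pf] sD(2)])
    fix x assume x: "x \<in> X"
    show "lift M p x = \<phi> x"
    proof (rule X_eqI[OF lift_restrict(1)[OF E pf x] Bij_mem[OF sD(2) x]])
      fix g assume g: "g \<in> carrier G"
      show "lift M p x g = \<phi> x g"
        using x g p[OF x] sD(5)[OF x g] by (simp add: lift_def)
    qed
  qed
  then show thesis using that pf p by blast
qed

lemma even_gate_is_lift: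
  assumes E: "exchangeable N M" and s: "supported_in M \<phi>" and ev: "even_on N \<phi>"
  obtains p where "p \<in> fiber_alt (frame N M) (patterns M)" "lift M p = \<phi>"
proof -
  have act: "acts_within G X N \<phi>" using ev by (simp add: even_on_def)
  obtain p where p: "p \<in> fiber_perms (frame N M) (patterns M)" "lift M p = \<phi>"
    "\<And>x. x \<in> X \<Longrightarrow> p (restrict x M) = restrict (\<phi> x) M"
    using gate_is_lift[OF E s act] by metis
  have "evenperm (restrict_id p {y \<in> patterns M. frame N M y = frame N M q})" if q: "q \<in> patterns M" for q
  proof -
    obtain x where x: "x \<in> X" "q = restrict x M" using q by (auto simp: restrictions_def)
    show ?thesis
      using ev x(1) parity_transfer[OF E x(1) supported_inD(2)[OF s] act p(3)] unfolding x(2) even_on_def by blast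
  qed
  then have "p \<in> fiber_alt (frame N M) (patterns M)" using p(1) by (simp add: fiber_alt_def)
  then show thesis using that p(2) by blast
qed

text \<open>An even gate is a product of 3-cycles of patterns with a common frame, and each of these is the commutator of two gates that are transpositions of patterns.\<close>

lemma even_gates_deep_derived: "even_gates G \<Sigma> X \<subseteq> deep_gates (derived BX (L G \<Sigma> X)) (carrier G)"
proof
  let ?E = "deep_gates (derived BX (L G \<Sigma> X)) (carrier G)"
  have sg: "subgroup (derived BX (L G \<Sigma> X)) BX" by (rule BX.derived_is_subgroup[OF L_Bij])
  note mult = deep_gates_mult[OF sg order_refl]
  fix \<phi> assume \<phi>: "\<phi> \<in> even_gates G \<Sigma> X"
  obtain N0 where N0: "even_on N0 \<phi>" using \<phi> even_gates_iff by blast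
  obtain D where D: "supported_in D \<phi>" using \<phi> even_gates_subset gates_iff by blast
  have fN0: "finite N0" "N0 \<subseteq> carrier G" using N0 by (auto simp: even_on_def acts_within_def)
  let ?N = "N0 \<union> D"
  have N: "finite ?N" "?N \<subseteq> carrier G" using fN0 supported_inD[OF D] by auto
  obtain M where E: "exchangeable ?N M" by (rule exchangeable_exists[OF N])
  note M = exchangeableD[OF E]
  have ev: "even_on ?N \<phi>" by (rule even_on_mono[OF N0 _ N]) simp
  have s: "supported_in M \<phi>" by (rule supported_in_mono[OF D _ M(1,3)]) (use M(2) in auto)
  obtain p where p: "p \<in> fiber_alt (frame ?N M) (patterns M)" "lift M p = \<phi>"
    using even_gate_is_lift[OF E s ev] by metis
  note fin = finite_patterns[OF M(1,3)]
  have "lift M p \<in> ?E"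
  proof (rule fiber_alt_induct[OF fin p(1), where P = "\<lambda>u. lift M u \<in> ?E"])
    have "bone \<odot> bone \<odot> binv bone \<odot> binv bone \<in> ?E"
      by (rule commutator_deep_derived[OF gates_one gates_one])
    then show "lift M id \<in> ?E" by (simp add: lift_id_eq[OF E])
  next
    fix a b c q
    assume abc: "a \<in> patterns M" "b \<in> patterns M" "c \<in> patterns M" "frame ?N M a = frame ?N M b"
        "frame ?N M b = frame ?N M c" "a \<noteq> b" "b \<noteq> c" "a \<noteq> c"
      and q: "q \<in> fiber_alt (frame ?N M) (patterns M)" "lift M q \<in> ?E"
    let ?F = "fiber_perms (frame ?N M) (patterns M)"
    let ?s = "swap a c" and ?t = "swap c b"
    have st: "?s \<in> ?F" "?t \<in> ?F" 
      using fiber_perms_transpose[where \<beta> = "frame ?N M", OF fin abc(1,3) trans[OF abc(4,5)]]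
        fiber_perms_transpose[where \<beta> = "frame ?N M", OF fin abc(3,2) abc(5)[symmetric]] .
    \<comment> \<open>Transpositions are their own inverses, so \<open>s t s t\<close> is the commutator of \<open>s\<close> and \<open>t\<close>.\<close>
    have self_inv: "binv (lift M u) = lift M u" if "u \<in> ?F" "u \<circ> u = id" for u
      using lift_comp[OF E that(1,1)] lift_id_eq[OF E] that(2) BX.inv_equality lift_Bij[OF E that(1)] by simp
    have inv: "binv (lift M ?s) = lift M ?s" "binv (lift M ?t) = lift M ?t"
      using self_inv st by auto
    have qF: "q \<in> ?F" using q(1) by (simp add: fiber_alt_def)
    note st1 = fiber_perms_comp[OF fin st]
    note st2 = fiber_perms_comp[OF fin st1 st(1)]
    have "lift M (cyc3 a b c) = lift M ?s \<odot> lift M ?t \<odot> lift M ?s \<odot> lift M ?t"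
      unfolding cyc3_commutator[OF abc(6,7,8)]
      by (simp only: lift_comp[OF E st2 st(2)] lift_comp[OF E st1 st(1)] lift_comp[OF E st])
    also have "\<dots> \<in> ?E"
      using commutator_deep_derived[OF lift_gate(1)[OF E st(1)] lift_gate(1)[OF E st(2)]] unfolding inv .
    finally have "lift M (cyc3 a b c) \<odot> lift M q \<in> ?E" by (rule mult[OF _ q(2)])
    moreover have "cyc3 a b c \<in> ?F" by (rule cyc3_fiber_perms[where \<beta> = "frame ?N M", OF fin abc(1-5)])
    ultimately show "lift M (cyc3 a b c \<circ> q) \<in> ?E" using lift_comp[OF E _ qF] by simp
  qed
  then show "\<phi> \<in> ?E" by (simp only: p(2))
qed

lemma L_even_eq_derived: "L_even G \<Sigma> X = derived BX (L G \<Sigma> X)"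
  using derived_L_subset
    L_even_subset_if_deep[OF BX.derived_is_subgroup[OF L_Bij] finite_index_normal_carrier even_gates_deep_derived]
  by blast

end

section \<open>Consequences of the eventual filling property\<close>

locale efp_sft = sft_space G \<Sigma> X
  for G :: "('g, 'm) monoid_scheme" (structure) and \<Sigma> :: "'s set" and X :: "('g \<Rightarrow> 's) set" +
  assumes efp: "EFP G X" and infinite_group: "infinite (carrier G)" and not_singleton: "\<not> is_singleton X"
begin

lemma EFP_fill:
  assumes "finite F" "F \<subseteq> carrier G"
  obtains N where "finite N" "N \<subseteq> carrier G"
    "\<And>x y. x \<in> X \<Longrightarrow> y \<in> X \<Longrightarrow> \<exists>z\<in>tail_class N y. agree F z x"
proof -
  obtain N where N: "finite N" "N \<subseteq> carrier G"
    "\<And>x y. x \<in> X \<Longrightarrow> y \<in> X \<Longrightarrow> \<exists>z\<in>X. restrict z F = restrict x F \<and> restrict z (carrier G - N) = restrict y (carrier G - N)"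
    using efp assms unfolding EFP_def by metis
  show thesis
    by (rule that[OF N(1,2)]) (use N(3) in \<open>unfold restrict_eq_iff_agree tail_class_def, blast\<close>)
qed

lemma two_values:
  assumes h: "h \<in> carrier G"
  obtains x y where "x \<in> X" "y \<in> X" "x h \<noteq> y h"
proof -
  have "X \<noteq> {}" using is_subshift by (simp add: subshift_def)
  then obtain x y where xy: "x \<in> X" "y \<in> X" "x \<noteq> y"
    using not_singleton unfolding is_singleton_def by blast
  then obtain g where g: "g \<in> carrier G" "x g \<noteq> y g" using X_eqI by blast
  \<comment> \<open>The shift by \<open>h\<^sup>-\<^sup>1 g\<close> moves the coordinate \<open>g\<close> to \<open>h\<close>.\<close>
  let ?k = "inv h \<otimes> g"
  have k: "?k \<in> carrier G" using g h by simp
  have "h \<otimes> ?k = g" using g h by (simp add: inv_cancel)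
  then have "shift G ?k x h \<noteq> shift G ?k y h" using g(2) h by (simp add: shift_apply)
  then show thesis using that shift_mem[OF k xy(1)] shift_mem[OF k xy(2)] by blast
qed

text \<open>Let \<open>N\<close> be such that any pattern on \<open>F\<close> can be completed to agree with a fixed \<open>y\<close> outside \<open>N\<close>, and \<open>h \<notin> N\<close>. Then all patterns on \<open>F\<close> extend to \<open>insert h F\<close> with the value \<open>y h\<close> at \<open>h\<close>, and some pattern has another value there.\<close>

lemma many_patterns:
  obtains F where "finite F" "F \<subseteq> carrier G" "n \<le> card (patterns F)"
proof -
  have "\<exists>F. finite F \<and> F \<subseteq> carrier G \<and> n \<le> card (patterns F)"
  proof (induction n)
    case 0 show ?case by (intro exI[of _ "{}"]) simp
  next
    case (Suc n)
    then obtain F where F: "finite F" "F \<subseteq> carrier G" "n \<le> card (patterns F)" by blast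
    obtain N where N: "finite N" "N \<subseteq> carrier G" "\<And>x y. x \<in> X \<Longrightarrow> y \<in> X \<Longrightarrow> \<exists>z\<in>tail_class N y. agree F z x"
      using EFP_fill[OF F(1,2)] by metis
    obtain h where h: "h \<in> carrier G" "h \<notin> N" using infinite_group N(1) by (meson finite_subset subsetI)
    obtain y y' where y: "y \<in> X" "y' \<in> X" "y h \<noteq> y' h" by (rule two_values[OF h(1)])
    let ?F = "insert h F"
    have F': "finite ?F" "?F \<subseteq> carrier G" using F h by auto
    let ?A = "{q \<in> patterns ?F. q h = y h}"
    have "patterns F \<subseteq> (\<lambda>q. restrict q F) ` ?A"
    proof
      fix q assume "q \<in> patterns F"
      then obtain x where x: "x \<in> X" "q = restrict x F" by (auto simp: restrictions_def)
      obtain z where z: "z \<in> tail_class N y" "agree F z x" using N(3)[OF x(1) y(1)] by blast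
      then have "restrict z ?F \<in> ?A" using h by (auto simp: tail_class_def agree_def restrictions_def)
      moreover have "q = restrict (restrict z ?F) F"
        unfolding x(2) using z(2) by (auto simp: agree_def restrict_def fun_eq_iff)
      ultimately show "q \<in> (\<lambda>q. restrict q F) ` ?A" by blast
    qed
    moreover have fin: "finite (patterns ?F)" by (rule finite_patterns[OF F'])
    ultimately have "card (patterns F) \<le> card ?A" by (intro surj_card_le) auto
    moreover have "?A \<subset> patterns ?F"
    proof -
      have "restrict y' ?F \<in> patterns ?F" "restrict y' ?F \<notin> ?A" using y by (auto simp: restrictions_def)
      then show ?thesis by blast
    qed
    then have "card ?A < card (patterns ?F)" by (rule psubset_card_mono[OF fin])
    ultimately have "Suc n \<le> card (patterns ?F)" using F(3) by linarith
    then show ?case using F' by blast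
  qed
  then show thesis using that by blast
qed

lemma tail_class_mono: "N \<subseteq> N' \<Longrightarrow> tail_class N x \<subseteq> tail_class N' x"
  by (auto simp: tail_class_def agree_def)

text \<open>By the filling property every pattern on \<open>F\<close> occurs in the class.\<close>

lemma large_classes:
  obtains N where "finite N" "N \<subseteq> carrier G"
    "\<And>N' y. finite N' \<Longrightarrow> N \<subseteq> N' \<Longrightarrow> N' \<subseteq> carrier G \<Longrightarrow> y \<in> X \<Longrightarrow> n \<le> card (tail_class N' y)"
proof -
  obtain F where F: "finite F" "F \<subseteq> carrier G" "n \<le> card (patterns F)" by (rule many_patterns)
  obtain N where N: "finite N" "N \<subseteq> carrier G" "\<And>x y. x \<in> X \<Longrightarrow> y \<in> X \<Longrightarrow> \<exists>z\<in>tail_class N y. agree F z x"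
    using EFP_fill[OF F(1,2)] by metis
  show thesis
  proof (rule that[OF N(1,2)])
    fix N' y assume N': "finite N'" "N \<subseteq> N'" "N' \<subseteq> carrier G" and y: "y \<in> X"
    have "patterns F \<subseteq> (\<lambda>z. restrict z F) ` tail_class N' y"
    proof
      fix q assume "q \<in> patterns F"
      then obtain x where x: "x \<in> X" "q = restrict x F" by (auto simp: restrictions_def)
      obtain z where z: "z \<in> tail_class N y" "agree F z x" using N(3)[OF x(1) y] by blast
      have "q = restrict z F" unfolding x(2) restrict_eq_iff_agree using z(2) by (rule agree_sym)
      then show "q \<in> (\<lambda>z. restrict z F) ` tail_class N' y" using tail_class_mono[OF N'(2)] z(1) by blast
    qed
    then have "card (patterns F) \<le> card (tail_class N' y)" by (rule surj_card_le[OF finite_tail_class[OF N'(1,3)]])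
    then show "n \<le> card (tail_class N' y)" using F(3) by linarith
  qed
qed

lemma card_fiber:
  assumes E: "exchangeable N M" and x: "x \<in> X"
  shows "card {q \<in> patterns M. frame N M q = frame N M (restrict x M)} = card (tail_class N x)"
  unfolding fiber_eq_tail_class[OF E x] by (rule card_image[OF inj_on_tail_class_restrict[OF E]])

text \<open>A 3-cycle of patterns that moves the pattern of \<open>y\<close> and avoids the pattern of \<open>x\<close>; the bound 4 leaves room for it.\<close>

lemma separating_even_gate:
  assumes xy: "x \<in> X" "y \<in> X" "x \<noteq> y"
  obtains \<phi> where "\<phi> \<in> even_gates G \<Sigma> X" "\<phi> x = x" "\<phi> y \<noteq> y"
proof -
  obtain N0 where N0: "finite N0" "N0 \<subseteq> carrier G"
    "\<And>N' y. finite N' \<Longrightarrow> N0 \<subseteq> N' \<Longrightarrow> N' \<subseteq> carrier G \<Longrightarrow> y \<in> X \<Longrightarrow> 4 \<le> card (tail_class N' y)"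
    using large_classes[of 4] by metis
  obtain g where g: "g \<in> carrier G" "x g \<noteq> y g" using X_eqI xy by blast
  let ?N = "insert g N0"
  have N: "finite ?N" "?N \<subseteq> carrier G" using N0 g by auto
  obtain M where E: "exchangeable ?N M" by (rule exchangeable_exists[OF N])
  note M = exchangeableD[OF E]
  note fin = finite_patterns[OF M(1,3)]
  let ?x = "restrict x M" and ?y = "restrict y M"
  let ?S = "{q \<in> patterns M. frame ?N M q = frame ?N M ?y}"
  have gM: "g \<in> M" using M(2) by blast
  have neq: "?x \<noteq> ?y" unfolding restrict_eq_iff_agree using g(2) gM by (auto simp: agree_def)
  have card: "4 \<le> card ?S" using card_fiber[OF E xy(2)] N0(3)[OF N(1) _ N(2) xy(2)] by auto
  have fresh: "\<exists>q. q \<in> ?S \<and> q \<notin> set qs" if "length qs \<le> 3" for qs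
  proof (rule ccontr)
    assume "\<nexists>q. q \<in> ?S \<and> q \<notin> set qs"
    then have "?S \<subseteq> set qs" by blast
    then have "card ?S \<le> card (set qs)" by (rule card_mono[rotated]) simp
    then show False using card that card_length[of qs] by linarith
  qed
  obtain a where a: "a \<in> ?S" "a \<notin> set [?x, ?y]" using fresh[of "[?x, ?y]"] by auto
  obtain b where b: "b \<in> ?S" "b \<notin> set [?x, ?y, a]" using fresh[of "[?x, ?y, a]"] by auto
  let ?p = "cyc3 ?y a b"
  have d: "?y \<noteq> a" "a \<noteq> b" "?y \<noteq> b" using a b by auto
  have p: "?p \<in> fiber_alt (frame ?N M) (patterns M)"
    using a b pattern_mem[OF xy(2)] d by (intro cyc3_fiber_alt[OF fin]) auto
  then have pf: "?p \<in> fiber_perms (frame ?N M) (patterns M)" by (simp add: fiber_alt_def)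
  have px: "?p ?x = ?x" by (rule cyc3_apply(4)[OF d]) (use neq a b in auto)
  have py: "?p ?y = a" by (rule cyc3_apply(1)[OF d])
  show thesis
  proof (rule that[OF lift_even[OF E p]])
    show "lift M ?p x = x"
      unfolding lift_def using xy(1) px by (auto simp: fun_eq_iff)
    show "lift M ?p y \<noteq> y"
      using lift_restrict(2)[OF E pf xy(2)] py d by auto
  qed
qed

text \<open>Choose \<open>N\<close> so large that each of its classes has at least nine elements and, by the filling property, contains a configuration that agrees with a point moved by \<open>\<pi>\<close>
on the support of \<open>\<pi>\<close>. Then \<open>\<pi>\<close> is nontrivial on the patterns with any given frame, and the commutator argument for alternating groups applies.\<close>

lemma even_gates_subset_normalized:
  assumes M: "subgroup U BX" and K0: "K0 \<subseteq> carrier G"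
    and norm: "\<And>x n. x \<in> L_even G \<Sigma> X \<Longrightarrow> n \<in> U \<Longrightarrow> x \<odot> n \<odot> binv x \<in> U"
    and \<pi>: "\<pi> \<in> deep_gates U K0" "\<pi> \<noteq> bone"
  shows "even_gates G \<Sigma> X \<subseteq> deep_gates U K0"
proof
  let ?E = "deep_gates U K0"
  fix \<psi> assume \<psi>: "\<psi> \<in> even_gates G \<Sigma> X"
  have g: "\<pi> \<in> gates G \<Sigma> X" "\<psi> \<in> gates G \<Sigma> X" using \<pi>(1) \<psi> even_gates_subset by (auto simp: deep_gates_def)
  obtain D where D: "finite D" "D \<subseteq> carrier G" "\<And>\<xi>. \<xi> \<in> {\<pi>, \<psi>} \<Longrightarrow> supported_in D \<xi>"
    by (rule gates_common_support[of "{\<pi>, \<psi>}"]) (use g in auto)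
  have s: "supported_in D \<pi>" "supported_in D \<psi>" using D(3) by auto
  note s\<pi> = supported_inD[OF s(1)]
  obtain x0 where x0: "x0 \<in> X" "\<pi> x0 \<noteq> x0"
    using \<pi>(2) Bij_eqI[OF gates_Bij[OF g(1)] BX.one_closed] by (metis bone_apply)
  have "\<exists>h\<in>carrier G. \<pi> x0 h \<noteq> x0 h" using X_eqI[OF Bij_mem[OF s\<pi>(2) x0(1)] x0(1)] x0(2) by blast
  then obtain h where h: "h \<in> carrier G" "\<pi> x0 h \<noteq> x0 h" by blast
  have hD: "h \<in> D" using s\<pi>(5)[OF x0(1) h(1)] h(2) by blast
  obtain N1 where N1: "finite N1" "N1 \<subseteq> carrier G" "\<And>x y. x \<in> X \<Longrightarrow> y \<in> X \<Longrightarrow> \<exists>z\<in>tail_class N1 y. agree D z x"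
    using EFP_fill[OF D(1,2)] by metis
  obtain N2 where N2: "finite N2" "N2 \<subseteq> carrier G"
    "\<And>N' y. finite N' \<Longrightarrow> N2 \<subseteq> N' \<Longrightarrow> N' \<subseteq> carrier G \<Longrightarrow> y \<in> X \<Longrightarrow> 9 \<le> card (tail_class N' y)"
    using large_classes[of 9] by metis
  obtain N3 where N3: "even_on N3 \<psi>" using \<psi> even_gates_iff by blast
  have fN3: "finite N3" "N3 \<subseteq> carrier G" using N3 by (auto simp: even_on_def acts_within_def)
  define N where "N = D \<union> N1 \<union> N2 \<union> N3"
  have N: "finite N" "N \<subseteq> carrier G" using D N1 N2 fN3 by (auto simp: N_def)
  have sub: "D \<subseteq> N" "N1 \<subseteq> N" "N2 \<subseteq> N" "N3 \<subseteq> N" by (auto simp: N_def)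
  obtain M where E: "exchangeable N M" by (rule exchangeable_exists[OF N])
  note Mp = exchangeableD[OF E]
  note fin = finite_patterns[OF Mp(1,3)]
  let ?F = "fiber_perms (frame N M) (patterns M)" and ?A = "fiber_alt (frame N M) (patterns M)"
  have DM: "D \<subseteq> M" using sub(1) Mp(2) by blast
  have sM: "supported_in M \<pi>" "supported_in M \<psi>"
    by (rule supported_in_mono[OF s(1) DM Mp(1,3)], rule supported_in_mono[OF s(2) DM Mp(1,3)])
  have act: "acts_within G X N \<pi>" using supported_in_mono[OF s(1) sub(1) N] by (simp add: supported_in_def)
  obtain p where p: "p \<in> ?F" "lift M p = \<pi>" "\<And>x. x \<in> X \<Longrightarrow> p (restrict x M) = restrict (\<pi> x) M"
    using gate_is_lift[OF E sM(1) act] by metis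
  obtain q where q: "q \<in> ?A" "lift M q = \<psi>"
    using even_gate_is_lift[OF E sM(2) even_on_mono[OF N3 sub(4) N]] by metis
  have AF: "u \<in> ?F" if "u \<in> ?A" for u using that by (simp add: fiber_alt_def)
  let ?n = "{u \<in> ?F. lift M u \<in> ?E}"
  have "?A \<subseteq> ?n"
  proof (rule fiber_alt_subset_if_normalized[OF fin, where \<pi> = p])
    fix u v assume uv: "u \<in> ?n" "v \<in> ?n"
    then have F: "u \<in> ?F" "v \<in> ?F" by auto
    show "u \<circ> v \<in> ?n"
      using fiber_perms_comp[OF fin F] lift_comp[OF E F] deep_gates_mult[OF M K0] uv by simp
  next
    fix u assume u: "u \<in> ?n"
    then have F: "u \<in> ?F" by auto
    show "pinv u \<in> ?n"
      using fiber_perms_inv[OF fin F] lift_inv[OF E F] deep_gates_inv[OF M K0] u by simp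
  next
    fix u v assume u: "u \<in> ?A" and v: "v \<in> ?n"
    have uF: "u \<in> ?F" "pinv u \<in> ?F" "v \<in> ?F" using AF[OF u] fiber_perms_inv[OF fin] v by auto
    have "lift M (u \<circ> v \<circ> pinv u) = lift M u \<odot> lift M v \<odot> binv (lift M u)"
      using lift_comp[OF E fiber_perms_comp[OF fin uF(1,3)] uF(2)] lift_comp[OF E uF(1,3)] lift_inv[OF E uF(1)] by simp
    moreover have "lift M u \<odot> lift M v \<odot> binv (lift M u) \<in> ?E"
      by (rule deep_gates_conj[OF M K0 norm _ lift_even[OF E u]]) (use v in auto)
    ultimately show "u \<circ> v \<circ> pinv u \<in> ?n"
      using fiber_perms_comp[OF fin fiber_perms_comp[OF fin uF(1,3)] uF(2)] by simp
  next
    show "p \<in> ?n" using p \<pi>(1) by simp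
    show "p \<in> ?F" by (rule p(1))
  next
    fix r assume "r \<in> patterns M"
    then obtain y where y: "y \<in> X" "r = restrict y M" by (auto simp: restrictions_def)
    show "9 \<le> card {s \<in> patterns M. frame N M s = frame N M r}"
      unfolding y(2) card_fiber[OF E y(1)] by (rule N2(3)[OF N(1) sub(3) N(2) y(1)])
    obtain z where z: "z \<in> tail_class N1 y" "agree D z x0" using N1(3)[OF x0(1) y(1)] by blast
    have zX: "z \<in> X" "z \<in> tail_class N y" using z(1) tail_class_mono[OF sub(2)] by (auto simp: tail_class_def)
    have "restrict z M \<in> {s \<in> patterns M. frame N M s = frame N M r}"
      unfolding y(2) fiber_eq_tail_class[OF E y(1)] using zX(2) by blast
    moreover have "p (restrict z M) \<noteq> restrict z M"
    proof -
      have "agree D (\<pi> z) (\<pi> x0)" by (rule s\<pi>(6)[OF zX(1) x0(1) z(2)])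
      then have "\<pi> z h \<noteq> z h" using z(2) h(2) hD by (auto simp: agree_def)
      then show ?thesis
        unfolding p(3)[OF zX(1)] restrict_eq_iff_agree using hD DM by (auto simp: agree_def)
    qed
    ultimately show "\<exists>s\<in>patterns M. frame N M s = frame N M r \<and> p s \<noteq> s" by blast
  qed
  then have "q \<in> ?n" using q(1) by blast
  then show "\<psi> \<in> ?E" using q(2) by simp
qed

text \<open>If \<open>f x \<noteq> x\<close> and the even gate \<open>\<phi>\<close> fixes \<open>x\<close> but moves \<open>f x\<close>, then \<open>f\<close> and \<open>\<phi>\<close> do not commute. Their commutator is a
gate, and it lies in \<open>deep_gates U K0\<close> where \<open>f\<close> commutes with the shifts in \<open>K0\<close>.\<close>

lemma L_even_minimal:
  assumes M: "subgroup U BX" "U \<subseteq> SAut G \<Sigma> X" "U \<noteq> {bone}"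
    and norm: "\<And>x n. x \<in> L_even G \<Sigma> X \<Longrightarrow> n \<in> U \<Longrightarrow> x \<odot> n \<odot> binv x \<in> U"
  shows "L_even G \<Sigma> X \<subseteq> U"
proof -
  obtain f where f: "f \<in> U" "f \<noteq> bone" using M(3) subgroup.one_closed[OF M(1)] by blast
  have fS: "f \<in> SAut G \<Sigma> X" using f(1) M(2) by blast
  have fB: "f \<in> Bij X" by (rule SAut_Bij[OF fS])
  obtain K0 where K0: "finite_index_normal G K0" "\<And>k. k \<in> K0 \<Longrightarrow> shift_map k \<odot> f = f \<odot> shift_map k"
    using fS unfolding SAut_iff by blast
  obtain x where x: "x \<in> X" "f x \<noteq> x"
    using f(2) Bij_eqI[OF fB BX.one_closed] by (metis bone_apply)
  have fx: "f x \<in> X" by (rule Bij_mem[OF fB x(1)])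
  obtain \<phi> where \<phi>: "\<phi> \<in> even_gates G \<Sigma> X" "\<phi> x = x" "\<phi> (f x) \<noteq> f x"
    by (rule separating_even_gate[OF x(1) fx]) (use x(2) in auto)
  have \<phi>B: "\<phi> \<in> Bij X" using \<phi>(1) even_gates_subset gates_Bij by blast
  let ?\<pi> = "f \<odot> \<phi> \<odot> binv f \<odot> binv \<phi>"
  have "?\<pi> \<noteq> bone"
  proof
    assume "?\<pi> = bone"
    then have "?\<pi> (\<phi> (f x)) = \<phi> (f x)" using Bij_mem[OF \<phi>B fx] by (simp add: bone_apply)
    moreover have "?\<pi> (\<phi> (f x)) = f x"
      using fB \<phi>B x(1) fx \<phi>(2) by (simp add: bmult_apply Bij_mem binv_apply)
    ultimately show False using \<phi>(3) by simp
  qed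
  moreover have "?\<pi> \<in> deep_gates U K0"
    by (rule commutator_with_element_deep[OF M(1) norm f(1) fS K0 \<phi>(1)])
  ultimately have "even_gates G \<Sigma> X \<subseteq> deep_gates U K0"
    using even_gates_subset_normalized[OF M(1) finite_index_normalD(3)[OF K0(1)] norm] by blast
  then show ?thesis by (rule L_even_subset_if_deep[OF M(1) K0(1)])
qed

text \<open>For sparse \<open>K\<close> a lattice acts at the coordinates in the support of its gate as the gate itself does.\<close>

lemma L_even_nontrivial: "L_even G \<Sigma> X \<noteq> {bone}"
proof -
  obtain x y where xy: "x \<in> X" "y \<in> X" "x \<one> \<noteq> y \<one>" by (rule two_values[OF one_closed])
  then have "x \<noteq> y" by auto
  then obtain \<phi> where \<phi>: "\<phi> \<in> even_gates G \<Sigma> X" "\<phi> x = x" "\<phi> y \<noteq> y"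
    by (rule separating_even_gate[OF xy(1,2)])
  have g: "\<phi> \<in> gates G \<Sigma> X" using \<phi>(1) even_gates_subset by blast
  obtain D where D: "supported_in D \<phi>" using g gates_iff by blast
  note sD = supported_inD[OF D]
  obtain h where h: "h \<in> carrier G" "\<phi> y h \<noteq> y h" using X_eqI[OF Bij_mem[OF sD(2) xy(2)] xy(2)] \<phi>(3) by blast
  have hD: "h \<in> D" using sD(5)[OF xy(2) h(1)] h(2) by blast
  obtain K where K: "finite_index_normal G K" and sep: "separates G K D"
    by (rule for_deep_obtain[OF for_deep_separates[OF rf sD(3,4)]])
  have s: "sparse K {\<phi>}" unfolding sparse_def using K sep D sD(3,4) by blast
  note lf = sparse_locally_finite[OF s singletonI]
  note Kn = finite_index_normalD[OF K]
  have "touching (conj_gate G X \<phi>) K h \<subseteq> {\<one>}"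
  proof
    fix k assume "k \<in> touching (conj_gate G X \<phi>) K h"
    then obtain w where k: "k \<in> K" and w: "w \<in> X" "cg \<phi> k w h \<noteq> w h" by (auto simp: touching_def)
    have kG: "k \<in> carrier G" using k Kn(3) by blast
    have "h \<in> D #> k" using supported_inD(5)[OF supported_in_cg[OF D kG] w(1) h(1)] w(2) by blast
    then obtain d where "d \<in> D" "d \<otimes> k = h" by (auto simp: r_coset_def)
    then show "k \<in> {\<one>}" using sep hD k unfolding separates_def by blast
  qed
  then have "gp \<phi> K y h = finprod BX (conj_gate G X \<phi>) {\<one>} y h"
    unfolding gate_power_eq using lim_prod_apply[OF lf xy(2) h(1), of "{\<one>}"] Kn(6) by simp
  also have "finprod BX (conj_gate G X \<phi>) {\<one>} = cg \<phi> \<one> \<odot> bone"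
    using finite_prod_insert[of "conj_gate G X \<phi>" \<one> "{}"] commuting_mono[OF locally_finiteD(3)[OF lf], of "{\<one>}"] Kn(6)
    by (simp add: finite_prod_empty)
  also have "(cg \<phi> \<one> \<odot> bone) y h = \<phi> y h"
    using cg_Bij[OF sD(2) one_closed] xy(2) h(1) sD(2)
    by (simp add: bmult_apply bone_apply cg_apply shift_one)
  finally have "gp \<phi> K y \<noteq> bone y" using h(2) xy(2) by (auto simp: bone_apply)
  moreover have "gp \<phi> K \<in> L_even G \<Sigma> X" by (rule gp_in_L_even[OF \<phi>(1) K sparse_commutes[OF s singletonI]])
  ultimately show ?thesis by auto
qed

end

section \<open>Simplicity and monoliths\<close>

theorem theorem3:
  fixes G :: "('g, 'm) monoid_scheme" and \<Sigma> :: "'s set" and X :: "('g \<Rightarrow> 's) set"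
  assumes "group G" and "residually_finite G"
    and "countable (carrier G)" and "infinite (carrier G)"
    and "finite \<Sigma>"
    and "SFT G \<Sigma> X" and "EFP G X"
  shows "(\<not> is_singleton X \<longrightarrow> is_simple_group (as_group X (L_even G \<Sigma> X))) \<and>
    L_even G \<Sigma> X = derived (BijGroup X) (L G \<Sigma> X) \<and>
    (L_even G \<Sigma> X \<lhd> as_group X (SAut G \<Sigma> X) \<and> L G \<Sigma> X \<lhd> as_group X (SAut G \<Sigma> X)) \<and>
    (\<not> is_singleton X \<longrightarrow>
       is_monolith (L_even G \<Sigma> X) (as_group X (L G \<Sigma> X)) \<and>
       is_monolith (L_even G \<Sigma> X) (as_group X (SAut G \<Sigma> X)))"
proof -
  interpret G: group G by (rule assms(1))
  interpret sft_space G \<Sigma> X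
    by unfold_locales (use assms in \<open>auto simp: SFT_def\<close>)
  let ?E = "L_even G \<Sigma> X" and ?L = "L G \<Sigma> X" and ?S = "SAut G \<Sigma> X"
  have ES: "?E \<subseteq> ?S" using L_even_subset_L L_SAut by blast
  have nE: "?E \<lhd> as_group X ?S"
    unfolding BX.normal_in_subgroup_iff[OF subgroup_SAut] using subgroup_L_even ES L_even_normalized by blast
  have nL: "?L \<lhd> as_group X ?S"
    unfolding BX.normal_in_subgroup_iff[OF subgroup_SAut] using subgroup_L L_SAut L_normalized by blast
  have nEL: "?E \<lhd> as_group X ?L"
    unfolding BX.normal_in_subgroup_iff[OF subgroup_L]
    using subgroup_L_even L_even_subset_L L_even_normalized L_SAut by blast
  have main: "is_simple_group (as_group X ?E) \<and> is_monolith ?E (as_group X ?L) \<and> is_monolith ?E (as_group X ?S)"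
    if ns: "\<not> is_singleton X"
  proof -
    interpret efp_sft G \<Sigma> X
      by unfold_locales (use assms ns in auto)
    have min: "?E \<subseteq> N" if V: "subgroup V BX" "?E \<subseteq> V" "V \<subseteq> ?S" and N: "N \<lhd> as_group X V" "N \<noteq> {bone}" for N V
    proof -
      have n: "subgroup N BX" "N \<subseteq> V" "\<And>m x. m \<in> V \<Longrightarrow> x \<in> N \<Longrightarrow> m \<odot> x \<odot> binv m \<in> N"
        using N(1) unfolding BX.normal_in_subgroup_iff[OF V(1)] by auto
      show ?thesis by (rule L_even_minimal[OF n(1) _ N(2)]) (use n V in blast)+
    qed
    have "is_simple_group (as_group X ?E)"
      unfolding is_simple_group_def
    proof (intro conjI allI impI)
      show "group (as_group X ?E)" by (rule BX.subgroup_imp_group[OF subgroup_L_even])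
      show "carrier (as_group X ?E) \<noteq> {\<one>\<^bsub>as_group X ?E\<^esub>}" using L_even_nontrivial by simp
      fix N assume N: "N \<lhd> as_group X ?E"
      have "N \<subseteq> ?E" using N unfolding BX.normal_in_subgroup_iff[OF subgroup_L_even] by blast
      then show "N = carrier (as_group X ?E) \<or> N = {\<one>\<^bsub>as_group X ?E\<^esub>}"
        using min[OF subgroup_L_even order_refl ES N] by auto
    qed
    moreover have "is_monolith ?E (as_group X ?L)"
      unfolding is_monolith_def using nEL L_even_nontrivial min[OF subgroup_L L_even_subset_L L_SAut] by simp
    moreover have "is_monolith ?E (as_group X ?S)"
      unfolding is_monolith_def using nE L_even_nontrivial min[OF subgroup_SAut ES order_refl] by simp
    ultimately show ?thesis by blast
  qed
  show ?thesis using main L_even_eq_derived nE nL by blast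
qed

end
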